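(* Let $X$ be a Kan complex. Then the Kan completion of the simplicial set $\mathrm{subdiv}(X)$ is homotopy equivalent to $X$.
   Context: For a simplicial set $X$, $\mathrm{subdiv}(X)$ is the nerve of the category $(\Delta_{\mathrm{inj}})_{/X}$ of simplices of $X$: an object is a map of simplicial sets $f:\Delta^n\to X$ ($n\ge0$, degenerate simplices allowed), and a morphism from $f:\Delta^n\to X$ to $f':\Delta^{n'}\to X$ is a map $\Delta^n\to\Delta^{n'}$ over $X$ induced by an order-preserving injection $[n]\to[n']$. The Kan completion of a simplicial set $Y$ is a Kan complex $Y'$ equipped with a weak homotopy equivalence $Y\to Y'$ (well-defined up to homotopy equivalence); for the nerve of a category it is the $\infty$-categorical localization along all morphisms. *)

theory Defs
  imports "HOL-Library.FuncSet"
begin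

section \<open>Simplicial sets\<close>

text \<open>Morphisms \<open>[m] \<rightarrow> [n]\<close> of the simplex category, with \<open>[n] = {..n}\<close>.\<close>

definition ord_maps :: "nat \<Rightarrow> nat \<Rightarrow> (nat \<Rightarrow> nat) set" where
  "ord_maps m n = {\<theta> \<in> {..m} \<rightarrow>\<^sub>E {..n}. mono_on {..m} \<theta>}"

text \<open>\<open>act X m n \<theta>\<close> is the operator \<open>\<theta>\<^sup>* : X\<^sub>n \<rightarrow> X\<^sub>m\<close> for \<open>\<theta> : [m] \<rightarrow> [n]\<close>. The sets
  \<open>simplices X n\<close> for different \<open>n\<close> may overlap as subsets of the type.\<close>

record 'a sset =
  simplices :: "nat \<Rightarrow> 'a set"
  act :: "nat \<Rightarrow> nat \<Rightarrow> (nat \<Rightarrow> nat) \<Rightarrow> 'a \<Rightarrow> 'a"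

definition simplicial_set :: "'a sset \<Rightarrow> bool" where
  "simplicial_set X \<longleftrightarrow>
     (\<forall>m n. \<forall>\<theta>\<in>ord_maps m n. \<forall>x\<in>simplices X n. act X m n \<theta> x \<in> simplices X m) \<and>
     (\<forall>n. \<forall>x\<in>simplices X n. act X n n (restrict id {..n}) x = x) \<and>
     (\<forall>k m n. \<forall>\<eta>\<in>ord_maps k m. \<forall>\<theta>\<in>ord_maps m n. \<forall>x\<in>simplices X n.
        act X k m \<eta> (act X m n \<theta> x) = act X k n (compose {..k} \<theta> \<eta>) x)"

text \<open>The components of a map are extensional functions, so equality of maps is
  equality of terms.\<close>

definition sset_hom :: "'a sset \<Rightarrow> 'b sset \<Rightarrow> (nat \<Rightarrow> 'a \<Rightarrow> 'b) set" where
  "sset_hom X Y = {f. (\<forall>n. f n \<in> simplices X n \<rightarrow>\<^sub>E simplices Y n) \<and>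
     (\<forall>m n. \<forall>\<theta>\<in>ord_maps m n. \<forall>x\<in>simplices X n.
        f m (act X m n \<theta> x) = act Y m n \<theta> (f n x))}"

definition sset_id :: "'a sset \<Rightarrow> nat \<Rightarrow> 'a \<Rightarrow> 'a" where
  "sset_id X = (\<lambda>n. restrict id (simplices X n))"

definition sset_comp ::
  "'a sset \<Rightarrow> (nat \<Rightarrow> 'b \<Rightarrow> 'c) \<Rightarrow> (nat \<Rightarrow> 'a \<Rightarrow> 'b) \<Rightarrow> nat \<Rightarrow> 'a \<Rightarrow> 'c" where
  "sset_comp X g f = (\<lambda>n. compose (simplices X n) (g n) (f n))"

definition sset_prod :: "'a sset \<Rightarrow> 'b sset \<Rightarrow> ('a \<times> 'b) sset" where
  "sset_prod X Y = \<lparr> simplices = (\<lambda>n. simplices X n \<times> simplices Y n),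
     act = (\<lambda>m n \<theta> (x, y). (act X m n \<theta> x, act Y m n \<theta> y)) \<rparr>"

definition std_simplex :: "nat \<Rightarrow> (nat \<Rightarrow> nat) sset" where
  "std_simplex n = \<lparr> simplices = (\<lambda>m. ord_maps m n),
     act = (\<lambda>k m \<eta> \<sigma>. compose {..k} \<sigma> \<eta>) \<rparr>"

definition std_simplex_map :: "nat \<Rightarrow> (nat \<Rightarrow> nat) \<Rightarrow> nat \<Rightarrow> (nat \<Rightarrow> nat) \<Rightarrow> (nat \<Rightarrow> nat)" where
  "std_simplex_map n \<alpha> = (\<lambda>m. \<lambda>\<sigma>\<in>ord_maps m n. compose {..m} \<alpha> \<sigma>)"

text \<open>The horn \<open>\<Lambda>\<^sup>n\<^sub>i\<close>: the simplices of \<open>\<Delta>\<^sup>n\<close> that miss some vertex other than \<open>i\<close>.\<close>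

definition horn :: "nat \<Rightarrow> nat \<Rightarrow> (nat \<Rightarrow> nat) sset" where
  "horn n i = \<lparr> simplices = (\<lambda>m. {\<sigma> \<in> ord_maps m n. \<not> {..n} - {i} \<subseteq> \<sigma> ` {..m}}),
     act = act (std_simplex n) \<rparr>"

definition kan_complex :: "'a sset \<Rightarrow> bool" where
  "kan_complex X \<longleftrightarrow> simplicial_set X \<and>
     (\<forall>n\<ge>1. \<forall>i\<le>n. \<forall>f\<in>sset_hom (horn n i) X.
        \<exists>g\<in>sset_hom (std_simplex n) X. \<forall>m. \<forall>\<sigma>\<in>simplices (horn n i) m. g m \<sigma> = f m \<sigma>)"

section \<open>Homotopy and weak homotopy equivalences\<close>

text \<open>\<open>const_simplex n i\<close> is the degenerate \<open>n\<close>-simplex of \<open>\<Delta>\<^sup>1\<close> at the vertex \<open>i\<close>.\<close>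

definition const_simplex :: "nat \<Rightarrow> nat \<Rightarrow> (nat \<Rightarrow> nat)" where
  "const_simplex n i = (\<lambda>_\<in>{..n}. i)"

definition elementary_homotopic ::
  "'a sset \<Rightarrow> 'b sset \<Rightarrow> (nat \<Rightarrow> 'a \<Rightarrow> 'b) \<Rightarrow> (nat \<Rightarrow> 'a \<Rightarrow> 'b) \<Rightarrow> bool" where
  "elementary_homotopic X Y f g \<longleftrightarrow> f \<in> sset_hom X Y \<and> g \<in> sset_hom X Y \<and>
     (\<exists>h\<in>sset_hom (sset_prod (std_simplex 1) X) Y. \<forall>n. \<forall>x\<in>simplices X n.
        h n (const_simplex n 0, x) = f n x \<and> h n (const_simplex n 1, x) = g n x)"

text \<open>Maps are homotopic if they lie in the same connected component of \<open>Fun(X, Y)\<close>. When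
  \<open>Y\<close> is a Kan complex a single elementary homotopy suffices.\<close>

definition sset_homotopic ::
  "'a sset \<Rightarrow> 'b sset \<Rightarrow> (nat \<Rightarrow> 'a \<Rightarrow> 'b) \<Rightarrow> (nat \<Rightarrow> 'a \<Rightarrow> 'b) \<Rightarrow> bool" where
  "sset_homotopic X Y f g \<longleftrightarrow> f \<in> sset_hom X Y \<and> g \<in> sset_hom X Y \<and>
     equivclp (elementary_homotopic X Y) f g"

definition homotopy_classes :: "'a sset \<Rightarrow> 'b sset \<Rightarrow> (nat \<Rightarrow> 'a \<Rightarrow> 'b) set set" where
  "homotopy_classes X Y = sset_hom X Y // {(f, g). sset_homotopic X Y f g}"

definition homotopy_equivalence :: "'a sset \<Rightarrow> 'b sset \<Rightarrow> (nat \<Rightarrow> 'a \<Rightarrow> 'b) \<Rightarrow> bool" where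
  "homotopy_equivalence X Y f \<longleftrightarrow> f \<in> sset_hom X Y \<and>
     (\<exists>g\<in>sset_hom Y X. sset_homotopic X X (sset_comp X g f) (sset_id X) \<and>
                       sset_homotopic Y Y (sset_comp Y f g) (sset_id Y))"

definition homotopy_equivalent :: "'a sset \<Rightarrow> 'b sset \<Rightarrow> bool" where
  "homotopy_equivalent X Y \<longleftrightarrow> (\<exists>f. homotopy_equivalence X Y f)"

text \<open>\<open>f : Y \<rightarrow> Z\<close> is a weak homotopy equivalence if precomposition with \<open>f\<close> induces a
  bijection \<open>\<pi>\<^sub>0 Fun(Z, K) \<rightarrow> \<pi>\<^sub>0 Fun(Y, K)\<close> for every Kan complex \<open>K\<close>.

  A HOL formula cannot quantify over all types, so \<open>K\<close> has its simplices in the type below,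
  whose cardinality is at least \<open>2\<^sup>\<kappa>\<close> for \<open>\<kappa> = max(\<aleph>\<^sub>0, |Y|, |Z|)\<close>. This loses nothing: the type
  contains copies of fibrant replacements of \<open>Y\<close> and \<open>Z\<close> (both the \<open>Ex\<^sup>\<infinity>\<close> construction and
  the singular complex of the realization have at most \<open>2\<^sup>\<kappa>\<close> simplices), and by the Yoneda
  lemma in the homotopy category these two test objects already detect whether \<open>f\<close> is a
  weak homotopy equivalence.\<close>

type_synonym ('a, 'b) test_simplex = "(nat + 'a + 'b) set"

definition weak_homotopy_equivalence :: "'a sset \<Rightarrow> 'b sset \<Rightarrow> (nat \<Rightarrow> 'a \<Rightarrow> 'b) \<Rightarrow> bool" where
  "weak_homotopy_equivalence Y Z f \<longleftrightarrow> f \<in> sset_hom Y Z \<and>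
     (\<forall>K :: ('a, 'b) test_simplex sset. kan_complex K \<longrightarrow>
        bij_betw (\<lambda>C. {u. \<exists>v\<in>C. sset_homotopic Y K (sset_comp Y v f) u})
          (homotopy_classes Z K) (homotopy_classes Y K))"

definition kan_completion :: "'a sset \<Rightarrow> 'b sset \<Rightarrow> (nat \<Rightarrow> 'a \<Rightarrow> 'b) \<Rightarrow> bool" where
  "kan_completion Y Y' i \<longleftrightarrow> kan_complex Y' \<and> weak_homotopy_equivalence Y Y' i"

section \<open>Categories, nerves and the subdivision\<close>

text \<open>\<open>Comp C x y z g f\<close> is the composite \<open>g \<circ> f\<close> of \<open>f : x \<rightarrow> y\<close> and \<open>g : y \<rightarrow> z\<close>.\<close>

record ('o, 'm) cat =
  Obj :: "'o set"
  Hom :: "'o \<Rightarrow> 'o \<Rightarrow> 'm set"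
  Id :: "'o \<Rightarrow> 'm"
  Comp :: "'o \<Rightarrow> 'o \<Rightarrow> 'o \<Rightarrow> 'm \<Rightarrow> 'm \<Rightarrow> 'm"

definition category :: "('o, 'm) cat \<Rightarrow> bool" where
  "category C \<longleftrightarrow>
     (\<forall>x\<in>Obj C. Id C x \<in> Hom C x x) \<and>
     (\<forall>x\<in>Obj C. \<forall>y\<in>Obj C. \<forall>z\<in>Obj C. \<forall>f\<in>Hom C x y. \<forall>g\<in>Hom C y z.
        Comp C x y z g f \<in> Hom C x z) \<and>
     (\<forall>x\<in>Obj C. \<forall>y\<in>Obj C. \<forall>f\<in>Hom C x y.
        Comp C x x y f (Id C x) = f \<and> Comp C x y y (Id C y) f = f) \<and>
     (\<forall>w\<in>Obj C. \<forall>x\<in>Obj C. \<forall>y\<in>Obj C. \<forall>z\<in>Obj C.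
        \<forall>f\<in>Hom C w x. \<forall>g\<in>Hom C x y. \<forall>h\<in>Hom C y z.
        Comp C w x z (Comp C x y z h g) f = Comp C w y z h (Comp C w x y g f))"

text \<open>An \<open>n\<close>-simplex of the nerve is a functor \<open>(c, a)\<close> from the poset \<open>[n]\<close>: \<open>c\<close> is its action
  on objects, and \<open>a (i, j)\<close> is the image of the arrow \<open>i \<le> j\<close>.\<close>

definition poset_arrows :: "nat \<Rightarrow> (nat \<times> nat) set" where
  "poset_arrows n = {(i, j). i \<le> j \<and> j \<le> n}"

definition nerve :: "('o, 'm) cat \<Rightarrow> ((nat \<Rightarrow> 'o) \<times> (nat \<times> nat \<Rightarrow> 'm)) sset" where
  "nerve C = \<lparr>
     simplices = (\<lambda>n. {(c, a). c \<in> {..n} \<rightarrow>\<^sub>E Obj C \<and> a \<in> extensional (poset_arrows n) \<and>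
        (\<forall>(i, j)\<in>poset_arrows n. a (i, j) \<in> Hom C (c i) (c j)) \<and>
        (\<forall>i\<le>n. a (i, i) = Id C (c i)) \<and>
        (\<forall>i j k. i \<le> j \<and> j \<le> k \<and> k \<le> n \<longrightarrow>
           a (i, k) = Comp C (c i) (c j) (c k) (a (j, k)) (a (i, j)))}),
     act = (\<lambda>m n \<theta> (c, a).
        (compose {..m} c \<theta>, \<lambda>(i, j)\<in>poset_arrows m. a (\<theta> i, \<theta> j))) \<rparr>"

text \<open>The category \<open>(\<Delta>\<^sub>i\<^sub>n\<^sub>j)\<^sub>/\<^sub>X\<close>. A morphism is recorded as the order-preserving injection
  \<open>\<alpha> : [n] \<rightarrow> [n']\<close>; the induced map \<open>\<Delta>\<^sup>n \<rightarrow> \<Delta>\<^sup>n\<^sup>'\<close> determines \<open>\<alpha>\<close>.\<close>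

type_synonym 'a simplex_obj = "nat \<times> (nat \<Rightarrow> (nat \<Rightarrow> nat) \<Rightarrow> 'a)"

definition simplex_category :: "'a sset \<Rightarrow> ('a simplex_obj, nat \<Rightarrow> nat) cat" where
  "simplex_category X = \<lparr>
     Obj = {(n, f). f \<in> sset_hom (std_simplex n) X},
     Hom = (\<lambda>(n, f) (n', f'). {\<alpha> \<in> ord_maps n n'. inj_on \<alpha> {..n} \<and>
        sset_comp (std_simplex n) f' (std_simplex_map n \<alpha>) = f}),
     Id = (\<lambda>(n, f). restrict id {..n}),
     Comp = (\<lambda>(n, f) y z \<beta> \<alpha>. compose {..n} \<beta> \<alpha>) \<rparr>"

definition subdiv ::
  "'a sset \<Rightarrow> ((nat \<Rightarrow> 'a simplex_obj) \<times> (nat \<times> nat \<Rightarrow> (nat \<Rightarrow> nat))) sset" where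
  "subdiv X = nerve (simplex_category X)"

section \<open>The constructions are well-defined\<close>

lemma ord_maps_comp: "\<eta> \<in> ord_maps k m \<Longrightarrow> \<theta> \<in> ord_maps m n \<Longrightarrow> compose {..k} \<theta> \<eta> \<in> ord_maps k n"
  unfolding ord_maps_def by (auto simp: compose_def mono_on_def PiE_def Pi_def)

lemma ord_maps_id: "restrict id {..n} \<in> ord_maps n n"
  unfolding ord_maps_def by (auto simp: mono_on_def)

lemma ord_maps_ext: "\<theta> \<in> ord_maps m n \<Longrightarrow> \<theta> \<in> extensional {..m}"
  unfolding ord_maps_def by (auto simp: PiE_def)

lemma ord_le: "\<theta> \<in> ord_maps m n \<Longrightarrow> i \<le> m \<Longrightarrow> \<theta> i \<le> n"
  unfolding ord_maps_def by auto

lemma ord_mono: "\<theta> \<in> ord_maps m n \<Longrightarrow> i \<le> j \<Longrightarrow> j \<le> m \<Longrightarrow> \<theta> i \<le> \<theta> j"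
  unfolding ord_maps_def by (auto simp: mono_on_def)

lemma compose_ord_assoc: "\<eta> \<in> ord_maps k m \<Longrightarrow>
  compose {..k} (compose {..m} \<sigma> \<theta>) \<eta> = compose {..k} \<sigma> (compose {..k} \<theta> \<eta>)"
  by (auto simp: compose_def fun_eq_iff ord_le)

lemma compose_ord_id_right: "\<sigma> \<in> extensional {..n} \<Longrightarrow> compose {..n} \<sigma> (restrict id {..n}) = \<sigma>"
  by (auto simp: compose_def fun_eq_iff extensional_def)

lemma compose_ord_id_left: "\<sigma> \<in> ord_maps m n \<Longrightarrow> compose {..m} (restrict id {..n}) \<sigma> = \<sigma>"
  unfolding ord_maps_def by (auto simp: compose_def fun_eq_iff extensional_def PiE_def Pi_def)

lemma simplicial_set_std_simplex: "simplicial_set (std_simplex n)"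
  unfolding simplicial_set_def std_simplex_def
  by (auto simp: ord_maps_comp compose_ord_assoc intro!: compose_ord_id_right simp: ord_maps_ext)

lemma simplicial_set_horn: "simplicial_set (horn n i)"
proof -
  have "compose {..k} \<sigma> \<theta> ` {..k} \<subseteq> \<sigma> ` {..m}" if "\<theta> \<in> ord_maps k m" for k m \<sigma> \<theta>
    using that by (auto simp: compose_def ord_le)
  then have "\<not> {..n} - {i} \<subseteq> compose {..k} \<sigma> \<theta> ` {..k}"
    if "\<theta> \<in> ord_maps k m" "\<not> {..n} - {i} \<subseteq> \<sigma> ` {..m}" for k m \<sigma> \<theta>
    using that by (meson order_trans)
  then show ?thesis
    unfolding simplicial_set_def std_simplex_def horn_def
    by (auto simp: ord_maps_comp compose_ord_assoc intro!: compose_ord_id_right ord_maps_ext)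
qed

lemma simplicial_set_prod: "simplicial_set X \<Longrightarrow> simplicial_set Y \<Longrightarrow> simplicial_set (sset_prod X Y)"
  unfolding simplicial_set_def sset_prod_def by auto

lemma simplicial_set_nerve: assumes "category C" shows "simplicial_set (nerve C)"
  unfolding simplicial_set_def
proof (intro conjI allI ballI)
  fix m n \<theta> x assume t: "\<theta> \<in> ord_maps m n" and x: "x \<in> simplices (nerve C) n"
  obtain c a where xe: "x = (c,a)" by force
  show "act (nerve C) m n \<theta> x \<in> simplices (nerve C) m"
    using x t unfolding xe nerve_def poset_arrows_def
    by (auto simp: compose_def ord_le ord_mono PiE_def Pi_def)
next
  fix n x assume x: "x \<in> simplices (nerve C) n"
  obtain c a where xe: "x = (c,a)" by force
  show "act (nerve C) n n (restrict id {..n}) x = x"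
    using x unfolding xe nerve_def
    by (auto simp: compose_ord_id_right PiE_def fun_eq_iff extensional_def poset_arrows_def)
next
  fix k m n \<eta> \<theta> x assume t: "\<eta> \<in> ord_maps k m" "\<theta> \<in> ord_maps m n" and x: "x \<in> simplices (nerve C) n"
  obtain c a where xe: "x = (c,a)" by force
  show "act (nerve C) k m \<eta> (act (nerve C) m n \<theta> x) = act (nerve C) k n (compose {..k} \<theta> \<eta>) x"
    using x t unfolding xe nerve_def
    by (auto simp: compose_ord_assoc fun_eq_iff poset_arrows_def ord_le ord_mono compose_def)
qed

lemma category_simplex_category: assumes "simplicial_set X" shows "category (simplex_category X)"
proof -
  have 1: "sset_comp (std_simplex n) f (std_simplex_map n (restrict id {..n})) = f"
    if "f \<in> sset_hom (std_simplex n) X" for n f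
  proof (intro ext)
    fix m \<sigma> 
    have e: "f m \<in> extensional (ord_maps m n)" using that by (auto simp: sset_hom_def std_simplex_def PiE_def)
    show "sset_comp (std_simplex n) f (std_simplex_map n (restrict id {..n})) m \<sigma> = f m \<sigma>"
      using e by (auto simp: sset_comp_def compose_def[of "ord_maps _ _"] std_simplex_def std_simplex_map_def compose_ord_id_left extensional_def)
  qed
  have 2: "sset_comp (std_simplex n) h (std_simplex_map n (compose {..n} \<beta> \<alpha>))
     = sset_comp (std_simplex n) (sset_comp (std_simplex n') h (std_simplex_map n' \<beta>)) (std_simplex_map n \<alpha>)"
    if "\<alpha> \<in> ord_maps n n'" for n n' \<alpha> \<beta> and h :: "nat \<Rightarrow> (nat \<Rightarrow> nat) \<Rightarrow> 'a"
    using that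
    by (auto simp: sset_comp_def compose_def[of "ord_maps _ _"] std_simplex_def std_simplex_map_def fun_eq_iff compose_ord_assoc ord_maps_comp)
  show ?thesis
    unfolding category_def simplex_category_def
    apply (auto simp: ord_maps_id 1 ord_maps_comp 2 compose_ord_assoc compose_ord_id_left intro!: compose_ord_id_right simp: ord_maps_ext)
    by (auto simp: inj_on_def compose_def ord_le)
qed

lemma simplicial_set_subdiv: "simplicial_set X \<Longrightarrow> simplicial_set (subdiv X)"
  unfolding subdiv_def by (intro simplicial_set_nerve category_simplex_category)

lemma sset_id_hom: "simplicial_set X \<Longrightarrow> sset_id X \<in> sset_hom X X"
  by (auto simp: sset_hom_def sset_id_def simplicial_set_def)
lemma sset_comp_hom: "simplicial_set X \<Longrightarrow> f \<in> sset_hom X Y \<Longrightarrow> g \<in> sset_hom Y Z \<Longrightarrow> sset_comp X g f \<in> sset_hom X Z"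
  apply (auto simp: sset_hom_def sset_comp_def simplicial_set_def compose_def)
  apply (metis PiE_mem) by (metis PiE_mem)

end

theory Submission
  imports Defs
begin

text \<open>The last vertex map \<open>l : subdiv X \<rightarrow> X\<close> exhibits \<open>X\<close> itself as the Kan completion; the uniqueness of Kan
  completions then follows from the Yoneda lemma in the homotopy category. For a Kan complex \<open>K\<close>, a map
  \<open>g : subdiv X \<rightarrow> K\<close> is the same as a map of semisimplicial sets \<open>X \<rightarrow> Ex(K)\<close>, since the morphisms of the
  category of simplices are injective. Filling horns in the mapping cylinders of the last vertex maps
  \<open>sd \<Delta>\<^sup>n \<rightarrow> \<Delta>\<^sup>n\<close>, one first deforms it into a semisimplicial map \<open>\<phi> : X \<rightarrow> K\<close>. One then deforms \<open>\<phi>\<close> into a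
  simplicial map \<open>f\<close>, by induction over the nondegenerate simplices \<open>\<Delta>\<^sup>m \<rightarrow> X\<close>; the point is that the
  extension problem for all degeneracies of such a simplex at once is solved by a deformation retraction
  which is natural only for injective operators, together with the homotopy extension property. This gives
  \<open>g \<simeq> f \<circ> l\<close>, and the relative form of the construction over \<open>\<Delta>\<^sup>1 \<times> X\<close> shows that the class of \<open>f\<close> is
  determined by that of \<open>g\<close>.\<close>

text \<open>Morphisms of the simplex category are injective, so \<open>subdiv X\<close> does not
  relate a degenerate simplex of \<open>X\<close> to the simplex it comes from. A map on
  \<open>subdiv X\<close> carries no information about degeneracies, and the difficulty is to create
  compatibility with them. The device is a second coordinate \<open>t\<close>, a simplex of
  \<open>\<Delta>\<^sup>1\<close>, attached to every simplex: at vertices of type 0 only injective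
  operators are respected, at vertices of type 1 all of them are. A word with repeated letters of
  type 1 is determined by the word in which these repetitions are removed, and the words without
  such repetitions are closed under injective operators, so values on them can be chosen dimension
  by dimension. All choices reduce to horn filling in explicit complexes of finite chains; no
  fibrant replacement or realization enters. Both extension theorems are relative to a subcomplex,
  because injectivity on homotopy classes calls for a resolution over
  \<open>\<Delta>\<^sup>1 \<times> X\<close> with prescribed ends. The comparison along the last
  vertex map holds for Kan complexes over an arbitrary type; the final uniqueness argument moves
  complexes into the type of test simplices.\<close>

section \<open>Order-preserving maps, faces and sections\<close>

lemma ord_mapsI:
  assumes "\<And>i. i \<le> m \<Longrightarrow> \<theta> i \<le> n" "\<And>i j. i \<le> j \<Longrightarrow> j \<le> m \<Longrightarrow> \<theta> i \<le> \<theta> j" "\<theta> \<in> extensional {..m}"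
  shows "\<theta> \<in> ord_maps m n"
  using assms unfolding ord_maps_def by (auto simp: mono_on_def PiE_def)

lemma ord_maps_eqI:
  assumes "\<theta> \<in> extensional {..m}" "\<eta> \<in> extensional {..m}" "\<And>i. i \<le> m \<Longrightarrow> \<theta> i = \<eta> i"
  shows "\<theta> = \<eta>"
  using assms by (intro extensionalityI[of \<theta> "{..m}" \<eta>]) auto

definition inj_maps :: "nat \<Rightarrow> nat \<Rightarrow> (nat \<Rightarrow> nat) set" where
  "inj_maps m n = {\<alpha> \<in> ord_maps m n. inj_on \<alpha> {..m}}"

lemma inj_maps_ord: "\<alpha> \<in> inj_maps m n \<Longrightarrow> \<alpha> \<in> ord_maps m n"
  by (simp add: inj_maps_def)

lemma inj_maps_less:
  assumes "\<alpha> \<in> inj_maps m n" "i < j" "j \<le> m"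
  shows "\<alpha> i < \<alpha> j"
proof -
  have "\<alpha> i \<le> \<alpha> j" using assms by (intro ord_mono[of \<alpha> m n]) (auto simp: inj_maps_def)
  moreover have "\<alpha> i \<noteq> \<alpha> j" using assms by (auto simp: inj_maps_def inj_on_def)
  ultimately show ?thesis by simp
qed

lemma inj_maps_less_iff: "\<alpha> \<in> inj_maps m n \<Longrightarrow> i \<le> m \<Longrightarrow> j \<le> m \<Longrightarrow> \<alpha> i < \<alpha> j \<longleftrightarrow> i < j"
  by (metis inj_maps_less linorder_cases order_less_asym less_irrefl)

lemma inj_maps_le_iff: "\<alpha> \<in> inj_maps m n \<Longrightarrow> i \<le> m \<Longrightarrow> j \<le> m \<Longrightarrow> \<alpha> i \<le> \<alpha> j \<longleftrightarrow> i \<le> j"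
  by (meson inj_maps_less_iff not_le)

lemma inj_maps_eq_iff: "\<alpha> \<in> inj_maps m n \<Longrightarrow> i \<le> m \<Longrightarrow> j \<le> m \<Longrightarrow> \<alpha> i = \<alpha> j \<longleftrightarrow> i = j"
  by (metis inj_maps_less linorder_neqE_nat less_irrefl)

lemma inj_mapsI:
  assumes "\<And>i. i \<le> m \<Longrightarrow> \<alpha> i \<le> n" "\<And>i j. i < j \<Longrightarrow> j \<le> m \<Longrightarrow> \<alpha> i < \<alpha> j" "\<alpha> \<in> extensional {..m}"
  shows "\<alpha> \<in> inj_maps m n"
proof -
  have "\<alpha> \<in> ord_maps m n"
    using assms by (intro ord_mapsI) (auto simp: le_less)
  moreover have "inj_on \<alpha> {..m}"
    using assms(2) by (intro linorder_inj_onI) (auto dest: less_imp_neq)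
  ultimately show ?thesis by (simp add: inj_maps_def)
qed

lemma inj_maps_comp:
  "\<beta> \<in> inj_maps k m \<Longrightarrow> \<alpha> \<in> inj_maps m n \<Longrightarrow> compose {..k} \<alpha> \<beta> \<in> inj_maps k n"
proof (rule inj_mapsI)
  assume a: "\<beta> \<in> inj_maps k m" "\<alpha> \<in> inj_maps m n"
  have b: "\<beta> i \<le> m" if "i \<le> k" for i using a that by (meson inj_maps_ord ord_le)
  show "compose {..k} \<alpha> \<beta> i \<le> n" if "i \<le> k" for i
    using a b that by (auto simp: compose_def intro: ord_le inj_maps_ord)
  show "compose {..k} \<alpha> \<beta> i < compose {..k} \<alpha> \<beta> j" if "i < j" "j \<le> k" for i j
    using that inj_maps_less[OF a(2) inj_maps_less[OF a(1) that] b[OF that(2)]] by (simp add: compose_def)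
qed (simp add: compose_def)

lemma inj_maps_card: "\<alpha> \<in> inj_maps m n \<Longrightarrow> m \<le> n"
  using card_inj_on_le[of \<alpha> "{..m}" "{..n}"]
  by (auto simp: inj_maps_def dest: ord_le)

text \<open>Such a map is squeezed from both sides: strict growth gives
  \<open>i \<le> \<theta> i\<close> when counting up from 0 and \<open>\<theta> i \<le> i\<close>
  when counting down from \<open>n\<close>.\<close>

lemma surj_self_id:
  assumes "\<theta> \<in> ord_maps n n" "\<theta> ` {..n} = {..n}"
  shows "\<theta> = restrict id {..n}"
proof -
  have inj: "inj_on \<theta> {..n}"
    using assms(2) by (simp add: eq_card_imp_inj_on)
  then have a: "\<theta> \<in> inj_maps n n" using assms(1) by (simp add: inj_maps_def)
  have ge: "i \<le> \<theta> i" if "i \<le> n" for i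
    using that
  proof (induction i)
    case (Suc i)
    then show ?case using inj_maps_less[OF a, of i "Suc i"] by simp
  qed simp
  have le: "\<theta> (n - i) \<le> n - i" if "i \<le> n" for i
    using that
  proof (induction i)
    case 0
    then show ?case using assms(1) by (simp add: ord_le)
  next
    case (Suc i)
    then have "\<theta> (n - Suc i) < \<theta> (n - i)" by (intro inj_maps_less[OF a]) auto
    with Suc show ?case by simp
  qed
  show ?thesis
  proof (rule ord_maps_eqI[of _ n])
    show "\<theta> i = restrict id {..n} i" if "i \<le> n" for i
      using ge[OF that] le[of "n - i"] that by simp
  qed (use assms ord_maps_ext in auto)
qed

lemma inj_self_id:
  assumes "\<alpha> \<in> inj_maps n n"
  shows "\<alpha> = restrict id {..n}"
proof (rule surj_self_id)
  show "\<alpha> \<in> ord_maps n n" using assms by (rule inj_maps_ord)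
  then have "\<alpha> ` {..n} \<subseteq> {..n}" by (auto dest: ord_le)
  then show "\<alpha> ` {..n} = {..n}"
    using assms by (intro endo_inj_surj) (auto simp: inj_maps_def)
qed

definition coface :: "nat \<Rightarrow> nat \<Rightarrow> nat \<Rightarrow> nat" where
  "coface n i = (\<lambda>l\<in>{..n}. if l < i then l else Suc l)"

definition codegen :: "nat \<Rightarrow> nat \<Rightarrow> nat \<Rightarrow> nat" where
  "codegen n i = (\<lambda>l\<in>{..Suc n}. if l \<le> i then l else l - 1)"

lemma coface_inj: "coface n i \<in> inj_maps n (Suc n)"
  by (rule inj_mapsI) (auto simp: coface_def)

lemma codegen_ord: "i \<le> n \<Longrightarrow> codegen n i \<in> ord_maps (Suc n) n"
  by (rule ord_mapsI) (auto simp: codegen_def)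

text \<open>Lowering all values above a missing vertex by one closes the gap. This is how operators
  that are not surjective are seen to land in a smaller skeleton.\<close>

lemma nonsurj_factor:
  assumes "\<theta> \<in> ord_maps k n" "\<theta> ` {..k} \<noteq> {..n}"
  obtains m i \<theta>' where "n = Suc m" "\<theta>' \<in> ord_maps k m" "\<theta> = compose {..k} (coface m i) \<theta>'"
proof -
  obtain i where i: "i \<le> n" "i \<notin> \<theta> ` {..k}"
    using assms by (force dest: ord_le)
  have n: "n \<noteq> 0"
    using i ord_le[OF assms(1), of 0] by (auto intro!: image_eqI[of _ _ 0])
  then obtain m where m: "n = Suc m" by (cases n) auto
  define \<theta>' where "\<theta>' = (\<lambda>l\<in>{..k}. if \<theta> l < i then \<theta> l else \<theta> l - 1)"
  have ne: "\<theta> l \<noteq> i" if "l \<le> k" for l using i that by auto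
  have "\<theta>' \<in> ord_maps k m"
  proof (rule ord_mapsI)
    show "\<theta>' l \<le> m" if "l \<le> k" for l
      using ord_le[OF assms(1) that] ne[OF that] i m that by (auto simp: \<theta>'_def)
    show "\<theta>' l \<le> \<theta>' l'" if "l \<le> l'" "l' \<le> k" for l l'
      using ord_mono[OF assms(1) that] ne[of l] that by (auto simp: \<theta>'_def)
  qed (auto simp: \<theta>'_def)
  moreover have "\<theta> = compose {..k} (coface m i) \<theta>'"
  proof (rule ord_maps_eqI[of _ k])
    show "\<theta> l = compose {..k} (coface m i) \<theta>' l" if "l \<le> k" for l
      using ord_le[OF assms(1) that] ne[OF that] i m that by (auto simp: \<theta>'_def coface_def compose_def)
  qed (use assms ord_maps_ext in auto)
  ultimately show ?thesis using m that by blast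
qed

text \<open>The section can be made to pass through any prescribed point. This freedom is what lets
  \<open>skel_unique\<close> recover a surjection from its sections.\<close>

lemma surj_section:
  assumes "\<theta> \<in> ord_maps k n" "\<theta> ` {..k} = {..n}" "i \<le> k"
  obtains s where "s \<in> inj_maps n k" "compose {..n} \<theta> s = restrict id {..n}" "s (\<theta> i) = i"
proof -
  define s where "s = (\<lambda>j\<in>{..n}. if j = \<theta> i then i else (SOME l. l \<le> k \<and> \<theta> l = j))"
  have s: "s j \<le> k \<and> \<theta> (s j) = j" if "j \<le> n" for j
  proof (cases "j = \<theta> i")
    case False
    have "\<exists>l. l \<le> k \<and> \<theta> l = j" using assms(2) that by (metis atMost_iff imageE)
    from someI_ex[OF this] show ?thesis using False that by (simp add: s_def)
  qed (use assms that in \<open>simp add: s_def\<close>)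
  have "s \<in> inj_maps n k"
  proof (rule inj_mapsI)
    show "s a < s b" if "a < b" "b \<le> n" for a b
    proof (rule ccontr)
      assume "\<not> s a < s b"
      then have "\<theta> (s b) \<le> \<theta> (s a)" using s[of a] that by (intro ord_mono[OF assms(1)]) auto
      then show False using s[of a] s[of b] that by auto
    qed
  qed (use s in \<open>auto simp: s_def\<close>)
  moreover have "compose {..n} \<theta> s = restrict id {..n}"
    using s by (auto simp: compose_def)
  moreover have "s (\<theta> i) = i" using ord_le[OF assms(1,3)] by (simp add: s_def)
  ultimately show ?thesis using that by blast
qed

section \<open>Increasing enumerations\<close>

text \<open>As an element of \<open>inj_maps (card U - 1) n\<close> this is the face operator of the
  face spanned by \<open>U\<close>; the shift by one comes from \<open>[m]\<close> having
  \<open>m + 1\<close> elements.\<close>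

definition enum_set :: "nat set \<Rightarrow> nat \<Rightarrow> nat" where
  "enum_set U = (\<lambda>i\<in>{..card U - 1}. sorted_list_of_set U ! i)"

text \<open>On \<open>U\<close> this inverts \<open>enum_set U\<close>. Written as a count it is
  monotone on all numbers and strictly increasing at elements of \<open>U\<close>.\<close>

definition rank_in :: "nat set \<Rightarrow> nat \<Rightarrow> nat" where
  "rank_in U x = card {y \<in> U. y < x}"

lemma enum_set_in:
  assumes "finite U" "U \<noteq> {}" "i \<le> card U - 1"
  shows "enum_set U i \<in> U"
proof -
  have "i < length (sorted_list_of_set U)" using assms card_gt_0_iff[of U] by auto
  then have "sorted_list_of_set U ! i \<in> U" using assms(1) nth_mem by (metis set_sorted_list_of_set)
  then show ?thesis using assms by (simp add: enum_set_def)
qed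

lemma enum_set_less:
  assumes "finite U" "i < j" "j \<le> card U - 1"
  shows "enum_set U i < enum_set U j"
proof -
  have "j < length (sorted_list_of_set U)" using assms by auto
  then show ?thesis
    using assms sorted_wrt_nth_less[OF strict_sorted_list_of_set, of i j U] by (auto simp: enum_set_def)
qed

lemma enum_set_surj:
  assumes "finite U" "U \<noteq> {}"
  shows "enum_set U ` {..card U - 1} = U"
proof (rule card_subset_eq[OF assms(1)])
  show "enum_set U ` {..card U - 1} \<subseteq> U" using enum_set_in[OF assms] by auto
  have "inj_on (enum_set U) {..card U - 1}"
    using enum_set_less[OF assms(1)] by (auto intro!: linorder_inj_onI dest: less_imp_neq)
  then show "card (enum_set U ` {..card U - 1}) = card U"
    using assms card_gt_0_iff[of U] by (simp add: card_image)
qed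

lemma enum_set_inj_maps:
  assumes "finite U" "U \<noteq> {}" "U \<subseteq> {..n}"
  shows "enum_set U \<in> inj_maps (card U - 1) n"
  using enum_set_in[OF assms(1,2)] enum_set_less[OF assms(1)] assms(3)
  by (intro inj_mapsI) (auto simp: enum_set_def)

lemma rank_enum_set:
  assumes "finite U" "U \<noteq> {}" "i \<le> card U - 1"
  shows "rank_in U (enum_set U i) = i"
proof -
  have "{y \<in> U. y < enum_set U i} = enum_set U ` {..<i}"
  proof
    show "{y \<in> U. y < enum_set U i} \<subseteq> enum_set U ` {..<i}"
    proof clarsimp
      fix y assume y: "y \<in> U" "y < enum_set U i"
      then obtain j where j: "j \<le> card U - 1" "y = enum_set U j"
        using enum_set_surj[OF assms(1,2)] by blast
      then have "j < i"
        using y enum_set_less[OF assms(1), of i j] by (metis less_asym linorder_neqE_nat)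
      then show "y \<in> enum_set U ` {..<i}" using j by auto
    qed
    show "enum_set U ` {..<i} \<subseteq> {y \<in> U. y < enum_set U i}"
      using assms enum_set_in[OF assms(1,2)] enum_set_less[OF assms(1)] by auto
  qed
  moreover have "inj_on (enum_set U) {..<i}"
  proof (rule linorder_inj_onI)
    show "enum_set U x \<noteq> enum_set U y" if "x < y" "x \<in> {..<i}" "y \<in> {..<i}" for x y
      using enum_set_less[OF assms(1) that(1)] that assms(3) by simp
  qed auto
  ultimately show ?thesis by (simp add: rank_in_def card_image)
qed

lemma enum_rank_in:
  assumes "finite U" "x \<in> U"
  shows "enum_set U (rank_in U x) = x" "rank_in U x \<le> card U - 1"
proof -
  have ne: "U \<noteq> {}" using assms by auto
  obtain j where j: "j \<le> card U - 1" "x = enum_set U j"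
    using enum_set_surj[OF assms(1) ne] assms(2) by blast
  with rank_enum_set[OF assms(1) ne j(1)]
  show "enum_set U (rank_in U x) = x" "rank_in U x \<le> card U - 1" by simp_all
qed

lemma rank_in_mono: "finite U \<Longrightarrow> x \<le> y \<Longrightarrow> rank_in U x \<le> rank_in U y"
  unfolding rank_in_def by (intro card_mono) auto

lemma rank_in_less: "finite U \<Longrightarrow> x \<in> U \<Longrightarrow> x < y \<Longrightarrow> rank_in U x < rank_in U y"
  unfolding rank_in_def by (intro psubset_card_mono) auto

text \<open>An increasing injection is determined by its image, so faces can be named by subsets.
  The normal form of simplices of the subdivision rests on this.\<close>

lemma enum_set_unique:
  assumes "\<alpha> \<in> inj_maps k n"
  shows "enum_set (\<alpha> ` {..k}) = \<alpha>" "card (\<alpha> ` {..k}) - 1 = k"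
    "i \<le> k \<Longrightarrow> rank_in (\<alpha> ` {..k}) (\<alpha> i) = i"
proof -
  let ?U = "\<alpha> ` {..k}"
  show c: "card ?U - 1 = k" using assms by (simp add: inj_maps_def card_image)
  have r: "rank_in ?U (\<alpha> i) = i" if "i \<le> k" for i
  proof -
    have "{y \<in> ?U. y < \<alpha> i} = \<alpha> ` {..<i}"
      using that assms by (auto simp: inj_maps_less_iff)
    moreover have "inj_on \<alpha> {..<i}" using assms that by (auto simp: inj_maps_def inj_on_def)
    ultimately show ?thesis by (simp add: rank_in_def card_image)
  qed
  then show "i \<le> k \<Longrightarrow> rank_in ?U (\<alpha> i) = i" .
  show "enum_set ?U = \<alpha>"
  proof (rule ord_maps_eqI[of _ k])
    show "\<alpha> \<in> extensional {..k}" using assms inj_maps_ord ord_maps_ext by blast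
    show "enum_set ?U i = \<alpha> i" if "i \<le> k" for i
      using enum_rank_in(1)[of ?U "\<alpha> i"] r[OF that] that by simp
    show "enum_set ?U \<in> extensional {..k}" using c by (metis enum_set_def restrict_extensional)
  qed
qed

text \<open>The composite of the enumeration of \<open>U\<close> with \<open>\<alpha>\<close> is
  increasing and has the right image, so uniqueness of enumerations identifies it. Ranks are
  therefore invariant under injections.\<close>

lemma enum_set_image:
  assumes "\<alpha> \<in> inj_maps k n" "U \<subseteq> {..k}" "U \<noteq> {}"
  shows "enum_set (\<alpha> ` U) = compose {..card U - 1} \<alpha> (enum_set U)" "card (\<alpha> ` U) = card U"
    "x \<in> U \<Longrightarrow> rank_in (\<alpha> ` U) (\<alpha> x) = rank_in U x"
proof -
  have f: "finite U" using assms finite_subset by blast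
  have e: "enum_set U \<in> inj_maps (card U - 1) k" using enum_set_inj_maps[OF f assms(3,2)] .
  let ?c = "compose {..card U - 1} \<alpha> (enum_set U)"
  have c: "?c \<in> inj_maps (card U - 1) n" by (rule inj_maps_comp[OF e assms(1)])
  have im: "?c ` {..card U - 1} = \<alpha> ` U"
    using enum_set_surj[OF f assms(3)] by (auto simp: compose_def image_iff) force
  show "enum_set (\<alpha> ` U) = ?c" using enum_set_unique(1)[OF c] im by simp
  show "card (\<alpha> ` U) = card U"
    using assms by (auto intro!: card_image simp: inj_maps_def inj_on_subset)
  show "rank_in (\<alpha> ` U) (\<alpha> x) = rank_in U x" if "x \<in> U"
    using enum_set_unique(3)[OF c, of "rank_in U x"] enum_rank_in[OF f that] im
    by (simp add: compose_def)
qed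

section \<open>Simplicial sets and maps\<close>

lemma act_closed: "simplicial_set X \<Longrightarrow> \<theta> \<in> ord_maps m n \<Longrightarrow> x \<in> simplices X n \<Longrightarrow> act X m n \<theta> x \<in> simplices X m"
  unfolding simplicial_set_def by blast

lemma act_id: "simplicial_set X \<Longrightarrow> x \<in> simplices X n \<Longrightarrow> act X n n (restrict id {..n}) x = x"
  unfolding simplicial_set_def by blast

lemma act_comp: "simplicial_set X \<Longrightarrow> \<eta> \<in> ord_maps k m \<Longrightarrow> \<theta> \<in> ord_maps m n \<Longrightarrow> x \<in> simplices X n \<Longrightarrow>
  act X k m \<eta> (act X m n \<theta> x) = act X k n (compose {..k} \<theta> \<eta>) x"
  unfolding simplicial_set_def by blast

lemma kan_simplicial: "kan_complex X \<Longrightarrow> simplicial_set X"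
  by (simp add: kan_complex_def)

lemma hom_in: "f \<in> sset_hom X Y \<Longrightarrow> x \<in> simplices X n \<Longrightarrow> f n x \<in> simplices Y n"
  unfolding sset_hom_def by blast

lemma hom_act: "f \<in> sset_hom X Y \<Longrightarrow> \<theta> \<in> ord_maps m n \<Longrightarrow> x \<in> simplices X n \<Longrightarrow>
  f m (act X m n \<theta> x) = act Y m n \<theta> (f n x)"
  unfolding sset_hom_def by blast

lemma hom_restrictI:
  assumes "simplicial_set X" "\<And>n x. x \<in> simplices X n \<Longrightarrow> f n x \<in> simplices Y n"
    "\<And>m n \<theta> x. \<theta> \<in> ord_maps m n \<Longrightarrow> x \<in> simplices X n \<Longrightarrow> f m (act X m n \<theta> x) = act Y m n \<theta> (f n x)"
  shows "(\<lambda>n. restrict (f n) (simplices X n)) \<in> sset_hom X Y"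
  using assms by (auto simp: sset_hom_def act_closed)

lemma hom_eqI:
  assumes "f \<in> sset_hom X Y" "g \<in> sset_hom X Y" "\<And>n x. x \<in> simplices X n \<Longrightarrow> f n x = g n x"
  shows "f = g"
proof
  fix n show "f n = g n"
    using assms by (intro extensionalityI[of _ "simplices X n"]) (auto simp: sset_hom_def PiE_def)
qed

section \<open>Complexes of finite chains\<close>

text \<open>Simplices may repeat vertices, hence sequences and not sets. All pairs are compared and
  not only neighbours, because the relation \<open>jle\<close> of the mapping cylinder is not
  transitive; it is a linear order only on its chains, which is what \<open>lin\<close>
  records.\<close>

definition cplx :: "('v \<Rightarrow> 'v \<Rightarrow> bool) \<Rightarrow> 'v set set \<Rightarrow> (nat \<Rightarrow> 'v) sset" where
  "cplx le C = \<lparr> simplices = (\<lambda>k. {c \<in> extensional {..k}. c ` {..k} \<in> C \<and> (\<forall>j\<le>k. \<forall>i\<le>j. le (c i) (c j))}),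
     act = (\<lambda>m n \<theta> c. compose {..m} c \<theta>) \<rparr>"

definition face_closed :: "'v set set \<Rightarrow> bool" where
  "face_closed C \<longleftrightarrow> (\<forall>F\<in>C. \<forall>S\<subseteq>F. S \<noteq> {} \<longrightarrow> S \<in> C)"

definition lin :: "('v \<Rightarrow> 'v \<Rightarrow> bool) \<Rightarrow> 'v set \<Rightarrow> bool" where
  "lin le T \<longleftrightarrow> (\<forall>a\<in>T. \<forall>b\<in>T. le a b \<or> le b a) \<and> (\<forall>a\<in>T. \<forall>b\<in>T. le a b \<longrightarrow> le b a \<longrightarrow> a = b) \<and>
     (\<forall>a\<in>T. \<forall>b\<in>T. \<forall>c\<in>T. le a b \<longrightarrow> le b c \<longrightarrow> le a c)"

lemma cplx_act[simp]: "act (cplx le C) m n \<theta> c = compose {..m} c \<theta>"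
  by (simp add: cplx_def)

lemma cplx_simplex_iff: "c \<in> simplices (cplx le C) k \<longleftrightarrow>
  c \<in> extensional {..k} \<and> c ` {..k} \<in> C \<and> (\<forall>j\<le>k. \<forall>i\<le>j. le (c i) (c j))"
  by (simp add: cplx_def)

lemma compose_image_ord: "\<theta> \<in> ord_maps m n \<Longrightarrow> compose {..m} c \<theta> ` {..m} \<subseteq> c ` {..n}"
  by (auto simp: compose_def ord_le)

lemma cplx_act_closed:
  assumes "face_closed C" "\<theta> \<in> ord_maps m n" "c \<in> simplices (cplx le C) n"
  shows "compose {..m} c \<theta> \<in> simplices (cplx le C) m"
proof -
  have "compose {..m} c \<theta> ` {..m} \<in> C"
    using assms compose_image_ord[OF assms(2), of c]
    unfolding face_closed_def cplx_simplex_iff by (metis atMost_iff empty_is_image empty_iff le0)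
  then show ?thesis
    using assms ord_le[OF assms(2)] ord_mono[OF assms(2)] unfolding cplx_simplex_iff
    by (auto simp: compose_def)
qed

lemma simplicial_set_cplx:
  assumes "face_closed C"
  shows "simplicial_set (cplx le C)"
  unfolding simplicial_set_def
proof (intro conjI allI ballI)
  fix n c assume "c \<in> simplices (cplx le C) n"
  then show "act (cplx le C) n n (restrict id {..n}) c = c"
    by (simp add: compose_ord_id_right cplx_simplex_iff)
qed (simp_all add: assms cplx_act_closed compose_ord_assoc)

lemma lin_subset: "lin le T \<Longrightarrow> S \<subseteq> T \<Longrightarrow> lin le S"
  unfolding lin_def by (meson subsetD)

lemma lin_max:
  assumes "finite T" "T \<noteq> {}" "lin le T"
  obtains m where "m \<in> T" "\<And>a. a \<in> T \<Longrightarrow> le a m"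
proof -
  have "\<exists>m\<in>T. \<forall>a\<in>T. le a m"
    using assms
  proof (induction T rule: finite_ne_induct)
    case (singleton x)
    then show ?case by (auto simp: lin_def)
  next
    case (insert x F)
    then obtain m where m: "m \<in> F" "\<forall>a\<in>F. le a m" using lin_subset by blast
    show ?case
    proof (cases "le x m")
      case True
      then show ?thesis using m by auto
    next
      case False
      have "x \<in> insert x F" "m \<in> insert x F" using m by auto
      with False have xm: "le m x" and xx: "le x x" using insert.prems unfolding lin_def by blast+
      have "le a x" if "a \<in> F" for a
      proof -
        have "le a m" "m \<in> insert x F" "a \<in> insert x F" using m that by auto
        then show ?thesis using insert.prems xm unfolding lin_def by blast
      qed
      then have "le a x" if "a \<in> insert x F" for a
        using that xx by auto
      then show ?thesis by blast
    qed
  qed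
  then show ?thesis using that by blast
qed

lemma lin_enum:
  assumes "finite T" "lin le T" "card T = Suc n"
  obtains e where "e \<in> extensional {..n}" "bij_betw e {..n} T" "\<And>i j. i \<le> j \<Longrightarrow> j \<le> n \<Longrightarrow> le (e i) (e j)"
proof -
  have "\<exists>e. bij_betw e {..n} T \<and> (\<forall>j\<le>n. \<forall>i\<le>j. le (e i) (e j))"
    using assms
  proof (induction n arbitrary: T)
    case 0
    then obtain a where T: "T = {a}" by (auto simp: card_Suc_eq)
    have "le a a" using 0 by (auto simp: lin_def T)
    then show ?case by (intro exI[of _ "\<lambda>_. a"]) (auto simp: T bij_betw_def)
  next
    case (Suc n)
    then have "T \<noteq> {}" by auto
    then obtain m where m: "m \<in> T" "\<And>a. a \<in> T \<Longrightarrow> le a m"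
      using lin_max[OF Suc.prems(1) _ Suc.prems(2)] by metis
    obtain e where e: "bij_betw e {..n} (T - {m})" "\<forall>j\<le>n. \<forall>i\<le>j. le (e i) (e j)"
      using Suc.IH[of "T - {m}"] Suc.prems m lin_subset[OF Suc.prems(2), of "T - {m}"] by auto
    let ?e = "e(Suc n := m)"
    have "bij_betw ?e {..n} (T - {m})"
      using e(1) bij_betw_cong[of "{..n}" ?e e] by auto
    then have "bij_betw ?e ({..n} \<union> {Suc n}) (T - {m} \<union> {m})"
      by (intro bij_betw_combine) (auto simp: bij_betw_def)
    moreover have "{..n} \<union> {Suc n} = {..Suc n}" "T - {m} \<union> {m} = T" using m by auto
    ultimately have b: "bij_betw ?e {..Suc n} T" by simp
    have im: "e i \<in> T" if "i \<le> n" for i using e(1) that by (auto simp: bij_betw_def)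
    have "le (?e i) (?e j)" if "j \<le> Suc n" "i \<le> j" for i j
      using that e(2) m im by (auto simp: le_Suc_eq)
    then show ?case using b by blast
  qed
  then obtain e where e: "bij_betw e {..n} T" "\<forall>j\<le>n. \<forall>i\<le>j. le (e i) (e j)" by blast
  show ?thesis
    by (rule that[of "restrict e {..n}"]) (use e in \<open>auto simp: bij_betw_def inj_on_def\<close>)
qed

section \<open>Horn filling in complexes of chains\<close>

lemma kan_filler:
  assumes "kan_complex K" "1 \<le> n" "i \<le> n" "f \<in> sset_hom (horn n i) K"
  shows "\<exists>g\<in>sset_hom (std_simplex n) K. \<forall>m. \<forall>\<sigma>\<in>simplices (horn n i) m. g m \<sigma> = f m \<sigma>"
proof -
  have "\<forall>n\<ge>1. \<forall>i\<le>n. \<forall>f\<in>sset_hom (horn n i) K.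
    \<exists>g\<in>sset_hom (std_simplex n) K. \<forall>m. \<forall>\<sigma>\<in>simplices (horn n i) m. g m \<sigma> = f m \<sigma>"
    using assms(1) unfolding kan_complex_def by (rule conjunct2)
  from bspec[OF mp[OF spec[OF mp[OF spec[OF this] assms(2)]] assms(3)] assms(4)] show ?thesis .
qed

text \<open>Under an increasing enumeration \<open>e\<close> of \<open>T\<close>, the faces of
  \<open>T\<close> available in \<open>C\<close> form the horn whose missing face is opposite to
  \<open>a\<close>. A filler of this horn supplies the values on \<open>T\<close> and on
  \<open>T - {a}\<close> together.\<close>

lemma cplx_one_step:
  fixes K :: "'k sset" and le :: "'v \<Rightarrow> 'v \<Rightarrow> bool"
  assumes K: "kan_complex K" and C: "face_closed C"
    and T: "finite T" "lin le T" "a \<in> T" "2 \<le> card T" "T \<notin> C" "T - {a} \<notin> C"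
    and faces: "\<And>S. S \<subseteq> T \<Longrightarrow> S \<noteq> {} \<Longrightarrow> S \<noteq> T \<Longrightarrow> S \<noteq> T - {a} \<Longrightarrow> S \<in> C"
    and f: "f \<in> sset_hom (cplx le C) K"
  shows "\<exists>g\<in>sset_hom (cplx le (C \<union> {T, T - {a}})) K. \<forall>k. \<forall>c\<in>simplices (cplx le C) k. g k c = f k c"
proof -
  define n where "n = card T - 1"
  have n: "card T = Suc n" "1 \<le> n" using T by (auto simp: n_def)
  obtain e where e: "e \<in> extensional {..n}" "bij_betw e {..n} T" "\<And>i j. i \<le> j \<Longrightarrow> j \<le> n \<Longrightarrow> le (e i) (e j)"
    using lin_enum[OF T(1,2) n(1)] by metis
  define p where "p = inv_into {..n} e"
  have p: "p x \<le> n" "e (p x) = x" if "x \<in> T" for x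
    using e(2) that bij_betw_inv_into_right[OF e(2)] inv_into_into[of x e "{..n}"]
    by (auto simp: p_def bij_betw_def)
  have pe: "p (e i) = i" if "i \<le> n" for i
    using bij_betw_inv_into_left[OF e(2)] that by (simp add: p_def)
  have eT: "e i \<in> T" if "i \<le> n" for i using e(2) that by (auto simp: bij_betw_def)
  have pmono: "p x \<le> p y" if "x \<in> T" "y \<in> T" "le x y" for x y
  proof (rule ccontr)
    assume "\<not> p x \<le> p y"
    then have "le y x" using e(3)[of "p y" "p x"] p that by auto
    then have "x = y" using T(2) that unfolding lin_def by blast
    then show False using \<open>\<not> p x \<le> p y\<close> by simp
  qed
  \<comment> \<open>The horn vertex is the position of \<open>a\<close>: the face missing from
    \<open>horn n j\<close> is the one opposite to \<open>j\<close>, which \<open>e\<close> sends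
    onto \<open>T - {a}\<close>.\<close>
  define j where "j = p a"
  have j: "j \<le> n" "e j = a" using p[OF T(3)] by (auto simp: j_def)
  have q: "compose {..k} e \<sigma> \<in> simplices (cplx le C) k" if "\<sigma> \<in> simplices (horn n j) k" for k \<sigma>
  proof -
    have \<sigma>: "\<sigma> \<in> ord_maps k n" "\<not> {..n} - {j} \<subseteq> \<sigma> ` {..k}" using that by (auto simp: horn_def)
    then obtain i where i: "i \<le> n" "i \<noteq> j" "i \<notin> \<sigma> ` {..k}" by auto
    let ?S = "compose {..k} e \<sigma> ` {..k}"
    have S: "?S \<subseteq> T" "?S \<noteq> {}" using \<sigma> eT by (auto simp: compose_def ord_le)
    have "e i \<notin> ?S"
    proof
      assume "e i \<in> ?S"
      then obtain l where "l \<le> k" "e i = e (\<sigma> l)" by (auto simp: compose_def)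
      then have "i = \<sigma> l" using pe[OF i(1)] pe[of "\<sigma> l"] ord_le[OF \<sigma>(1)] by metis
      then show False using i \<open>l \<le> k\<close> by blast
    qed
    moreover have "e i \<in> T" "e i \<noteq> a" using i eT pe[OF i(1)] by (auto simp: j_def)
    ultimately have "?S \<in> C" using S by (intro faces) auto
    then show ?thesis
      unfolding cplx_simplex_iff using \<sigma> e(3) ord_le[OF \<sigma>(1)] ord_mono[OF \<sigma>(1)] by (auto simp: compose_def)
  qed
  have hh: "(\<lambda>k. restrict (\<lambda>\<sigma>. f k (compose {..k} e \<sigma>)) (simplices (horn n j) k)) \<in> sset_hom (horn n j) K"
    (is "?h \<in> _")
  proof (rule hom_restrictI[OF simplicial_set_horn])
    fix m k \<theta> \<sigma> assume a: "\<theta> \<in> ord_maps m k" "\<sigma> \<in> simplices (horn n j) k"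
    have "act (horn n j) m k \<theta> \<sigma> = compose {..m} \<sigma> \<theta>" by (simp add: horn_def std_simplex_def)
    then show "f m (compose {..m} e (act (horn n j) m k \<theta> \<sigma>)) = act K m k \<theta> (f k (compose {..k} e \<sigma>))"
      using hom_act[OF f a(1) q[OF a(2)]] a(1) by (simp add: compose_ord_assoc)
  qed (use q hom_in[OF f] in auto)
  have "\<exists>g\<in>sset_hom (std_simplex n) K. \<forall>m. \<forall>\<sigma>\<in>simplices (horn n j) m. g m \<sigma> = ?h m \<sigma>"
    by (rule kan_filler[OF K n(2) j(1) hh])
  then obtain G where G: "G \<in> sset_hom (std_simplex n) K"
    "\<And>k \<sigma>. \<sigma> \<in> simplices (horn n j) k \<Longrightarrow> G k \<sigma> = f k (compose {..k} e \<sigma>)"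
    by auto
  \<comment> \<open>Positions in the enumeration turn a chain inside \<open>T\<close> back into a
    simplex of the standard simplex; composition with \<open>e\<close> undoes this.\<close>
  define pos where "pos k c = (\<lambda>i\<in>{..k}. p (c i))" for k :: nat and c :: "nat \<Rightarrow> 'v"
  have pos: "pos k c \<in> ord_maps k n" "compose {..k} e (pos k c) = c"
    if "c \<in> simplices (cplx le D) k" "c ` {..k} \<subseteq> T" for k c D
  proof -
    show "pos k c \<in> ord_maps k n"
      using that p pmono by (intro ord_mapsI) (auto simp: pos_def cplx_simplex_iff image_subset_iff)
    show "compose {..k} e (pos k c) = c"
      using that p by (intro extensionalityI[of _ "{..k}"]) (auto simp: pos_def compose_def cplx_simplex_iff image_subset_iff)
  qed
  have horn: "pos k c \<in> simplices (horn n j) k"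
    if "c \<in> simplices (cplx le C) k" "c ` {..k} \<subseteq> T" for k c
  proof -
    have "\<not> {..n} - {j} \<subseteq> pos k c ` {..k}"
    proof
      assume s: "{..n} - {j} \<subseteq> pos k c ` {..k}"
      have "T - {a} \<subseteq> c ` {..k}"
      proof
        fix x assume x: "x \<in> T - {a}"
        then have "p x \<in> {..n} - {j}" using p[of x] j by auto
        then obtain i where "i \<le> k" "p x = p (c i)" using s by (auto simp: pos_def)
        then show "x \<in> c ` {..k}" using x p that(2) by (metis DiffD1 atMost_iff image_eqI image_subset_iff)
      qed
      then have "c ` {..k} = T \<or> c ` {..k} = T - {a}" using that(2) by auto
      then show False using that(1) T by (auto simp: cplx_simplex_iff)
    qed
    then show ?thesis using pos(1)[OF that] by (simp add: horn_def)
  qed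
  let ?D = "C \<union> {T, T - {a}}"
  have D: "face_closed ?D"
    unfolding face_closed_def
  proof (intro ballI allI impI)
    fix F S assume a: "F \<in> ?D" "S \<subseteq> F" "S \<noteq> {}"
    show "S \<in> ?D"
    proof (cases "F \<in> C")
      case True
      then show ?thesis using a C unfolding face_closed_def by blast
    next
      case False
      then have "S \<subseteq> T" using a by auto
      then show ?thesis using faces[of S] a by auto
    qed
  qed
  have imT: "c ` {..k} \<subseteq> T" if "c \<in> simplices (cplx le ?D) k" "c ` {..k} \<notin> C" for k c
    using that by (auto simp: cplx_simplex_iff)
  \<comment> \<open>The filler is consulted only outside \<open>C\<close>. On chains of
    \<open>C\<close> that lie inside \<open>T\<close> it agrees with \<open>f\<close>, so passing to
    a face that falls into \<open>C\<close> causes no conflict.\<close>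
  define g where "g k c = (if c ` {..k} \<in> C then f k c else G k (pos k c))" for k c
  have sub: "c \<in> simplices (cplx le C) k" if "c \<in> simplices (cplx le ?D) k" "c ` {..k} \<in> C" for k c
    using that by (simp add: cplx_simplex_iff)
  have "(\<lambda>k. restrict (g k) (simplices (cplx le ?D) k)) \<in> sset_hom (cplx le ?D) K"
  proof (rule hom_restrictI[OF simplicial_set_cplx[OF D]])
    fix k c assume c: "c \<in> simplices (cplx le ?D) k"
    show "g k c \<in> simplices K k"
      using hom_in[OF f sub[OF c]] hom_in[OF G(1)] pos(1)[OF c imT[OF c]]
      by (auto simp: g_def std_simplex_def)
  next
    fix m k \<theta> c assume \<theta>: "\<theta> \<in> ord_maps m k" and c: "c \<in> simplices (cplx le ?D) k"
    have c': "compose {..m} c \<theta> \<in> simplices (cplx le ?D) m" using cplx_act_closed[OF D \<theta> c] .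
    show "g m (act (cplx le ?D) m k \<theta> c) = act K m k \<theta> (g k c)"
    proof (cases "c ` {..k} \<in> C")
      case True
      from cplx_act_closed[OF C \<theta> sub[OF c True]] have "compose {..m} c \<theta> ` {..m} \<in> C"
        by (simp add: cplx_simplex_iff)
      then show ?thesis using hom_act[OF f \<theta> sub[OF c True]] True by (simp add: g_def)
    next
      case False
      note cT = imT[OF c False]
      have eq: "pos m (compose {..m} c \<theta>) = compose {..m} (pos k c) \<theta>"
        using \<theta> by (auto simp: pos_def compose_def ord_le fun_eq_iff restrict_def)
      have c'T: "compose {..m} c \<theta> ` {..m} \<subseteq> T" using compose_image_ord[OF \<theta>] cT by (rule order_trans)
      have *: "G m (pos m (compose {..m} c \<theta>)) = act K m k \<theta> (G k (pos k c))"
        using hom_act[OF G(1) \<theta>, of "pos k c"] pos(1)[OF c cT] by (simp add: eq std_simplex_def)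
      show ?thesis
      proof (cases "compose {..m} c \<theta> ` {..m} \<in> C")
        case True
        have "G m (pos m (compose {..m} c \<theta>)) = f m (compose {..m} c \<theta>)"
          using G(2)[OF horn[OF sub[OF c' True] c'T]] pos(2)[OF c' c'T] by simp
        then show ?thesis using True False * by (simp add: g_def)
      qed (use False * in \<open>simp add: g_def\<close>)
    qed
  qed
  then show ?thesis
    by (rule bexI[rotated]) (auto simp: g_def cplx_simplex_iff)
qed

text \<open>Each \<open>T \<in> TT\<close> is attached together with its free face \<open>T - {a T}\<close>, in the order of the
  rank \<open>r\<close>.\<close>

lemma cplx_collapse:
  fixes K :: "'k sset" and le :: "'v \<Rightarrow> 'v \<Rightarrow> bool" and r :: "'v set \<Rightarrow> nat"
  assumes K: "kan_complex K" and C: "face_closed C" and fin: "finite TT"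
    and T: "\<And>T. T \<in> TT \<Longrightarrow> finite T \<and> lin le T \<and> a T \<in> T \<and> 2 \<le> card T \<and> T \<notin> C \<and> T - {a T} \<notin> C"
    and disj: "\<And>T T'. T \<in> TT \<Longrightarrow> T' \<in> TT \<Longrightarrow> T - {a T} = T' - {a T'} \<Longrightarrow> T = T'"
      "\<And>T T'. T \<in> TT \<Longrightarrow> T' \<in> TT \<Longrightarrow> T \<noteq> T' - {a T'}"
    and faces: "\<And>T S. T \<in> TT \<Longrightarrow> S \<subseteq> T \<Longrightarrow> S \<noteq> {} \<Longrightarrow> S \<noteq> T \<Longrightarrow> S \<noteq> T - {a T} \<Longrightarrow>
      S \<in> C \<or> (\<exists>T'\<in>TT. r T' < r T \<and> (S = T' \<or> S = T' - {a T'}))"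
    and f: "f \<in> sset_hom (cplx le C) K"
  shows "\<exists>g\<in>sset_hom (cplx le (C \<union> (\<Union>T\<in>TT. {T, T - {a T}}))) K.
    \<forall>k. \<forall>c\<in>simplices (cplx le C) k. g k c = f k c"
  using fin T disj faces
proof (induction "card TT" arbitrary: TT)
  case 0
  then have "TT = {}" by simp
  then show ?case using f by auto
next
  case (Suc N)
  have ne: "TT \<noteq> {}" using Suc.hyps by auto
  \<comment> \<open>The set attached last has maximal rank. No other member of the family can use it
    or its free face as a boundary face, so the face condition survives its removal.\<close>
  obtain T where T: "T \<in> TT" "\<And>T'. T' \<in> TT \<Longrightarrow> r T' \<le> r T"
  proof -
    have "Max (r ` TT) \<in> r ` TT" using Suc.prems(1) ne by (intro Max_in) auto
    then obtain T where "T \<in> TT" "r T = Max (r ` TT)" by auto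
    moreover have "r T' \<le> Max (r ` TT)" if "T' \<in> TT" for T'
      using Suc.prems(1) that by (intro Max_ge) auto
    ultimately show ?thesis using that by metis
  qed
  let ?TT = "TT - {T}"
  let ?D = "C \<union> (\<Union>T\<in>?TT. {T, T - {a T}})"
  have faces': "S \<in> C \<or> (\<exists>T''\<in>?TT. r T'' < r T' \<and> (S = T'' \<or> S = T'' - {a T''}))"
    if "T' \<in> TT" "S \<subseteq> T'" "S \<noteq> {}" "S \<noteq> T'" "S \<noteq> T' - {a T'}" for T' S
  proof -
    have "T'' \<noteq> T" if "r T'' < r T'" for T''
      using that T(2)[OF \<open>T' \<in> TT\<close>] by auto
    then show ?thesis using Suc.prems(5)[OF that] by blast
  qed
  have "\<exists>g\<in>sset_hom (cplx le ?D) K. \<forall>k. \<forall>c\<in>simplices (cplx le C) k. g k c = f k c"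
  proof (rule Suc.hyps(1))
    show "N = card ?TT" using Suc.hyps T Suc.prems(1) by simp
  qed (use Suc.prems faces' in auto)
  then obtain g where g: "g \<in> sset_hom (cplx le ?D) K" "\<And>k c. c \<in> simplices (cplx le C) k \<Longrightarrow> g k c = f k c"
    by blast
  have D: "face_closed ?D"
    unfolding face_closed_def
  proof (intro ballI allI impI)
    fix F S assume a: "F \<in> ?D" "S \<subseteq> F" "S \<noteq> {}"
    show "S \<in> ?D"
    proof (cases "F \<in> C")
      case True
      then show ?thesis using a C unfolding face_closed_def by blast
    next
      case False
      then obtain T' where T': "T' \<in> ?TT" "F = T' \<or> F = T' - {a T'}" using a by auto
      then show ?thesis using faces'[of T' S] a by blast
    qed
  qed
  have nin: "T \<notin> ?D" "T - {a T} \<notin> ?D"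
    using Suc.prems(2)[OF T(1)] Suc.prems(3,4) T(1) by auto
  have fcs: "S \<in> ?D" if "S \<subseteq> T" "S \<noteq> {}" "S \<noteq> T" "S \<noteq> T - {a T}" for S
    using faces'[OF T(1) that] by auto
  have pT: "finite T" "lin le T" "a T \<in> T" "2 \<le> card T" using Suc.prems(2)[OF T(1)] by auto
  have "\<exists>h\<in>sset_hom (cplx le (?D \<union> {T, T - {a T}})) K. \<forall>k. \<forall>c\<in>simplices (cplx le ?D) k. h k c = g k c"
    by (rule cplx_one_step[OF K D pT nin fcs g(1)])
  then obtain h where h: "h \<in> sset_hom (cplx le (?D \<union> {T, T - {a T}})) K"
    "\<And>k c. c \<in> simplices (cplx le ?D) k \<Longrightarrow> h k c = g k c"
    by auto
  have "?D \<union> {T, T - {a T}} = C \<union> (\<Union>T\<in>TT. {T, T - {a T}})" using T(1) by auto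
  moreover have "h k c = f k c" if "c \<in> simplices (cplx le C) k" for k c
    using h(2)[of c k] g(2)[OF that] that by (auto simp: cplx_simplex_iff)
  ultimately show ?case using h(1) by (intro bexI[of _ h]) auto
qed

section \<open>Lifting along a family of complexes\<close>

text \<open>The source of \<open>lift\<close> is only semisimplicial: the lifts are chosen by induction on the dimension, compatibly
  with faces but not with degeneracies, so every single extension problem is of the form \<open>fill\<close>.\<close>

locale supp_complex =
  fixes le :: "'v \<Rightarrow> 'v \<Rightarrow> bool" and CC :: "'v set set" and sp :: "'v \<Rightarrow> nat set"
    and mp :: "(nat \<Rightarrow> nat) \<Rightarrow> 'v \<Rightarrow> 'v" and base :: "'v set"
  assumes CC_closed: "face_closed CC"
    and CC_fin: "F \<in> CC \<Longrightarrow> finite F \<and> F \<noteq> {}"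
    and sp_fin: "F \<in> CC \<Longrightarrow> v \<in> F \<Longrightarrow> finite (sp v) \<and> sp v \<noteq> {}"
    and mp_CC: "F \<in> CC \<Longrightarrow> strict_mono_on (\<Union>(sp ` F)) \<alpha> \<Longrightarrow> mp \<alpha> ` F \<in> CC"
    and mp_le: "F \<in> CC \<Longrightarrow> strict_mono_on (\<Union>(sp ` F)) \<alpha> \<Longrightarrow> a \<in> F \<Longrightarrow> b \<in> F \<Longrightarrow> le a b \<Longrightarrow> le (mp \<alpha> a) (mp \<alpha> b)"
    and mp_sp: "sp (mp \<alpha> v) = \<alpha> ` sp v"
    and mp_comp: "mp \<alpha> (mp \<beta> v) = mp (\<lambda>i. \<alpha> (\<beta> i)) v"
    and mp_cong: "(\<And>i. i \<in> sp v \<Longrightarrow> \<alpha> i = \<beta> i) \<Longrightarrow> mp \<alpha> v = mp \<beta> v"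
    and mp_id: "mp (\<lambda>i. i) v = v"
    and mp_base: "mp \<alpha> v \<in> base \<longleftrightarrow> v \<in> base"
begin

definition supp :: "'v set \<Rightarrow> nat set" where "supp F = \<Union>(sp ` F)"

definition lev :: "nat \<Rightarrow> 'v set set" where "lev n = {F \<in> CC. supp F \<subseteq> {..n}}"

text \<open>This is where a map out of \<open>lev n\<close> is determined in advance: chains
  supported on a proper face carry earlier choices, chains in the base carry the given data.\<close>

definition low :: "nat \<Rightarrow> 'v set set" where "low n = {F \<in> lev n. supp F \<noteq> {..n} \<or> F \<subseteq> base}"

definition blev :: "nat \<Rightarrow> 'v set set" where "blev n = {F \<in> lev n. F \<subseteq> base}"

abbreviation seqs :: "nat \<Rightarrow> nat \<Rightarrow> (nat \<Rightarrow> 'v) set" where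
  "seqs n \<equiv> simplices (cplx le (lev n))"

abbreviation bseqs :: "nat \<Rightarrow> nat \<Rightarrow> (nat \<Rightarrow> 'v) set" where
  "bseqs n \<equiv> simplices (cplx le (blev n))"

abbreviation lseqs :: "nat \<Rightarrow> nat \<Rightarrow> (nat \<Rightarrow> 'v) set" where
  "lseqs n \<equiv> simplices (cplx le (low n))"

definition shift :: "(nat \<Rightarrow> nat) \<Rightarrow> nat \<Rightarrow> (nat \<Rightarrow> 'v) \<Rightarrow> nat \<Rightarrow> 'v" where
  "shift \<alpha> j c = (\<lambda>i\<in>{..j}. mp \<alpha> (c i))"

lemma supp_mono: "S \<subseteq> F \<Longrightarrow> supp S \<subseteq> supp F"
  by (auto simp: supp_def)

lemma lev_closed: "face_closed (lev n)"
  using CC_closed supp_mono unfolding face_closed_def lev_def by blast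

lemma blev_closed: "face_closed (blev n)"
  using lev_closed[of n] unfolding face_closed_def blev_def by blast

lemma low_closed: "face_closed (low n)"
  unfolding face_closed_def
proof (intro ballI allI impI)
  fix F S assume a: "F \<in> low n" "S \<subseteq> F" "S \<noteq> {}"
  then have "S \<in> lev n" using lev_closed[of n] unfolding face_closed_def low_def by blast
  moreover have "supp S \<noteq> {..n} \<or> S \<subseteq> base"
    using a supp_mono[OF a(2)] unfolding low_def lev_def by blast
  ultimately show "S \<in> low n" by (simp add: low_def)
qed

lemma supp_fin: "F \<in> CC \<Longrightarrow> finite (supp F) \<and> supp F \<noteq> {}"
  using CC_fin sp_fin unfolding supp_def by blast

lemma supp_mp: "supp (mp \<alpha> ` F) = \<alpha> ` supp F"
  by (auto simp: supp_def mp_sp)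

lemma shift_image: "shift \<alpha> j c ` {..j} = mp \<alpha> ` c ` {..j}"
  by (auto simp: shift_def)

lemma shift_cplx:
  assumes "c \<in> seqs k j" "strict_mono_on (supp (c ` {..j})) \<alpha>"
    "\<alpha> ` supp (c ` {..j}) \<subseteq> {..n}"
  shows "shift \<alpha> j c \<in> seqs n j"
proof -
  have F: "c ` {..j} \<in> CC" using assms(1) by (simp add: cplx_simplex_iff lev_def)
  have "mp \<alpha> ` c ` {..j} \<in> CC" using mp_CC[OF F] assms(2) by (simp add: supp_def)
  moreover have "supp (mp \<alpha> ` c ` {..j}) \<subseteq> {..n}" using assms(3) by (simp only: supp_mp)
  moreover have "le (mp \<alpha> (c i)) (mp \<alpha> (c i'))" if "i \<le> i'" "i' \<le> j" for i i'
  proof (rule mp_le[OF F])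
    show "strict_mono_on (\<Union>(sp ` c ` {..j})) \<alpha>" using assms(2) by (simp add: supp_def)
    show "le (c i) (c i')" using assms(1) that by (simp add: cplx_simplex_iff)
  qed (use that in auto)
  ultimately show ?thesis
    unfolding cplx_simplex_iff lev_def by (simp add: shift_image) (simp add: shift_def)
qed

lemma inj_maps_strict_mono_on: "\<alpha> \<in> inj_maps k n \<Longrightarrow> U \<subseteq> {..k} \<Longrightarrow> strict_mono_on U \<alpha>"
  by (auto intro!: strict_mono_onI dest: inj_maps_less)

lemma shift_lev:
  assumes "c \<in> seqs k j" "\<alpha> \<in> inj_maps k n"
  shows "shift \<alpha> j c \<in> seqs n j"
proof -
  have "supp (c ` {..j}) \<subseteq> {..k}" using assms(1) by (simp add: cplx_simplex_iff lev_def)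
  then show ?thesis
    using assms(2) by (intro shift_cplx[OF assms(1)] inj_maps_strict_mono_on)
      (auto dest!: inj_maps_ord intro: ord_le)
qed

lemma shift_blev:
  assumes "c \<in> bseqs k j" "\<alpha> \<in> inj_maps k n"
  shows "shift \<alpha> j c \<in> bseqs n j"
proof -
  have "c \<in> seqs k j" "c ` {..j} \<subseteq> base"
    using assms(1) by (auto simp: cplx_simplex_iff blev_def)
  from shift_lev[OF this(1) assms(2)] this(2) show ?thesis
    using mp_base by (auto simp: cplx_simplex_iff blev_def shift_def)
qed

text \<open>Relabelling by ranks moves a chain into the smallest simplex that can carry it, of
  dimension \<open>card U - 1\<close>.\<close>

lemma shift_rank:
  assumes "c \<in> seqs k j" "U = supp (c ` {..j})"
  shows "shift (rank_in U) j c \<in> seqs (card U - 1) j"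
proof (rule shift_cplx[OF assms(1)])
  have F: "c ` {..j} \<in> CC" using assms(1) by (simp add: cplx_simplex_iff lev_def)
  have U: "finite U" "U \<noteq> {}" using supp_fin[OF F] assms(2) by auto
  show "strict_mono_on (supp (c ` {..j})) (rank_in U)"
    using U by (auto intro!: strict_mono_onI rank_in_less simp: assms(2))
  show "rank_in U ` supp (c ` {..j}) \<subseteq> {..card U - 1}"
    using enum_rank_in(2)[OF U(1)] assms(2) by auto
qed

lemma shift_compose: "\<theta> \<in> ord_maps i j \<Longrightarrow> compose {..i} (shift \<alpha> j c) \<theta> = shift \<alpha> i (compose {..i} c \<theta>)"
  by (auto simp: shift_def compose_def ord_le)

lemma sp_in_supp: "i \<le> j \<Longrightarrow> l \<in> sp (c i) \<Longrightarrow> l \<in> supp (c ` {..j})"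
  by (auto simp: supp_def)

lemma shift_cong:
  assumes "\<And>l. l \<in> supp (c ` {..j}) \<Longrightarrow> \<alpha> l = \<beta> l"
  shows "shift \<alpha> j c = shift \<beta> j c"
  unfolding shift_def by (rule restrict_ext) (auto intro!: mp_cong assms sp_in_supp)

lemma shift_shift:
  assumes "\<And>l. l \<in> supp (c ` {..j}) \<Longrightarrow> \<alpha> (\<beta> l) = \<gamma> l"
  shows "shift \<alpha> j (shift \<beta> j c) = shift \<gamma> j c"
  unfolding shift_def by (rule restrict_ext) (auto simp: mp_comp intro!: mp_cong assms sp_in_supp)

lemma shift_ident:
  assumes "c \<in> extensional {..j}" "\<And>l. l \<in> supp (c ` {..j}) \<Longrightarrow> \<alpha> l = l"
  shows "shift \<alpha> j c = c"
proof -
  have "shift \<alpha> j c = shift (\<lambda>i. i) j c" using assms(2) by (rule shift_cong)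
  then show ?thesis using assms(1) by (auto simp: shift_def mp_id extensional_def)
qed

text \<open>For a new \<open>b\<close> in dimension \<open>n\<close> the values on
  \<open>low n\<close> are forced, by the lifts chosen for its proper faces and by \<open>d\<close>
  on the base. Once these forced values are shown to form a map, \<open>fill\<close> extends it. On
  \<open>A\<close> the lift \<open>F0\<close> is taken over unchanged, which makes the construction
  relative.\<close>

theorem lift:
  fixes K :: "'k sset" and B A :: "nat \<Rightarrow> 'b set" and ba :: "nat \<Rightarrow> nat \<Rightarrow> (nat \<Rightarrow> nat) \<Rightarrow> 'b \<Rightarrow> 'b"
    and d F0 :: "nat \<Rightarrow> 'b \<Rightarrow> nat \<Rightarrow> (nat \<Rightarrow> 'v) \<Rightarrow> 'k"
  assumes B: "\<And>k n \<alpha> b. \<alpha> \<in> inj_maps k n \<Longrightarrow> b \<in> B n \<Longrightarrow> ba k n \<alpha> b \<in> B k"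
    and B_comp: "\<And>j k n \<alpha> \<beta> b. \<beta> \<in> inj_maps j k \<Longrightarrow> \<alpha> \<in> inj_maps k n \<Longrightarrow> b \<in> B n \<Longrightarrow>
      ba j k \<beta> (ba k n \<alpha> b) = ba j n (compose {..j} \<alpha> \<beta>) b"
    and B_id: "\<And>n b. b \<in> B n \<Longrightarrow> ba n n (restrict id {..n}) b = b"
    and A: "\<And>n. A n \<subseteq> B n" "\<And>k n \<alpha> b. \<alpha> \<in> inj_maps k n \<Longrightarrow> b \<in> A n \<Longrightarrow> ba k n \<alpha> b \<in> A k"
    and d: "\<And>n b. b \<in> B n \<Longrightarrow> d n b \<in> sset_hom (cplx le (blev n)) K"
      "\<And>k n \<alpha> b j c. \<alpha> \<in> inj_maps k n \<Longrightarrow> b \<in> B n \<Longrightarrow> c \<in> bseqs k j \<Longrightarrow>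
        d k (ba k n \<alpha> b) j c = d n b j (shift \<alpha> j c)"
    and F0: "\<And>n b. b \<in> A n \<Longrightarrow> F0 n b \<in> sset_hom (cplx le (lev n)) K"
      "\<And>k n \<alpha> b j c. \<alpha> \<in> inj_maps k n \<Longrightarrow> b \<in> A n \<Longrightarrow> c \<in> seqs k j \<Longrightarrow>
        F0 k (ba k n \<alpha> b) j c = F0 n b j (shift \<alpha> j c)"
      "\<And>n b j c. b \<in> A n \<Longrightarrow> c \<in> bseqs n j \<Longrightarrow> F0 n b j c = d n b j c"
    and fill: "\<And>n f. f \<in> sset_hom (cplx le (low n)) K \<Longrightarrow>
      \<exists>g\<in>sset_hom (cplx le (lev n)) K. \<forall>j. \<forall>c\<in>lseqs n j. g j c = f j c"
  shows "\<exists>P. \<forall>n. \<forall>b\<in>B n. P n b \<in> sset_hom (cplx le (lev n)) K \<and>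
    (\<forall>j. \<forall>c\<in>bseqs n j. P n b j c = d n b j c) \<and>
    (b \<in> A n \<longrightarrow> P n b = F0 n b) \<and>
    (\<forall>k. \<forall>\<alpha>\<in>inj_maps k n. \<forall>j. \<forall>c\<in>seqs k j.
      P k (ba k n \<alpha> b) j c = P n b j (shift \<alpha> j c))"
proof -
  define good where "good f n r \<longleftrightarrow> (\<forall>b\<in>B n. r b \<in> sset_hom (cplx le (lev n)) K \<and>
    (\<forall>j. \<forall>c\<in>bseqs n j. r b j c = d n b j c) \<and>
    (b \<in> A n \<longrightarrow> r b = F0 n b) \<and>
    (\<forall>k<n. \<forall>\<alpha>\<in>inj_maps k n. \<forall>j. \<forall>c\<in>seqs k j.
      f k (ba k n \<alpha> b) j c = r b j (shift \<alpha> j c)))"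
    for f :: "nat \<Rightarrow> 'b \<Rightarrow> nat \<Rightarrow> (nat \<Rightarrow> 'v) \<Rightarrow> 'k" and n and r
  \<comment> \<open>The condition \<open>good\<close> speaks of proper faces. In dimension
    \<open>n\<close> itself the only injection is the identity, so naturality for all injections
    follows.\<close>
  have nat: "f k (ba k n \<alpha> b) j c = f n b j (shift \<alpha> j c)"
    if "good f n (f n)" "b \<in> B n" "\<alpha> \<in> inj_maps k n" "c \<in> seqs k j"
    for f n b k \<alpha> j c
  proof (cases "k = n")
    case True
    then have \<alpha>: "\<alpha> = restrict id {..n}" using that(3) by (simp add: inj_self_id)
    have "c \<in> extensional {..j}" "supp (c ` {..j}) \<subseteq> {..n}"
      using that(4) True by (auto simp: cplx_simplex_iff lev_def)
    then have "shift \<alpha> j c = c" by (intro shift_ident) (auto simp: \<alpha>)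
    then show ?thesis using True B_id[OF that(2)] \<alpha> by simp
  next
    case False
    then have "k < n" using inj_maps_card[OF that(3)] by simp
    then show ?thesis using that unfolding good_def by blast
  qed
  have "\<exists>f. \<forall>n. good f n (f n)"
  proof (rule dependent_wellorder_choice)
    show "good f n r = good g n r" if "\<And>z. z < n \<Longrightarrow> f z = g z" for r f g n
      using that by (simp add: good_def)
    show "\<exists>r. good f n r" if IH: "\<And>m. m < n \<Longrightarrow> good f m (f m)" for n f
    proof -
      have fhom: "f m b \<in> sset_hom (cplx le (lev m)) K" if "m < n" "b \<in> B m" for m b
        using IH[OF that(1)] that(2) by (simp add: good_def)
      have fbase: "f m b j c = d m b j c"
        if "m < n" "b \<in> B m" "c \<in> bseqs m j" for m b j c
        using IH[OF that(1)] that(2,3) by (simp add: good_def)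
      have fA: "f m b = F0 m b" if "m < n" "b \<in> A m" for m b
        using IH[OF that(1)] A(1)[of m] that(2) by (auto simp: good_def)
      note fnat = nat[OF IH]
      have "\<exists>g. g \<in> sset_hom (cplx le (lev n)) K \<and>
        (\<forall>j. \<forall>c\<in>bseqs n j. g j c = d n b j c) \<and>
        (b \<in> A n \<longrightarrow> g = F0 n b) \<and>
        (\<forall>k<n. \<forall>\<alpha>\<in>inj_maps k n. \<forall>j. \<forall>c\<in>seqs k j.
          f k (ba k n \<alpha> b) j c = g j (shift \<alpha> j c))" if b: "b \<in> B n" for b
      proof (cases "b \<in> A n")
        case True
        show ?thesis
          by (rule exI[of _ "F0 n b"]) (use True F0 fA A in auto)
      next
        case False
        \<comment> \<open>A chain with support \<open>U\<close> is evaluated over the face of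
          \<open>b\<close> spanned by \<open>U\<close>, after relabelling by ranks. Chains in the
          base go through \<open>d\<close> instead, since their support may be all of
          \<open>[n]\<close>, where no earlier choice exists.\<close>
        define g0 where "g0 j c = (if c ` {..j} \<subseteq> base then d n b j c else
          let U = supp (c ` {..j}); u = card U - 1 in
          f u (ba u n (enum_set U) b) j (shift (rank_in U) j c))" for j c
        have U: "finite U" "U \<noteq> {}" "U \<subseteq> {..n}" "card U - 1 < n" "enum_set U \<in> inj_maps (card U - 1) n"
          if "c \<in> lseqs n j" "\<not> c ` {..j} \<subseteq> base" "U = supp (c ` {..j})" for c j U
        proof -
          have F: "c ` {..j} \<in> CC" "U \<subseteq> {..n}" "U \<noteq> {..n}"
            using that by (auto simp: cplx_simplex_iff low_def lev_def)
          show 1: "finite U" "U \<noteq> {}" "U \<subseteq> {..n}" using supp_fin[OF F(1)] F that(3) by auto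
          have "card U < card {..n}" using F(2,3) by (intro psubset_card_mono) auto
          moreover have "card U > 0" using 1 by (simp add: card_gt_0_iff)
          ultimately show "card U - 1 < n" by simp
          show "enum_set U \<in> inj_maps (card U - 1) n" using enum_set_inj_maps[OF 1] .
        qed
        have lowlev: "c \<in> seqs n j" if "c \<in> lseqs n j" for c j
          using that by (auto simp: cplx_simplex_iff low_def)
        have lowb: "c \<in> bseqs n j" if "c \<in> lseqs n j" "c ` {..j} \<subseteq> base" for c j
          using that by (auto simp: cplx_simplex_iff low_def blev_def)
        have er: "shift (enum_set U) j (shift (rank_in U) j c) = c"
          if "c \<in> seqs m j" "U = supp (c ` {..j})" for c j U m
        proof -
          have "finite U" using supp_fin that by (auto simp: cplx_simplex_iff lev_def)
          then have "shift (enum_set U) j (shift (rank_in U) j c) = shift (\<lambda>i. i) j c"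
            using that(2) by (intro shift_shift) (auto simp: enum_rank_in)
          also have "\<dots> = c" using that(1) by (intro shift_ident) (auto simp: cplx_simplex_iff)
          finally show ?thesis .
        qed
        have g0: "(\<lambda>j. restrict (g0 j) (lseqs n j)) \<in> sset_hom (cplx le (low n)) K"
        proof (rule hom_restrictI[OF simplicial_set_cplx[OF low_closed]])
          fix j c assume c: "c \<in> lseqs n j"
          show "g0 j c \<in> simplices K j"
          proof (cases "c ` {..j} \<subseteq> base")
            case True
            then show ?thesis using hom_in[OF d(1)[OF b] lowb[OF c True]] by (simp add: g0_def)
          next
            case False
            let ?U = "supp (c ` {..j})"
            note U' = U[OF c False refl]
            have "f (card ?U - 1) (ba (card ?U - 1) n (enum_set ?U) b) j (shift (rank_in ?U) j c) \<in> simplices K j"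
              by (rule hom_in[OF fhom[OF U'(4) B[OF U'(5) b]] shift_rank[OF lowlev[OF c] refl]])
            then show ?thesis using False by (simp add: g0_def Let_def)
          qed
        next
          fix i j \<theta> c assume \<theta>: "\<theta> \<in> ord_maps i j" and c: "c \<in> lseqs n j"
          let ?c = "compose {..i} c \<theta>"
          have c': "?c \<in> lseqs n i" by (rule cplx_act_closed[OF low_closed \<theta> c])
          have sub: "?c ` {..i} \<subseteq> c ` {..j}" by (rule compose_image_ord[OF \<theta>])
          have "g0 i ?c = act K i j \<theta> (g0 j c)"
          proof (cases "c ` {..j} \<subseteq> base")
            case True
            then have "?c ` {..i} \<subseteq> base" using sub by (rule order_trans[rotated])
            then show ?thesis using True hom_act[OF d(1)[OF b] \<theta> lowb[OF c True]] by (simp add: g0_def)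
          next
            case F: False
            define U where "U = supp (c ` {..j})"
            define u where "u = card U - 1"
            note U' = U[OF c F U_def, folded u_def]
            have bU: "ba u n (enum_set U) b \<in> B u" by (rule B[OF U'(5) b])
            have sc: "shift (rank_in U) j c \<in> seqs u j"
              unfolding u_def by (rule shift_rank[OF lowlev[OF c] U_def])
            have rhs: "act K i j \<theta> (g0 j c) = f u (ba u n (enum_set U) b) i (shift (rank_in U) i ?c)"
              using hom_act[OF fhom[OF U'(4) bU] \<theta> sc] F shift_compose[OF \<theta>]
              by (simp add: g0_def Let_def U_def u_def)
            have sc': "shift (rank_in U) i ?c \<in> seqs u i"
              using cplx_act_closed[OF lev_closed \<theta> sc] by (simp add: shift_compose[OF \<theta>])
            have U'U: "supp (?c ` {..i}) \<subseteq> U" using supp_mono[OF sub] by (simp add: U_def)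
            show ?thesis
            proof (cases "?c ` {..i} \<subseteq> base")
              case True
              have sb: "shift (rank_in U) i ?c \<in> bseqs u i"
                using sc' True mp_base by (auto simp: cplx_simplex_iff blev_def shift_def)
              have "f u (ba u n (enum_set U) b) i (shift (rank_in U) i ?c) = d n b i (shift (enum_set U) i (shift (rank_in U) i ?c))"
                using fbase[OF U'(4) bU sb] d(2)[OF U'(5) b sb] by simp
              also have "shift (enum_set U) i (shift (rank_in U) i ?c) = shift (\<lambda>l. l) i ?c"
                using U'U U'(1) by (intro shift_shift) (auto simp: enum_rank_in)
              also have "\<dots> = ?c" by (rule shift_ident) (simp_all add: compose_def)
              finally show ?thesis using rhs True by (simp add: g0_def)
            next
              case G: False
              \<comment> \<open>The restricted chain may have smaller support \<open>V\<close>, so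
                its value was read off from a smaller face. That face is the
                \<open>\<beta>\<close>-face of the one spanned by \<open>U\<close>, and naturality
                of the earlier choices compares the two.\<close>
              define V where "V = supp (?c ` {..i})"
              define v where "v = card V - 1"
              note V' = U[OF c' G V_def, folded v_def]
              define \<beta> where "\<beta> = compose {..v} (rank_in U) (enum_set V)"
              have VU: "V \<subseteq> U" using U'U by (simp add: V_def)
              have inV: "enum_set V x \<in> U" if "x \<le> v" for x
                using enum_set_in[OF V'(1,2)] that VU by (auto simp: v_def)
              have \<beta>: "\<beta> \<in> inj_maps v u"
              proof (rule inj_mapsI)
                show "\<beta> x \<le> u" if "x \<le> v" for x
                  using enum_rank_in(2)[OF U'(1) inV[OF that]] that by (simp add: \<beta>_def compose_def u_def)
                show "\<beta> x < \<beta> y" if "x < y" "y \<le> v" for x y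
                  using rank_in_less[OF U'(1) inV, of x "enum_set V y"] enum_set_less[OF V'(1) that(1)] that
                  by (simp add: \<beta>_def compose_def v_def)
              qed (simp add: \<beta>_def compose_def)
              have eV: "enum_set V = compose {..v} (enum_set U) \<beta>"
              proof (rule ord_maps_eqI[of _ v])
                show "enum_set V x = compose {..v} (enum_set U) \<beta> x" if "x \<le> v" for x
                  using enum_rank_in(1)[OF U'(1) inV[OF that]] that by (simp add: \<beta>_def compose_def)
              qed (simp_all add: compose_def v_def enum_set_def)
              have sv: "shift (rank_in V) i ?c \<in> seqs v i"
                unfolding v_def by (rule shift_rank[OF lowlev[OF c'] V_def])
              have "g0 i ?c = f v (ba v n (enum_set V) b) i (shift (rank_in V) i ?c)"
                using G by (simp add: g0_def Let_def V_def v_def)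
              also have "ba v n (enum_set V) b = ba v u \<beta> (ba u n (enum_set U) b)"
                using B_comp[OF \<beta> U'(5) b] by (simp add: eV)
              also have "f v (ba v u \<beta> (ba u n (enum_set U) b)) i (shift (rank_in V) i ?c) =
                  f u (ba u n (enum_set U) b) i (shift \<beta> i (shift (rank_in V) i ?c))"
                by (rule fnat[OF U'(4) bU \<beta> sv])
              also have "shift \<beta> i (shift (rank_in V) i ?c) = shift (rank_in U) i ?c"
              proof (rule shift_shift)
                fix l assume "l \<in> supp (?c ` {..i})"
                then have "l \<in> V" by (simp add: V_def)
                then show "\<beta> (rank_in V l) = rank_in U l"
                  using enum_rank_in[OF V'(1)] by (simp add: \<beta>_def compose_def v_def)
              qed
              finally show ?thesis using rhs by simp
            qed
          qed
          then show "g0 i (act (cplx le (low n)) i j \<theta> c) = act K i j \<theta> (g0 j c)" by simp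
        qed
        obtain g where g: "g \<in> sset_hom (cplx le (lev n)) K"
          "\<And>j c. c \<in> lseqs n j \<Longrightarrow> g j c = g0 j c"
          using fill[OF g0] by auto
        have "g j c = d n b j c" if "c \<in> bseqs n j" for j c
        proof -
          have "c \<in> lseqs n j" "c ` {..j} \<subseteq> base"
            using that by (auto simp: cplx_simplex_iff low_def blev_def)
          then show ?thesis using g(2) by (simp add: g0_def)
        qed
        moreover have "f k (ba k n \<alpha> b) j c = g j (shift \<alpha> j c)"
          if k: "k < n" "\<alpha> \<in> inj_maps k n" "c \<in> seqs k j" for k \<alpha> j c
        proof -
          let ?c = "shift \<alpha> j c"
          define V where "V = supp (c ` {..j})"
          have F: "c ` {..j} \<in> CC" "V \<subseteq> {..k}" using k(3) by (auto simp: cplx_simplex_iff lev_def V_def)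
          have V: "finite V" "V \<noteq> {}" using supp_fin[OF F(1)] by (auto simp: V_def)
          have sV: "supp (?c ` {..j}) = \<alpha> ` V" by (simp add: shift_image supp_mp V_def)
          \<comment> \<open>A chain coming from dimension \<open>k < n\<close> is supported on at
            most \<open>k + 1\<close> vertices, so its image lies in \<open>low n\<close>, where
            \<open>g\<close> is known to be \<open>g0\<close>.\<close>
          have "card (\<alpha> ` V) \<le> card V" using V by (simp add: card_image_le)
          also have "\<dots> \<le> Suc k" using card_mono[OF _ F(2)] by simp
          finally have "\<alpha> ` V \<noteq> {..n}" using k(1) by auto
          then have cl: "?c \<in> lseqs n j"
            using shift_lev[OF k(3,2)] sV by (auto simp: cplx_simplex_iff low_def)
          show ?thesis
          proof (cases "c ` {..j} \<subseteq> base")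
            case True
            then have cb: "c \<in> bseqs k j" using k(3) by (auto simp: cplx_simplex_iff blev_def)
            have "?c ` {..j} \<subseteq> base" using True mp_base by (auto simp: shift_def)
            then show ?thesis
              using g(2)[OF cl] fbase[OF k(1) B[OF k(2) b] cb] d(2)[OF k(2) b cb] by (simp add: g0_def)
          next
            case False
            then have nb: "\<not> ?c ` {..j} \<subseteq> base" using mp_base by (auto simp: shift_def)
            define v where "v = card V - 1"
            have eV: "enum_set V \<in> inj_maps v k" unfolding v_def by (rule enum_set_inj_maps[OF V F(2)])
            have cV: "card (\<alpha> ` V) - 1 = v" using enum_set_image(2)[OF k(2) F(2) V(2)] by (simp add: v_def)
            have sv: "shift (rank_in V) j c \<in> seqs v j"
              unfolding v_def by (rule shift_rank[OF k(3) V_def])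
            have "g j ?c = f v (ba v n (enum_set (\<alpha> ` V)) b) j (shift (rank_in (\<alpha> ` V)) j ?c)"
              using g(2)[OF cl] nb by (simp add: g0_def Let_def sV cV[unfolded One_nat_def])
            also have "shift (rank_in (\<alpha> ` V)) j ?c = shift (rank_in V) j c"
              by (rule shift_shift) (use enum_set_image(3)[OF k(2) F(2) V(2)] V_def in auto)
            also have "ba v n (enum_set (\<alpha> ` V)) b = ba v k (enum_set V) (ba k n \<alpha> b)"
              using B_comp[OF eV k(2) b] enum_set_image(1)[OF k(2) F(2) V(2)] by (simp add: v_def)
            also have "f v (ba v k (enum_set V) (ba k n \<alpha> b)) j (shift (rank_in V) j c) =
                f k (ba k n \<alpha> b) j (shift (enum_set V) j (shift (rank_in V) j c))"
              by (rule fnat[OF k(1) B[OF k(2) b] eV sv])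
            finally show ?thesis using er[OF k(3) V_def] by simp
          qed
        qed
        ultimately show ?thesis using g(1) False by blast
      qed
      then have "\<exists>r. \<forall>b\<in>B n. r b \<in> sset_hom (cplx le (lev n)) K \<and>
        (\<forall>j. \<forall>c\<in>bseqs n j. r b j c = d n b j c) \<and>
        (b \<in> A n \<longrightarrow> r b = F0 n b) \<and>
        (\<forall>k<n. \<forall>\<alpha>\<in>inj_maps k n. \<forall>j. \<forall>c\<in>seqs k j.
          f k (ba k n \<alpha> b) j c = r b j (shift \<alpha> j c))"
        by (intro bchoice ballI)
      then show ?thesis by (simp only: good_def)
    qed
  qed
  then obtain P where P: "\<And>n. good P n (P n)" by blast
  have "P n b \<in> sset_hom (cplx le (lev n)) K \<and>
    (\<forall>j. \<forall>c\<in>bseqs n j. P n b j c = d n b j c) \<and>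
    (b \<in> A n \<longrightarrow> P n b = F0 n b) \<and>
    (\<forall>k. \<forall>\<alpha>\<in>inj_maps k n. \<forall>j. \<forall>c\<in>seqs k j.
      P k (ba k n \<alpha> b) j c = P n b j (shift \<alpha> j c))" if "b \<in> B n" for n b
    using P[of n] nat[OF P that] that unfolding good_def by blast
  then show ?thesis by blast
qed

end

section \<open>Prisms\<close>

definition ple :: "nat \<times> nat \<Rightarrow> nat \<times> nat \<Rightarrow> bool" where
  "ple p q \<longleftrightarrow> fst p \<le> fst q \<and> snd p \<le> snd q"

text \<open>With the first coordinate bounded by \<open>n\<close>, these are the chains whose
  complex is the prism \<open>\<Delta>\<^sup>n \<times> \<Delta>\<^sup>1\<close>. Only the first
  coordinate counts as support; the base is the end at height 0.\<close>

definition prism_chains :: "(nat \<times> nat) set set" where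
  "prism_chains = {F. finite F \<and> F \<noteq> {} \<and> snd ` F \<subseteq> {..1} \<and> (\<forall>p\<in>F. \<forall>q\<in>F. ple p q \<or> ple q p)}"

definition pmap :: "(nat \<Rightarrow> nat) \<Rightarrow> nat \<times> nat \<Rightarrow> nat \<times> nat" where
  "pmap \<alpha> p = (\<alpha> (fst p), snd p)"

interpretation prism: supp_complex ple prism_chains "\<lambda>p. {fst p}" pmap "{p. snd p = 0}"
proof
  show "face_closed prism_chains"
    unfolding face_closed_def prism_chains_def
    by (intro ballI allI impI CollectI conjI) (blast intro: finite_subset)+
next
  fix F :: "(nat \<times> nat) set" and \<alpha> :: "nat \<Rightarrow> nat"
  assume F: "F \<in> prism_chains" and m: "strict_mono_on (\<Union>((\<lambda>p. {fst p}) ` F)) \<alpha>"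
  have *: "\<alpha> (fst p) \<le> \<alpha> (fst q)" if "p \<in> F" "q \<in> F" "fst p \<le> fst q" for p q
    using strict_mono_on_leD[OF m _ _ that(3)] that(1,2) by blast
  show "ple (pmap \<alpha> p) (pmap \<alpha> q)" if "p \<in> F" "q \<in> F" "ple p q" for p q
    using * that by (simp add: ple_def pmap_def)
  then show "pmap \<alpha> ` F \<in> prism_chains"
    using F unfolding prism_chains_def by (auto simp: pmap_def) blast
qed (auto simp: prism_chains_def pmap_def)

lemma lin_prism: "F \<in> prism_chains \<Longrightarrow> lin ple F"
  by (auto simp: lin_def prism_chains_def ple_def)

lemma prism_supp: "prism.supp F = fst ` F"
  by (auto simp: prism.supp_def)

lemma prism_lev_iff: "F \<in> prism.lev n \<longleftrightarrow> F \<in> prism_chains \<and> fst ` F \<subseteq> {..n}"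
  by (simp add: prism.lev_def prism_supp)

lemma prism_low_iff: "F \<in> prism.low n \<longleftrightarrow> F \<in> prism.lev n \<and> (fst ` F \<noteq> {..n} \<or> snd ` F \<subseteq> {0})"
  by (auto simp: prism.low_def prism_supp)

text \<open>The usual \<open>n + 1\<close> top simplices of the prism, indexed by the place
  \<open>j\<close> where the chain climbs. The face opposite to \<open>(j, 0)\<close> will be the
  free one.\<close>

definition prism_top :: "nat \<Rightarrow> nat \<Rightarrow> (nat \<times> nat) set" where
  "prism_top n j = (\<lambda>l. (l, 0)) ` {..j} \<union> (\<lambda>l. (l, 1)) ` {j..n}"

lemma prism_top_iff[simp]:
  "(l, 0) \<in> prism_top n j \<longleftrightarrow> l \<le> j" "(l, Suc 0) \<in> prism_top n j \<longleftrightarrow> j \<le> l \<and> l \<le> n"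
  by (auto simp: prism_top_def)

lemma prism_top_lev: "j \<le> n \<Longrightarrow> prism_top n j \<in> prism.lev n"
  unfolding prism_lev_iff by (auto simp: prism_chains_def prism_top_def ple_def)

lemma prism_top_not_low:
  assumes "j \<le> n"
  shows "prism_top n j \<notin> prism.low n" "prism_top n j - {(j, 0)} \<notin> prism.low n"
proof -
  have "l \<in> fst ` (prism_top n j - {(j, 0)})" if "l \<le> n" for l
    using assms that by (cases "l < j") (force simp: prism_top_def)+
  moreover have "(n, 1) \<in> prism_top n j - {(j, 0)}" using assms by simp
  moreover have "fst ` prism_top n j \<subseteq> {..n}" using assms by (auto simp: prism_top_def)
  ultimately have "fst ` (prism_top n j - {(j, 0)}) = {..n}" "\<not> snd ` (prism_top n j - {(j, 0)}) \<subseteq> {0}"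
    by force+
  then show "prism_top n j - {(j, 0)} \<notin> prism.low n" by (auto simp: prism_low_iff)
  then show "prism_top n j \<notin> prism.low n"
    using prism.low_closed[of n] \<open>(n, 1) \<in> _\<close> unfolding face_closed_def by (metis Diff_subset empty_iff)
qed

text \<open>A chain over all of \<open>[n]\<close> that reaches height 1 is governed by the first
  \<open>j\<close> at height 1: before \<open>j\<close> only height 0 occurs, and after
  \<open>j\<close> comparability with \<open>(j, 1)\<close> excludes height 0. Only the presence of
  \<open>(j, 0)\<close> is left open.\<close>

lemma prism_not_low:
  assumes "F \<in> prism.lev n" "F \<notin> prism.low n"
  obtains j where "j \<le> n" "(j, 1) \<in> F" "F = prism_top n j \<or> F = prism_top n j - {(j, 0)}"
proof -
  have F: "F \<in> prism_chains" "fst ` F = {..n}" "\<not> snd ` F \<subseteq> {0}"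
    using assms unfolding prism_low_iff prism_lev_iff by blast+
  have s: "t = 0 \<or> t = 1" if "(i, t) \<in> F" for i t
  proof -
    have "snd (i, t) \<in> {..1}" using F(1) that unfolding prism_chains_def by blast
    then show ?thesis by auto
  qed
  obtain i t where "(i, t) \<in> F" "t \<noteq> 0" using F(3) by force
  then have i: "(i, 1) \<in> F" using s by blast
  define j where "j = (LEAST i. (i, 1) \<in> F)"
  have j1: "(j, 1) \<in> F"
    unfolding j_def by (rule LeastI[of "\<lambda>i. (i, 1) \<in> F", OF i])
  have j0: "(l, 1) \<notin> F" if "l < j" for l
    using that unfolding j_def by (rule not_less_Least)
  note j = j1 j0
  have jn: "j \<le> n" using F(2) j(1) by (metis atMost_iff fst_conv image_eqI)
  have cov: "(l, 0) \<in> F \<or> (l, 1) \<in> F" if "l \<le> n" for l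
  proof -
    have "l \<in> fst ` F" using F(2) that by simp
    then show ?thesis using s by force
  qed
  have no0: "(l, 0) \<notin> F" if "l > j" for l
  proof
    assume "(l, 0) \<in> F"
    then have "ple (l, 0) (j, 1) \<or> ple (j, 1) (l, 0)" using F(1) j(1) unfolding prism_chains_def by blast
    then show False using that by (simp add: ple_def)
  qed
  have le: "l \<le> n" if "(l, t) \<in> F" for l t using F(2) that by force
  have "(l, t) \<in> F \<longleftrightarrow> (l, t) \<in> prism_top n j" if "(l, t) \<noteq> (j, 0)" for l t
  proof (cases "t = 0 \<or> t = 1")
    case True
    then show ?thesis
      using that cov[of l] no0[of l] j le[of l t] jn by (cases "l < j"; cases "l = j") auto
  next
    case False
    then show ?thesis using s by (auto simp: prism_top_def)
  qed
  then have "p \<in> F \<longleftrightarrow> p \<in> prism_top n j" if "p \<noteq> (j, 0)" for p using that by (cases p) blast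
  then have "F - {(j, 0)} = prism_top n j - {(j, 0)}" by blast
  moreover have "(j, 0) \<in> prism_top n j" by simp
  ultimately have "F = prism_top n j \<or> F = prism_top n j - {(j, 0)}" by blast
  then show ?thesis using that jn j(1) by blast
qed

text \<open>The classical extension from
  \<open>\<partial>\<Delta>\<^sup>n \<times> \<Delta>\<^sup>1\<close> and the base to the prism. The
  top simplices are attached from \<open>j = n\<close> downwards, since the face shared by the
  simplices \<open>j\<close> and \<open>Suc j\<close> is the free face of the latter and is attached
  together with it.\<close>

lemma prism_fill:
  assumes K: "kan_complex K" and f: "f \<in> sset_hom (cplx ple (prism.low n)) K"
  shows "\<exists>g\<in>sset_hom (cplx ple (prism.lev n)) K. \<forall>j. \<forall>c\<in>prism.lseqs n j. g j c = f j c"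
proof -
  \<comment> \<open>The collapse is indexed by sets, so the index of a top simplex is read off as
    its last vertex at height 0.\<close>
  define mx :: "(nat \<times> nat) set \<Rightarrow> nat" where "mx T = Max {l. (l, 0) \<in> T}" for T
  have mx: "mx (prism_top n j) = j" for j
    unfolding mx_def by (rule Max_eqI) auto
  let ?a = "\<lambda>T. (mx T, 0 :: nat)"
  let ?TT = "prism_top n ` {..n}"
  have eq: "j = j'"
    if "prism_top n j = prism_top n j' \<or> prism_top n j - {(j, 0)} = prism_top n j' - {(j', 0)} \<or>
      prism_top n j = prism_top n j' - {(j', 0)}" "j \<le> n" "j' \<le> n" for j j'
  proof -
    have "(j, 1) \<in> prism_top n j - {(j, 0)}" "(j', 1) \<in> prism_top n j' - {(j', 0)}" using that by auto
    then have "(j, 1) \<in> prism_top n j'" "(j', 1) \<in> prism_top n j" using that(1) by blast+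
    then show ?thesis by simp
  qed
  have U: "prism.low n \<union> (\<Union>T\<in>?TT. {T, T - {?a T}}) = prism.lev n"
  proof (intro equalityI subsetI)
    fix F assume "F \<in> prism.low n \<union> (\<Union>T\<in>?TT. {T, T - {?a T}})"
    then show "F \<in> prism.lev n"
    proof
      assume "F \<in> (\<Union>T\<in>?TT. {T, T - {?a T}})"
      then obtain j where j: "j \<le> n" "F = prism_top n j \<or> F = prism_top n j - {(j, 0)}" by (auto simp: mx)
      then have "F \<subseteq> prism_top n j" "(n, 1) \<in> F" by auto
      then show ?thesis using prism_top_lev[OF j(1)] prism.lev_closed[of n] unfolding face_closed_def by blast
    qed (simp add: prism.low_def)
  next
    fix F assume F: "F \<in> prism.lev n"
    show "F \<in> prism.low n \<union> (\<Union>T\<in>?TT. {T, T - {?a T}})"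
    proof (cases "F \<in> prism.low n")
      case False
      then obtain j where "j \<le> n" "F = prism_top n j \<or> F = prism_top n j - {(j, 0)}"
        using prism_not_low[OF F] by metis
      then show ?thesis by (force simp: mx)
    qed simp
  qed
  have "\<exists>g\<in>sset_hom (cplx ple (prism.low n \<union> (\<Union>T\<in>?TT. {T, T - {?a T}}))) K.
    \<forall>j. \<forall>c\<in>prism.lseqs n j. g j c = f j c"
  proof (rule cplx_collapse[OF K prism.low_closed _ _ _ _ _ f, where r = "\<lambda>T. n - mx T"])
    fix T assume "T \<in> ?TT"
    then obtain j where j: "j \<le> n" "T = prism_top n j" by auto
    have "T \<in> prism_chains" using prism_top_lev[OF j(1)] by (simp add: prism_lev_iff j(2))
    moreover have "{(j, 0), (j, 1)} \<subseteq> T" using j by simp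
    moreover have "card {(j, 0 :: nat), (j, 1)} = 2" by simp
    ultimately have "2 \<le> card T" "finite T" "lin ple T"
      using card_mono[of T "{(j, 0), (j, 1)}"] lin_prism by (auto simp: prism_chains_def)
    then show "finite T \<and> lin ple T \<and> ?a T \<in> T \<and> 2 \<le> card T \<and> T \<notin> prism.low n \<and> T - {?a T} \<notin> prism.low n"
      using prism_top_not_low[OF j(1)] by (simp add: j(2) mx)
  next
    fix T T' assume "T \<in> ?TT" "T' \<in> ?TT"
    then obtain j j' where j: "j \<le> n" "T = prism_top n j" "j' \<le> n" "T' = prism_top n j'" by auto
    show "T = T'" if "T - {?a T} = T' - {?a T'}" using that eq[of j j'] j by (simp add: mx)
    show "T \<noteq> T' - {?a T'}"
    proof
      assume a: "T = T' - {?a T'}"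
      then have "j = j'" using eq[of j j'] j by (simp add: mx)
      then have "(j, 0) \<notin> T" using a j(4) mx by auto
      then show False using j(2) by simp
    qed
  next
    fix T S assume "T \<in> ?TT" and S: "S \<subseteq> T" "S \<noteq> {}" "S \<noteq> T" "S \<noteq> T - {?a T}"
    then obtain j where j: "j \<le> n" "T = prism_top n j" by auto
    have SL: "S \<in> prism.lev n"
      using prism_top_lev[OF j(1)] prism.lev_closed[of n] S(1,2) j(2) unfolding face_closed_def by blast
    show "S \<in> prism.low n \<or> (\<exists>T'\<in>?TT. n - mx T' < n - mx T \<and> (S = T' \<or> S = T' - {?a T'}))"
    proof (cases "S \<in> prism.low n")
      case False
      then obtain i where i: "i \<le> n" "(i, 1) \<in> S" "S = prism_top n i \<or> S = prism_top n i - {(i, 0)}"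
        using prism_not_low[OF SL] by metis
      have "j \<le> i" using i(2) S(1) j by auto
      moreover have "i \<noteq> j" using i(3) S(3,4) j by (auto simp: mx)
      ultimately show ?thesis
        using i by (intro disjI2 bexI[of _ "prism_top n i"]) (auto simp: mx j)
    qed simp
  qed simp
  then show ?thesis unfolding U .
qed

section \<open>The mapping cylinder of the last vertex map\<close>

text \<open>The nodes are the vertices \<open>Inl z\<close> and the faces \<open>Inr A\<close> of a simplex. A chain consists of vertices
  followed by faces that contain all these vertices; the base is the barycentric subdivision.\<close>

fun jle :: "nat + nat set \<Rightarrow> nat + nat set \<Rightarrow> bool" where
  "jle (Inl z) (Inl w) \<longleftrightarrow> z \<le> w"
| "jle (Inl z) (Inr A) \<longleftrightarrow> z \<in> A"
| "jle (Inr A) (Inr B) \<longleftrightarrow> A \<subseteq> B"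
| "jle (Inr A) (Inl z) \<longleftrightarrow> False"

fun jsupp :: "nat + nat set \<Rightarrow> nat set" where
  "jsupp (Inl z) = {z}"
| "jsupp (Inr A) = A"

definition jmap :: "(nat \<Rightarrow> nat) \<Rightarrow> nat + nat set \<Rightarrow> nat + nat set" where
  "jmap \<alpha> = map_sum \<alpha> (image \<alpha>)"

definition cyl_chains :: "(nat + nat set) set set" where
  "cyl_chains = {F. finite F \<and> F \<noteq> {} \<and> (\<forall>v\<in>F. finite (jsupp v) \<and> jsupp v \<noteq> {}) \<and>
     (\<forall>p\<in>F. \<forall>q\<in>F. jle p q \<or> jle q p)}"

interpretation cyl: supp_complex jle cyl_chains jsupp jmap "range Inr"
proof
  show "face_closed cyl_chains"
    unfolding face_closed_def cyl_chains_def by (auto intro: finite_subset)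
next
  have sp: "jsupp (jmap \<alpha> v) = \<alpha> ` jsupp v" for \<alpha> v
    by (cases v) (auto simp: jmap_def)
  then show "jsupp (jmap \<alpha> v) = \<alpha> ` jsupp v" for \<alpha> v .
  fix F :: "(nat + nat set) set" and \<alpha> :: "nat \<Rightarrow> nat"
  assume F: "F \<in> cyl_chains" and m: "strict_mono_on (\<Union>(jsupp ` F)) \<alpha>"
  have m': "\<alpha> z \<le> \<alpha> w" if "Inl z \<in> F" "Inl w \<in> F" "z \<le> w" for z w
  proof -
    have "z \<in> \<Union>(jsupp ` F)" "w \<in> \<Union>(jsupp ` F)" using that(1,2) by force+
    then show ?thesis using strict_mono_on_leD[OF m, of z w] that(3) by blast
  qed
  show *: "jle (jmap \<alpha> p) (jmap \<alpha> q)" if "p \<in> F" "q \<in> F" "jle p q" for p q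
    using that m' by (cases p; cases q) (auto simp: jmap_def)
  show "jmap \<alpha> ` F \<in> cyl_chains"
    using F * unfolding cyl_chains_def by (simp add: sp) blast
next
  show "jmap \<alpha> (jmap \<beta> v) = jmap (\<lambda>i. \<alpha> (\<beta> i)) v" for \<alpha> \<beta> v
    by (cases v) (auto simp: jmap_def)
  show "jmap \<alpha> v = jmap \<beta> v" if "\<And>i. i \<in> jsupp v \<Longrightarrow> \<alpha> i = \<beta> i" for \<alpha> \<beta> v
    using that by (cases v) (auto simp: jmap_def)
  show "jmap (\<lambda>i. i) v = v" for v by (cases v) (auto simp: jmap_def)
  show "jmap \<alpha> v \<in> range Inr \<longleftrightarrow> v \<in> range Inr" for \<alpha> v by (cases v) (auto simp: jmap_def)
qed (auto simp: cyl_chains_def)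

lemma cyl_comparable: "F \<in> cyl_chains \<Longrightarrow> p \<in> F \<Longrightarrow> q \<in> F \<Longrightarrow> jle p q \<or> jle q p"
  by (simp add: cyl_chains_def)

text \<open>The relation \<open>jle\<close> is not transitive: \<open>z \<le> w\<close> and
  \<open>w \<in> A\<close> say nothing about \<open>z \<in> A\<close>. Within a chain, comparability
  supplies it, because a face never lies below a vertex.\<close>

lemma lin_cyl:
  assumes F: "F \<in> cyl_chains"
  shows "lin jle F"
  unfolding lin_def
proof (intro conjI ballI impI)
  fix p q assume "p \<in> F" "q \<in> F"
  then show "jle p q \<or> jle q p" using F by (rule cyl_comparable[rotated])
  show "p = q" if "jle p q" "jle q p" using that by (cases p; cases q) auto
next
  fix p q r assume a: "p \<in> F" "q \<in> F" "r \<in> F" "jle p q" "jle q r"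
  then show "jle p r" using cyl_comparable[OF F a(1,3)] by (cases p; cases q; cases r) auto
qed

text \<open>Chains outside \<open>low n\<close> are matched in pairs by inserting or removing the
  face \<open>Inr (Z S)\<close> spanned by the vertices of the chain. This changes neither the set
  of vertices nor the support, and every chain of a pair recovers its partner.\<close>

lemma cyl_fill:
  assumes K: "kan_complex K" and f: "f \<in> sset_hom (cplx jle (cyl.low n)) K"
  shows "\<exists>g\<in>sset_hom (cplx jle (cyl.lev n)) K. \<forall>j. \<forall>c\<in>cyl.lseqs n j. g j c = f j c"
proof -
  define Z :: "(nat + nat set) set \<Rightarrow> nat set" where "Z F = {z. Inl z \<in> F}" for F
  let ?a = "\<lambda>T. Inr (Z T) :: nat + nat set"
  define TT where "TT = {T \<in> cyl.lev n. cyl.supp T = {..n} \<and> Z T \<noteq> {} \<and> ?a T \<in> T}"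
  have ZR: "Z (T - {Inr A}) = Z T" "Z (insert (Inr A) T) = Z T" for T A by (auto simp: Z_def)
  have Zsupp: "Z F \<subseteq> cyl.supp F" for F by (force simp: Z_def cyl.supp_def)
  have levsub: "F \<subseteq> Inl ` {..n} \<union> Inr ` Pow {..n}" if "F \<in> cyl.lev n" for F
  proof
    fix v assume "v \<in> F"
    then have "jsupp v \<subseteq> {..n}" using that by (auto simp: cyl.lev_def cyl.supp_def)
    then show "v \<in> Inl ` {..n} \<union> Inr ` Pow {..n}" by (cases v) auto
  qed
  have "TT \<subseteq> Pow (Inl ` {..n} \<union> Inr ` Pow {..n})" using levsub by (auto simp: TT_def)
  then have finTT: "finite TT" by (rule finite_subset) simp
  have levfin: "finite F" if "F \<in> cyl.lev n" for F using that cyl.CC_fin by (simp add: cyl.lev_def)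
  have top: "insert (?a S) S \<in> TT" if S: "S \<in> cyl.lev n" "S \<notin> cyl.low n" for S
  proof -
    have s: "cyl.supp S = {..n}" "\<not> S \<subseteq> range Inr" using S by (auto simp: cyl.low_def)
    have "Z S \<noteq> {}"
    proof -
      obtain v where "v \<in> S" "v \<notin> range Inr" using s(2) by blast
      then show ?thesis by (cases v) (auto simp: Z_def)
    qed
    have CS: "S \<in> cyl_chains" using S(1) by (simp add: cyl.lev_def)
    have finZ: "finite (Z S)" using finite_subset[OF Zsupp[of S]] s(1) by simp
    \<comment> \<open>The spanned face fits between the vertices and the faces: it contains all
      vertices of the chain, and every face of the chain contains all of them as well.\<close>
    have le1: "jle v (?a S) \<or> jle (?a S) v" if "v \<in> S" for v
    proof (cases v)
      case (Inl z)
      then show ?thesis using that by (simp add: Z_def)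
    next
      case (Inr A)
      have "z \<in> A" if "z \<in> Z S" for z
        using cyl_comparable[OF CS, of "Inl z" "Inr A"] that \<open>v \<in> S\<close> Inr by (simp add: Z_def)
      then show ?thesis using Inr by auto
    qed
    have "insert (?a S) S \<in> cyl_chains"
      using CS le1 finZ \<open>Z S \<noteq> {}\<close> unfolding cyl_chains_def by auto
    moreover have "cyl.supp (insert (?a S) S) = {..n}"
      using s(1) Zsupp[of S] by (auto simp: cyl.supp_def)
    ultimately show ?thesis using \<open>Z S \<noteq> {}\<close> by (simp add: TT_def cyl.lev_def ZR)
  qed
  have notlow: "T - {?a T} \<notin> cyl.low n" "T \<notin> cyl.low n" if "T \<in> TT" for T
  proof -
    have "Z T \<noteq> {}" using that by (simp add: TT_def)
    then obtain z where z: "z \<in> Z T" by blast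
    then have zT: "Inl z \<in> T - {?a T}" by (auto simp: Z_def)
    then have nb: "\<not> T - {?a T} \<subseteq> range Inr" by auto
    \<comment> \<open>What the removed face contributes to the support is contributed by the
      vertices that span it.\<close>
    have "cyl.supp T \<subseteq> cyl.supp (T - {?a T})"
    proof
      fix x assume "x \<in> cyl.supp T"
      then obtain v where v: "v \<in> T" "x \<in> jsupp v" by (auto simp: cyl.supp_def)
      show "x \<in> cyl.supp (T - {?a T})"
      proof (cases "v = ?a T")
        case True
        then have "x \<in> Z (T - {?a T})" using v by (simp add: ZR)
        then show ?thesis using Zsupp by blast
      qed (use v in \<open>auto simp: cyl.supp_def\<close>)
    qed
    moreover have "cyl.supp (T - {?a T}) \<subseteq> cyl.supp T" by (rule cyl.supp_mono) auto
    ultimately have "cyl.supp (T - {?a T}) = {..n}" using that by (auto simp: TT_def)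
    then show 1: "T - {?a T} \<notin> cyl.low n" using nb by (auto simp: cyl.low_def)
    show "T \<notin> cyl.low n"
    proof
      assume "T \<in> cyl.low n"
      then have "T - {?a T} \<in> cyl.low n"
        using cyl.low_closed[of n] zT unfolding face_closed_def by (metis Diff_subset empty_iff)
      then show False using 1 by simp
    qed
  qed
  have sub: "S \<in> cyl.lev n" if "T \<in> cyl.lev n" "S \<subseteq> T" "S \<noteq> {}" for S T
    using cyl.lev_closed[of n] that unfolding face_closed_def by blast
  have U: "cyl.low n \<union> (\<Union>T\<in>TT. {T, T - {?a T}}) = cyl.lev n"
  proof (intro equalityI subsetI)
    fix F assume "F \<in> cyl.low n \<union> (\<Union>T\<in>TT. {T, T - {?a T}})"
    then show "F \<in> cyl.lev n"
    proof
      assume "F \<in> (\<Union>T\<in>TT. {T, T - {?a T}})"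
      then obtain T where T: "T \<in> TT" "F = T \<or> F = T - {?a T}" by auto
      then have "Z F \<noteq> {}" by (auto simp: TT_def ZR)
      then have "F \<noteq> {}" by (auto simp: Z_def)
      then show ?thesis using sub[of T F] T by (auto simp: TT_def)
    qed (simp add: cyl.low_def)
  next
    fix F assume F: "F \<in> cyl.lev n"
    show "F \<in> cyl.low n \<union> (\<Union>T\<in>TT. {T, T - {?a T}})"
    proof (cases "F \<in> cyl.low n")
      case False
      let ?T = "insert (?a F) F"
      have "F = ?T \<or> F = ?T - {?a ?T}" by (auto simp: ZR)
      then show ?thesis using top[OF F False] by blast
    qed simp
  qed
  have "\<exists>g\<in>sset_hom (cplx jle (cyl.low n \<union> (\<Union>T\<in>TT. {T, T - {?a T}}))) K.
    \<forall>j. \<forall>c\<in>cyl.lseqs n j. g j c = f j c"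
  \<comment> \<open>Completing a boundary face \<open>S\<close> by its spanned face may restore the
    cardinality of \<open>T\<close>, but only if \<open>S\<close> has lost a vertex. The summand
    \<open>card (Z T)\<close> registers this loss, so the rank drops in either case.\<close>
  proof (rule cplx_collapse[OF K cyl.low_closed finTT _ _ _ _ f, where r = "\<lambda>T. card (Z T) + card T"])
    fix T assume T: "T \<in> TT"
    then obtain z where z: "z \<in> Z T" unfolding TT_def by blast
    have fT: "finite T" "lin jle T" using T levfin lin_cyl by (auto simp: TT_def cyl.lev_def)
    have "{Inl z, ?a T} \<subseteq> T" using z T by (auto simp: TT_def Z_def)
    then have "2 \<le> card T" using card_mono[OF fT(1), of "{Inl z, ?a T}"] by simp
    then show "finite T \<and> lin jle T \<and> ?a T \<in> T \<and> 2 \<le> card T \<and> T \<notin> cyl.low n \<and> T - {?a T} \<notin> cyl.low n"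
      using fT notlow[OF T] T by (simp add: TT_def)
  next
    fix T T' assume T: "T \<in> TT" "T' \<in> TT"
    show "T = T'" if "T - {?a T} = T' - {?a T'}"
    proof -
      have "Z T = Z T'" using arg_cong[OF that, of Z] by (simp add: ZR)
      then show ?thesis using that T by (auto simp: TT_def)
    qed
    show "T \<noteq> T' - {?a T'}"
    proof
      assume a: "T = T' - {?a T'}"
      then have "Z T = Z T'" by (simp add: ZR)
      then show False using a T by (auto simp: TT_def)
    qed
  next
    fix T S assume T: "T \<in> TT" and S: "S \<subseteq> T" "S \<noteq> {}" "S \<noteq> T" "S \<noteq> T - {?a T}"
    have SL: "S \<in> cyl.lev n" using T S sub by (auto simp: TT_def)
    show "S \<in> cyl.low n \<or> (\<exists>T'\<in>TT. card (Z T') + card T' < card (Z T) + card T \<and> (S = T' \<or> S = T' - {?a T'}))"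
    proof (cases "S \<in> cyl.low n")
      case False
      let ?T = "insert (?a S) S"
      have eq: "S = ?T \<or> S = ?T - {?a ?T}" by (auto simp: ZR)
      have fT: "finite T" using T levfin by (simp add: TT_def)
      have fZ: "finite (Z T)" using finite_subset[OF Zsupp[of T]] T by (simp add: TT_def)
      have ZST: "Z S \<subseteq> Z T" using S(1) by (auto simp: Z_def)
      have "card (Z ?T) + card ?T < card (Z T) + card T"
      proof (cases "Z S = Z T")
        case True
        have "?T \<subseteq> T" using T S(1) by (auto simp: TT_def True)
        moreover have "?T \<noteq> T" using eq S(3,4) by metis
        ultimately have "card ?T < card T" using fT by (intro psubset_card_mono) auto
        then show ?thesis using True by (simp add: ZR)
      next
        case F: False
        then have "card (Z S) < card (Z T)" using ZST fZ by (intro psubset_card_mono) auto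
        moreover have "card S < card T" using S(1,3) fT by (intro psubset_card_mono) auto
        moreover have "card ?T \<le> Suc (card S)"
          using finite_subset[OF S(1) fT] by (simp add: card_insert_if)
        ultimately show ?thesis by (simp add: ZR)
      qed
      then show ?thesis using top[OF SL False] eq by blast
    qed simp
  qed
  then show ?thesis unfolding U .
qed

section \<open>Straightening semisimplicial maps\<close>

lemma const_simplex_ord: "i \<le> m \<Longrightarrow> const_simplex n i \<in> ord_maps n m"
  by (auto intro!: ord_mapsI simp: const_simplex_def)

lemma const_simplex_compose: "\<theta> \<in> ord_maps k n \<Longrightarrow> compose {..k} (const_simplex n i) \<theta> = const_simplex k i"
  by (auto simp: const_simplex_def compose_def ord_le)

text \<open>The map \<open>\<sigma>\<close> is the quotient of \<open>[n]\<close> by the fibres of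
  \<open>\<kappa>\<close>, with classes numbered by the rank of their value; the values of
  \<open>\<kappa>\<close> matter only through these fibres and their order.\<close>

lemma key_factor:
  fixes \<kappa> :: "nat \<Rightarrow> nat"
  assumes "\<And>i j. i \<le> j \<Longrightarrow> j \<le> n \<Longrightarrow> \<kappa> i \<le> \<kappa> j"
  shows "\<exists>m \<sigma> s. \<sigma> \<in> ord_maps n m \<and> s \<in> inj_maps m n \<and> (\<forall>p\<le>m. \<sigma> (s p) = p) \<and>
    (\<forall>i\<le>n. \<forall>j\<le>n. \<sigma> i = \<sigma> j \<longleftrightarrow> \<kappa> i = \<kappa> j)"
proof -
  define U where "U = \<kappa> ` {..n}"
  define m where "m = card U - 1"
  define \<sigma> where "\<sigma> = (\<lambda>i\<in>{..n}. rank_in U (\<kappa> i))"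
  have U: "finite U" "U \<noteq> {}" by (auto simp: U_def)
  have in_U: "\<kappa> i \<in> U" if "i \<le> n" for i using that by (simp add: U_def)
  have \<sigma>: "\<sigma> \<in> ord_maps n m"
    using enum_rank_in(2)[OF U(1) in_U] rank_in_mono[OF U(1) assms]
    by (intro ord_mapsI) (auto simp: \<sigma>_def m_def)
  have "\<sigma> ` {..n} = {..m}"
  proof
    show "\<sigma> ` {..n} \<subseteq> {..m}" using \<sigma> by (auto dest: ord_le)
    show "{..m} \<subseteq> \<sigma> ` {..n}"
    proof
      fix p assume "p \<in> {..m}"
      then have p: "p \<le> card U - 1" by (simp add: m_def)
      then obtain i where "i \<le> n" "enum_set U p = \<kappa> i" using enum_set_in[OF U p] by (auto simp: U_def)
      then have "\<sigma> i = p" using rank_enum_set[OF U p] by (simp add: \<sigma>_def)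
      then show "p \<in> \<sigma> ` {..n}" using \<open>i \<le> n\<close> by auto
    qed
  qed
  then obtain s where s: "s \<in> inj_maps m n" "compose {..m} \<sigma> s = restrict id {..m}"
    using surj_section[OF \<sigma> _ le0] by metis
  have "\<sigma> (s p) = p" if "p \<le> m" for p using fun_cong[OF s(2), of p] that by (simp add: compose_def)
  moreover have "\<sigma> i = \<sigma> j \<longleftrightarrow> \<kappa> i = \<kappa> j" if "i \<le> n" "j \<le> n" for i j
  proof -
    have "\<sigma> i = rank_in U (\<kappa> i)" "\<sigma> j = rank_in U (\<kappa> j)" using that by (simp_all add: \<sigma>_def)
    then show ?thesis
      using enum_rank_in(1)[OF U(1) in_U[OF that(1)]] enum_rank_in(1)[OF U(1) in_U[OF that(2)]] by metis
  qed
  ultimately show ?thesis using \<sigma> s(1) by (intro exI[of _ m] exI[of _ \<sigma>] exI[of _ s]) auto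
qed

definition step :: "nat \<Rightarrow> nat \<Rightarrow> nat \<Rightarrow> nat" where
  "step n p = (\<lambda>l\<in>{..n}. if l \<le> p then 0 else 1)"

lemma step_ord: "step n p \<in> ord_maps n 1"
  by (auto intro!: ord_mapsI simp: step_def)

text \<open>A vertex of the sequence \<open>c\<close> in a prism is kept on the semisimplicial side unless both its height and
  its type are \<open>1\<close>; the vertices on the simplicial side are moved up by one.\<close>

definition side :: "(nat \<Rightarrow> nat) \<Rightarrow> (nat \<Rightarrow> nat \<times> nat) \<Rightarrow> nat \<Rightarrow> nat" where
  "side t c i = min (snd (c i)) (t (fst (c i)))"

definition raised :: "(nat \<Rightarrow> nat) \<Rightarrow> nat \<Rightarrow> (nat \<Rightarrow> nat \<times> nat) \<Rightarrow> nat \<Rightarrow> nat" where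
  "raised t j c = (\<lambda>i\<in>{..j}. fst (c i) + side t c i)"

definition proj :: "nat \<Rightarrow> (nat \<Rightarrow> nat \<times> nat) \<Rightarrow> nat \<Rightarrow> nat" where
  "proj j c = (\<lambda>i\<in>{..j}. fst (c i))"

text \<open>Exactly for such a \<open>p\<close> do the raised positions on the semisimplicial side
  lie at most at \<open>p\<close> and those on the simplicial side at least at \<open>Suc p\<close>,
  which matches the types \<open>step (Suc n) p\<close>. The vertex \<open>p\<close> itself may
  occur on both sides because \<open>codegen n p\<close> repeats it.\<close>

definition valid_cut :: "nat \<Rightarrow> (nat \<Rightarrow> nat) \<Rightarrow> nat \<Rightarrow> (nat \<Rightarrow> nat \<times> nat) \<Rightarrow> nat \<Rightarrow> bool" where
  "valid_cut n t j c p \<longleftrightarrow> p \<le> n \<and>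
    (\<forall>i\<le>j. (side t c i = 0 \<longrightarrow> fst (c i) \<le> p) \<and> (side t c i = 1 \<longrightarrow> p \<le> fst (c i)))"

lemma prism_seq:
  assumes "c \<in> prism.seqs n j"
  shows "i \<le> j \<Longrightarrow> fst (c i) \<le> n" "i \<le> j \<Longrightarrow> snd (c i) \<le> 1"
    "i \<le> i' \<Longrightarrow> i' \<le> j \<Longrightarrow> fst (c i) \<le> fst (c i')" "i \<le> i' \<Longrightarrow> i' \<le> j \<Longrightarrow> snd (c i) \<le> snd (c i')"
    "c \<in> extensional {..j}"
proof -
  have F: "c ` {..j} \<in> prism.lev n" and le: "\<forall>j'\<le>j. \<forall>i\<le>j'. ple (c i) (c j')" and "c \<in> extensional {..j}"
    using assms by (auto simp: cplx_simplex_iff)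
  then show "c \<in> extensional {..j}" by simp
  have F': "fst ` c ` {..j} \<subseteq> {..n}" "snd ` c ` {..j} \<subseteq> {..1}"
  proof -
    have "c ` {..j} \<in> prism_chains" "fst ` c ` {..j} \<subseteq> {..n}" using F by (simp_all add: prism_lev_iff)
    then show "fst ` c ` {..j} \<subseteq> {..n}" "snd ` c ` {..j} \<subseteq> {..1}" unfolding prism_chains_def by blast+
  qed
  then show "i \<le> j \<Longrightarrow> fst (c i) \<le> n" "i \<le> j \<Longrightarrow> snd (c i) \<le> 1" by (auto simp: image_subset_iff)
  show "i \<le> i' \<Longrightarrow> i' \<le> j \<Longrightarrow> fst (c i) \<le> fst (c i')" "i \<le> i' \<Longrightarrow> i' \<le> j \<Longrightarrow> snd (c i) \<le> snd (c i')"
    using le by (auto simp: ple_def)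
qed

lemma prism_seqI:
  assumes "c \<in> extensional {..j}" "\<And>i. i \<le> j \<Longrightarrow> fst (c i) \<le> n" "\<And>i. i \<le> j \<Longrightarrow> snd (c i) \<le> 1"
    "\<And>i i'. i \<le> i' \<Longrightarrow> i' \<le> j \<Longrightarrow> fst (c i) \<le> fst (c i')" "\<And>i i'. i \<le> i' \<Longrightarrow> i' \<le> j \<Longrightarrow> snd (c i) \<le> snd (c i')"
  shows "c \<in> prism.seqs n j"
proof -
  have le: "ple (c i) (c i')" if "i \<le> i'" "i' \<le> j" for i i' using assms(4,5) that by (simp add: ple_def)
  have "ple (c i) (c i') \<or> ple (c i') (c i)" if "i \<le> j" "i' \<le> j" for i i'
    using le[of i i'] le[of i' i] that by linarith
  then have "c ` {..j} \<in> prism_chains"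
    unfolding prism_chains_def using assms(3) by (auto simp: image_subset_iff)
  then have "c ` {..j} \<in> prism.lev n"
    using assms(2) by (auto simp: prism_lev_iff image_subset_iff)
  then show ?thesis using assms(1) le by (auto simp: cplx_simplex_iff)
qed

lemma side_ord:
  assumes c: "c \<in> prism.seqs n j" and t: "t \<in> ord_maps n 1"
  shows "i \<le> j \<Longrightarrow> side t c i = 0 \<or> side t c i = 1" "i \<le> i' \<Longrightarrow> i' \<le> j \<Longrightarrow> side t c i \<le> side t c i'"
proof -
  show "i \<le> j \<Longrightarrow> side t c i = 0 \<or> side t c i = 1" using prism_seq(2)[OF c, of i] by (auto simp: side_def)
  assume "i \<le> i'" "i' \<le> j"
  then show "side t c i \<le> side t c i'"
    using prism_seq(3,4)[OF c, of i i'] prism_seq(1)[OF c, of i'] ord_mono[OF t, of "fst (c i)" "fst (c i')"]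
    by (auto simp: side_def min_le_iff_disj)
qed

lemma raised_ord:
  assumes c: "c \<in> prism.seqs n j" and t: "t \<in> ord_maps n 1"
  shows "raised t j c \<in> ord_maps j (Suc n)"
proof (rule ord_mapsI)
  show "raised t j c i \<le> Suc n" if "i \<le> j" for i
    using prism_seq(1)[OF c that] side_ord(1)[OF c t that] that by (auto simp: raised_def)
  show "raised t j c i \<le> raised t j c i'" if "i \<le> i'" "i' \<le> j" for i i'
    using prism_seq(3)[OF c that] side_ord(2)[OF c t that] that by (simp add: raised_def)
qed (simp add: raised_def)

lemma proj_ord:
  assumes c: "c \<in> prism.seqs n j"
  shows "proj j c \<in> ord_maps j n"
  using prism_seq[OF c] by (intro ord_mapsI) (auto simp: proj_def)

text \<open>Sides increase along the sequence, so the base point of its last vertex on side 0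
  separates them; if there is none, the cut 0 works.\<close>

lemma valid_cut_ex:
  assumes c: "c \<in> prism.seqs n j" and t: "t \<in> ord_maps n 1"
  obtains p where "valid_cut n t j c p"
proof (cases "\<exists>i\<le>j. side t c i = 0")
  case True
  define i0 where "i0 = Max {i. i \<le> j \<and> side t c i = 0}"
  have "i0 \<in> {i. i \<le> j \<and> side t c i = 0}" unfolding i0_def using True by (intro Max_in) auto
  then have i0: "i0 \<le> j" "side t c i0 = 0" by auto
  have mx: "i \<le> i0" if "i \<le> j" "side t c i = 0" for i
    unfolding i0_def using that by (intro Max_ge) auto
  have "fst (c i) \<le> fst (c i0)" if "i \<le> j" "side t c i = 0" for i
    using prism_seq(3)[OF c mx[OF that] i0(1)] .
  moreover have "fst (c i0) \<le> fst (c i)" if "i \<le> j" "side t c i = 1" for i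
  proof (cases "i \<le> i0")
    case True
    then show ?thesis using side_ord(2)[OF c t True i0(1)] that i0 by simp
  qed (use prism_seq(3)[OF c, of i0 i] that in simp)
  ultimately have "valid_cut n t j c (fst (c i0))"
    using prism_seq(1)[OF c i0(1)] by (auto simp: valid_cut_def)
  then show ?thesis by (rule that)
next
  case False
  then show ?thesis by (intro that[of 0]) (auto simp: valid_cut_def)
qed

lemma side_compose: "\<theta> \<in> ord_maps i j \<Longrightarrow> l \<le> i \<Longrightarrow> side t (compose {..i} c \<theta>) l = side t c (\<theta> l)"
  by (simp add: side_def compose_def)

lemma raised_compose: "\<theta> \<in> ord_maps i j \<Longrightarrow> raised t i (compose {..i} c \<theta>) = compose {..i} (raised t j c) \<theta>"
  by (auto simp: raised_def compose_def side_def ord_le)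

lemma proj_compose: "\<theta> \<in> ord_maps i j \<Longrightarrow> proj i (compose {..i} c \<theta>) = compose {..i} (proj j c) \<theta>"
  by (auto simp: proj_def compose_def ord_le)

lemma side_const: "i \<le> j \<Longrightarrow> c \<in> prism.seqs n j \<Longrightarrow> side (const_simplex n 0) c i = 0"
  using prism_seq(1)[of c n j i] by (simp add: side_def const_simplex_def)

definition subcomplex :: "'a sset \<Rightarrow> (nat \<Rightarrow> 'a set) \<Rightarrow> bool" where
  "subcomplex X S \<longleftrightarrow> (\<forall>n. S n \<subseteq> simplices X n) \<and>
    (\<forall>k n. \<forall>\<sigma>\<in>ord_maps k n. \<forall>x\<in>S n. act X k n \<sigma> x \<in> S k)"

definition semisimplicial :: "'a sset \<Rightarrow> 'k sset \<Rightarrow> (nat \<Rightarrow> 'a \<Rightarrow> 'k) \<Rightarrow> bool" where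
  "semisimplicial X K \<phi> \<longleftrightarrow> (\<forall>n. \<forall>x\<in>simplices X n. \<phi> n x \<in> simplices K n) \<and>
    (\<forall>k n. \<forall>\<alpha>\<in>inj_maps k n. \<forall>x\<in>simplices X n. \<phi> k (act X k n \<alpha> x) = act K k n \<alpha> (\<phi> n x))"

text \<open>A homotopy \<open>X \<times> \<Delta>\<^sup>1 \<rightarrow> K\<close> that starts at the semisimplicial map \<open>\<phi>\<close>, is natural for the operators
  that are injective over the vertex \<open>0\<close> of \<open>\<Delta>\<^sup>1\<close>, and hence ends at a simplicial map.\<close>

definition straightens :: "'a sset \<Rightarrow> 'k sset \<Rightarrow> (nat \<Rightarrow> 'a set) \<Rightarrow> (nat \<Rightarrow> 'a \<Rightarrow> 'k) \<Rightarrow>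
    (nat \<Rightarrow> 'a \<Rightarrow> (nat \<Rightarrow> nat) \<Rightarrow> 'k) \<Rightarrow> bool" where
  "straightens X K S \<phi> h \<longleftrightarrow>
    (\<forall>n. \<forall>x\<in>S n. \<forall>t\<in>ord_maps n 1. h n x t \<in> simplices K n) \<and>
    (\<forall>n. \<forall>x\<in>S n. h n x (const_simplex n 0) = \<phi> n x) \<and>
    (\<forall>k n. \<forall>\<sigma>\<in>ord_maps k n. \<forall>x\<in>S n. \<forall>t\<in>ord_maps n 1. inj_on \<sigma> {i. i \<le> k \<and> t (\<sigma> i) = 0} \<longrightarrow>
      h k (act X k n \<sigma> x) (compose {..k} t \<sigma>) = act K k n \<sigma> (h n x t))"

lemma straightens_in: "straightens X K S \<phi> h \<Longrightarrow> x \<in> S n \<Longrightarrow> t \<in> ord_maps n 1 \<Longrightarrow> h n x t \<in> simplices K n"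
  by (simp add: straightens_def)

lemma straightens_zero: "straightens X K S \<phi> h \<Longrightarrow> x \<in> S n \<Longrightarrow> h n x (const_simplex n 0) = \<phi> n x"
  by (simp add: straightens_def)

lemma straightens_act:
  assumes "straightens X K S \<phi> h" "\<sigma> \<in> ord_maps k n" "x \<in> S n" "t \<in> ord_maps n 1"
    "inj_on \<sigma> {i. i \<le> k \<and> t (\<sigma> i) = 0}"
  shows "h k (act X k n \<sigma> x) (compose {..k} t \<sigma>) = act K k n \<sigma> (h n x t)"
proof -
  have "\<forall>k n. \<forall>\<sigma>\<in>ord_maps k n. \<forall>x\<in>S n. \<forall>t\<in>ord_maps n 1. inj_on \<sigma> {i. i \<le> k \<and> t (\<sigma> i) = 0} \<longrightarrow>
      h k (act X k n \<sigma> x) (compose {..k} t \<sigma>) = act K k n \<sigma> (h n x t)"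
    using assms(1) unfolding straightens_def by (elim conjE)
  then show ?thesis using assms(2-5) by simp
qed

lemma straightens_act_inj: "straightens X K S \<phi> h \<Longrightarrow> \<sigma> \<in> inj_maps k n \<Longrightarrow> x \<in> S n \<Longrightarrow> t \<in> ord_maps n 1 \<Longrightarrow>
    h k (act X k n \<sigma> x) (compose {..k} t \<sigma>) = act K k n \<sigma> (h n x t)"
  by (rule straightens_act) (auto simp: inj_maps_def inj_on_def)

lemma straightensI:
  assumes "\<And>n x t. x \<in> S n \<Longrightarrow> t \<in> ord_maps n 1 \<Longrightarrow> h n x t \<in> simplices K n"
    "\<And>n x. x \<in> S n \<Longrightarrow> h n x (const_simplex n 0) = \<phi> n x"
    "\<And>k n \<sigma> x t. \<sigma> \<in> ord_maps k n \<Longrightarrow> x \<in> S n \<Longrightarrow> t \<in> ord_maps n 1 \<Longrightarrow>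
      inj_on \<sigma> {i. i \<le> k \<and> t (\<sigma> i) = 0} \<Longrightarrow> h k (act X k n \<sigma> x) (compose {..k} t \<sigma>) = act K k n \<sigma> (h n x t)"
  shows "straightens X K S \<phi> h"
  unfolding straightens_def using assms by simp


text \<open>A straightening \<open>h\<close> over \<open>S\<close> assigns to a simplex \<open>x\<close> with types \<open>t\<close> a homotopy \<open>\<Delta>\<^sup>n \<times> \<Delta>\<^sup>1 \<rightarrow> K\<close>
  from \<open>\<phi> x\<close> to \<open>h x t\<close>; on the \<open>p\<close>-th top simplex of the prism it is the value of \<open>h\<close> at the degeneracy
  of \<open>x\<close> that repeats the vertex \<open>p\<close>, once on the semisimplicial and once on the simplicial side.\<close>

locale straightening =
  fixes X :: "'a sset" and K :: "'k sset" and S :: "nat \<Rightarrow> 'a set" and \<phi> :: "nat \<Rightarrow> 'a \<Rightarrow> 'k"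
    and h :: "nat \<Rightarrow> 'a \<Rightarrow> (nat \<Rightarrow> nat) \<Rightarrow> 'k"
  assumes sX: "simplicial_set X" and sK: "simplicial_set K" and S: "subcomplex X S"
    and phi: "semisimplicial X K \<phi>" and h: "straightens X K S \<phi> h"
begin

lemma S_in: "x \<in> S n \<Longrightarrow> x \<in> simplices X n"
  using S by (auto simp: subcomplex_def)

lemma S_act: "x \<in> S n \<Longrightarrow> \<theta> \<in> ord_maps k n \<Longrightarrow> act X k n \<theta> x \<in> S k"
  using S by (simp add: subcomplex_def)

lemma phi_in: "x \<in> simplices X n \<Longrightarrow> \<phi> n x \<in> simplices K n"
  using phi by (simp add: semisimplicial_def)

lemma phi_nat: "\<alpha> \<in> inj_maps k n \<Longrightarrow> x \<in> simplices X n \<Longrightarrow> \<phi> k (act X k n \<alpha> x) = act K k n \<alpha> (\<phi> n x)"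
  using phi by (simp add: semisimplicial_def)

definition bval :: "nat \<Rightarrow> 'a \<Rightarrow> nat \<Rightarrow> nat \<Rightarrow> (nat \<Rightarrow> nat) \<Rightarrow> 'k" where
  "bval n x p j \<rho> = act K j (Suc n) \<rho> (h (Suc n) (act X (Suc n) n (codegen n p) x) (step (Suc n) p))"

text \<open>Neighbouring top simplices of the prism meet in the face that omits
  \<open>Suc p\<close>. This face operator is injective, so \<open>h\<close> respects it, and from
  either side it yields \<open>h n x (step n p)\<close>.\<close>

lemma bval_face:
  assumes x: "x \<in> S n" and p: "p \<le> n" "q = p \<or> q = Suc p" and \<tau>: "\<tau> \<in> ord_maps j n" and q: "q \<le> n"
  shows "bval n x q j (compose {..j} (coface n (Suc p)) \<tau>) = act K j n \<tau> (h n x (step n p))"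
proof -
  note cfi = coface_inj[of n "Suc p"]
  note cf = inj_maps_ord[OF cfi] and cg = codegen_ord[OF q]
  note W = S_act[OF x cg]
  have "compose {..n} (codegen n q) (coface n (Suc p)) = restrict id {..n}"
    using p(2) by (intro ord_maps_eqI[of _ n]) (auto simp: compose_def codegen_def coface_def)
  then have e1: "act X n (Suc n) (coface n (Suc p)) (act X (Suc n) n (codegen n q) x) = x"
    using act_comp[OF sX cf cg S_in[OF x]] act_id[OF sX S_in[OF x]] by simp
  have e2: "compose {..n} (step (Suc n) q) (coface n (Suc p)) = step n p"
    using p(2) by (intro ord_maps_eqI[of _ n]) (auto simp: compose_def coface_def step_def)
  have "bval n x q j (compose {..j} (coface n (Suc p)) \<tau>) =
      act K j n \<tau> (act K n (Suc n) (coface n (Suc p)) (h (Suc n) (act X (Suc n) n (codegen n q) x) (step (Suc n) q)))"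
    unfolding bval_def by (rule act_comp[OF sK \<tau> cf straightens_in[OF h W step_ord], symmetric])
  also have "act K n (Suc n) (coface n (Suc p)) (h (Suc n) (act X (Suc n) n (codegen n q) x) (step (Suc n) q)) = h n x (step n p)"
    using straightens_act_inj[OF h cfi W step_ord, of q] by (simp add: e1 e2)
  finally show ?thesis .
qed

text \<open>If \<open>p\<close> and \<open>Suc p\<close> both cut the sequence, no raised vertex
  equals \<open>Suc p\<close>; the value is then taken in the common face of the two top
  simplices.\<close>

lemma bval_step:
  assumes x: "x \<in> S n" and t: "t \<in> ord_maps n 1"
    and c: "c \<in> prism.seqs n j" and p: "valid_cut n t j c p" "valid_cut n t j c (Suc p)"
  shows "bval n x (Suc p) j (raised t j c) = bval n x p j (raised t j c)"
proof -
  have "raised t j c = compose {..j} (coface n (Suc p)) (proj j c)"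
  proof (rule ord_maps_eqI[of _ j])
    show "raised t j c i = compose {..j} (coface n (Suc p)) (proj j c) i" if "i \<le> j" for i
      using p that side_ord(1)[OF c t that] prism_seq(1)[OF c that]
      by (auto simp: raised_def compose_def coface_def proj_def valid_cut_def)
  qed (simp_all add: raised_def compose_def)
  then show ?thesis
    using bval_face[OF x _ _ proj_ord[OF c], of p "Suc p"] bval_face[OF x _ _ proj_ord[OF c], of p p] p
    by (simp add: valid_cut_def)
qed

text \<open>Valid cuts form an interval, so any two are joined by single steps.\<close>

lemma bval_indep:
  assumes x: "x \<in> S n" and t: "t \<in> ord_maps n 1"
    and c: "c \<in> prism.seqs n j" and p: "valid_cut n t j c p" "valid_cut n t j c q"
  shows "bval n x p j (raised t j c) = bval n x q j (raised t j c)"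
proof -
  have *: "bval n x q j (raised t j c) = bval n x p j (raised t j c)"
    if "p \<le> q" "valid_cut n t j c p" "valid_cut n t j c q" for p q
    using that
  proof (induction q rule: dec_induct)
    case (step r)
    have "valid_cut n t j c r" using step.hyps step.prems by (auto simp: valid_cut_def intro: order_trans)
    then show ?case using step bval_step[OF x t c] by simp
  qed simp
  show ?thesis using *[of p q] *[of q p] p by (cases "p \<le> q") auto
qed

text \<open>The first case involves \<open>\<phi>\<close> alone. It makes the prism meaningful for
  simplices outside \<open>S\<close> as long as their type is constantly 0; over \<open>S\<close> it
  agrees with the second case by \<open>bdry_bval\<close>.\<close>

definition bdry :: "nat \<Rightarrow> 'a \<times> (nat \<Rightarrow> nat) \<Rightarrow> nat \<Rightarrow> (nat \<Rightarrow> nat \<times> nat) \<Rightarrow> 'k" where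
  "bdry n b j = (\<lambda>c\<in>prism.seqs n j.
     if \<forall>i\<le>j. side (snd b) c i = 0 then act K j n (proj j c) (\<phi> n (fst b))
     else bval n (fst b) (SOME p. valid_cut n (snd b) j c p) j (raised (snd b) j c))"

lemma bdry_zero:
  assumes "c \<in> prism.seqs n j" "\<And>i. i \<le> j \<Longrightarrow> side t c i = 0"
  shows "bdry n (x, t) j c = act K j n (proj j c) (\<phi> n x)"
  using assms by (simp add: bdry_def)

lemma bdry_bval:
  assumes x: "x \<in> S n" and t: "t \<in> ord_maps n 1"
    and c: "c \<in> prism.seqs n j" and p: "valid_cut n t j c p"
  shows "bdry n (x, t) j c = bval n x p j (raised t j c)"
proof (cases "\<forall>i\<le>j. side t c i = 0")
  case True
  \<comment> \<open>With everything on side 0 the cut can be moved to \<open>n\<close>. There the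
    raised vertices miss \<open>Suc n\<close>, and what remains is \<open>h\<close> at type 0, which
    is \<open>\<phi>\<close>.\<close>
  have vn: "valid_cut n t j c n" using True prism_seq(1)[OF c] by (auto simp: valid_cut_def)
  have r: "raised t j c = compose {..j} (coface n (Suc n)) (proj j c)"
    using True prism_seq(1)[OF c]
    by (intro ord_maps_eqI[of _ j]) (auto simp: raised_def compose_def coface_def proj_def less_Suc_eq_le)
  have s: "step n n = const_simplex n 0" by (auto simp: step_def const_simplex_def)
  have "bval n x n j (raised t j c) = act K j n (proj j c) (h n x (step n n))"
    unfolding r by (rule bval_face[OF x _ _ proj_ord[OF c]]) auto
  then show ?thesis using bdry_zero[OF c] True bval_indep[OF x t c p vn] straightens_zero[OF h x] s by simp
next
  case False
  then have "bdry n (x, t) j c = bval n x (SOME p. valid_cut n t j c p) j (raised t j c)"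
    using c by (auto simp: bdry_def)
  then show ?thesis using bval_indep[OF x t c p someI[of "valid_cut n t j c", OF p]] by simp
qed

definition bwords :: "nat \<Rightarrow> ('a \<times> (nat \<Rightarrow> nat)) set" where
  "bwords n = {(x, t). x \<in> simplices X n \<and> t \<in> ord_maps n 1 \<and> (x \<in> S n \<or> t = const_simplex n 0)}"

lemma bdry_hom:
  assumes "(x, t) \<in> bwords n"
  shows "bdry n (x, t) \<in> sset_hom (cplx ple (prism.lev n)) K"
proof -
  have x: "x \<in> simplices X n" "t \<in> ord_maps n 1" using assms by (auto simp: bwords_def)
  have "(\<lambda>j. restrict (bdry n (x, t) j) (prism.seqs n j)) \<in> sset_hom (cplx ple (prism.lev n)) K"
  proof (rule hom_restrictI[OF simplicial_set_cplx[OF prism.lev_closed]])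
    fix j c assume c: "c \<in> prism.seqs n j"
    show "bdry n (x, t) j c \<in> simplices K j"
    proof (cases "x \<in> S n")
      case False
      then have "t = const_simplex n 0" using assms by (auto simp: bwords_def)
      then show ?thesis
        using bdry_zero[OF c] side_const[OF _ c] act_closed[OF sK proj_ord[OF c] phi_in[OF x(1)]] by simp
    next
      case True
      obtain p where p: "valid_cut n t j c p" using valid_cut_ex[OF c x(2)] .
      then have pn: "p \<le> n" by (simp add: valid_cut_def)
      show ?thesis
        unfolding bdry_bval[OF True x(2) c p] bval_def
        by (rule act_closed[OF sK raised_ord[OF c x(2)] straightens_in[OF h S_act[OF True codegen_ord[OF pn]] step_ord]])
    qed
  next
    fix i j \<theta> c assume \<theta>: "\<theta> \<in> ord_maps i j" and c: "c \<in> prism.seqs n j"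
    let ?c = "compose {..i} c \<theta>"
    have c': "?c \<in> prism.seqs n i" by (rule cplx_act_closed[OF prism.lev_closed \<theta> c])
    have "bdry n (x, t) i ?c = act K i j \<theta> (bdry n (x, t) j c)"
    proof (cases "x \<in> S n")
      case False
      then have "t = const_simplex n 0" using assms by (auto simp: bwords_def)
      then show ?thesis
        using bdry_zero[OF c] bdry_zero[OF c'] side_const[OF _ c] side_const[OF _ c']
          act_comp[OF sK \<theta> proj_ord[OF c] phi_in[OF x(1)]] proj_compose[OF \<theta>, of c] by simp
    next
      case True
      obtain p where p: "valid_cut n t j c p" using valid_cut_ex[OF c x(2)] .
      then have pn: "p \<le> n" by (simp add: valid_cut_def)
      have p': "valid_cut n t i ?c p"
        using p \<theta> by (auto simp: valid_cut_def side_compose[OF \<theta>] ord_le) (auto simp: compose_def ord_le)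
      show ?thesis
        unfolding bdry_bval[OF True x(2) c p] bdry_bval[OF True x(2) c' p'] bval_def raised_compose[OF \<theta>]
        by (rule act_comp[OF sK \<theta> raised_ord[OF c x(2)] straightens_in[OF h S_act[OF True codegen_ord[OF pn]] step_ord], symmetric])
    qed
    then show "bdry n (x, t) i (act (cplx ple (prism.lev n)) i j \<theta> c) = act K i j \<theta> (bdry n (x, t) j c)" by simp
  qed
  moreover have "(\<lambda>j. restrict (bdry n (x, t) j) (prism.seqs n j)) = bdry n (x, t)"
    by (rule ext) (simp add: bdry_def)
  ultimately show ?thesis by simp
qed

text \<open>The operator \<open>\<alpha>\<close> has to be lifted to the degenerate simplices that
  define the prism. The lift must again be injective, because at type 0 this is all that
  \<open>h\<close> respects.\<close>

lemma bdry_nat: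
  assumes \<alpha>: "\<alpha> \<in> inj_maps k n" and b: "(x, t) \<in> bwords n" and c: "c \<in> prism.seqs k j"
  shows "bdry k (act X k n \<alpha> x, compose {..k} t \<alpha>) j c = bdry n (x, t) j (prism.shift \<alpha> j c)"
proof -
  let ?x = "act X k n \<alpha> x" and ?t = "compose {..k} t \<alpha>" and ?c = "prism.shift \<alpha> j c"
  have x: "x \<in> simplices X n" "t \<in> ord_maps n 1" using b by (auto simp: bwords_def)
  note \<alpha>o = inj_maps_ord[OF \<alpha>]
  have x': "?x \<in> simplices X k" "?t \<in> ord_maps k 1" using ord_maps_comp[OF \<alpha>o] act_closed[OF sX \<alpha>o] x by auto
  have c': "?c \<in> prism.seqs n j" by (rule prism.shift_lev[OF c \<alpha>])
  have ci: "fst (?c i) = \<alpha> (fst (c i))" "snd (?c i) = snd (c i)" if "i \<le> j" for i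
    using that by (simp_all add: prism.shift_def pmap_def)
  have si: "side t ?c i = side ?t c i" if "i \<le> j" for i
    using ci[OF that] prism_seq(1)[OF c that] by (simp add: side_def compose_def)
  have pr: "proj j ?c = compose {..j} \<alpha> (proj j c)"
    using ci by (auto simp: proj_def compose_def)
  show ?thesis
  proof (cases "x \<in> S n")
    case False
    then have t: "t = const_simplex n 0" using b by (auto simp: bwords_def)
    then have t': "?t = const_simplex k 0" using const_simplex_compose[OF \<alpha>o] by simp
    have "bdry k (?x, ?t) j c = act K j k (proj j c) (\<phi> k ?x)"
      by (rule bdry_zero[OF c]) (simp add: t' side_const[OF _ c])
    also have "\<phi> k ?x = act K k n \<alpha> (\<phi> n x)" by (rule phi_nat[OF \<alpha> x(1)])
    also have "act K j k (proj j c) (act K k n \<alpha> (\<phi> n x)) = act K j n (proj j ?c) (\<phi> n x)"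
      unfolding pr by (rule act_comp[OF sK proj_ord[OF c] \<alpha>o phi_in[OF x(1)]])
    also have "\<dots> = bdry n (x, t) j ?c"
      by (rule bdry_zero[OF c', symmetric]) (simp add: t side_const[OF _ c'])
    finally show ?thesis .
  next
    case True
    have ns: "?x \<in> S k" by (rule S_act[OF True \<alpha>o])
    obtain p where p: "valid_cut k ?t j c p" using valid_cut_ex[OF c x'(2)] .
    then have pk: "p \<le> k" by (simp add: valid_cut_def)
    have \<alpha>p: "\<alpha> p \<le> n" using ord_le[OF \<alpha>o pk] .
    have p': "valid_cut n t j ?c (\<alpha> p)"
      using p \<alpha>p pk prism_seq(1)[OF c] by (auto simp: valid_cut_def si ci inj_maps_le_iff[OF \<alpha>])
    \<comment> \<open>The lift of \<open>\<alpha>\<close> that doubles the cut vertex: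
      \<open>p\<close> and \<open>Suc p\<close> go to \<open>\<alpha> p\<close> and
      \<open>Suc (\<alpha> p)\<close>. It intertwines the codegeneracies at \<open>p\<close> and
      \<open>\<alpha> p\<close> and preserves the types.\<close>
    define \<beta> where "\<beta> = (\<lambda>l\<in>{..Suc k}. if l \<le> p then \<alpha> l else Suc (\<alpha> (l - 1)))"
    have \<beta>: "\<beta> \<in> inj_maps (Suc k) (Suc n)"
    proof (rule inj_mapsI)
      show "\<beta> l \<le> Suc n" if "l \<le> Suc k" for l
        using that pk ord_le[OF \<alpha>o, of l] ord_le[OF \<alpha>o, of "l - 1"] by (auto simp: \<beta>_def)
      show "\<beta> l < \<beta> l'" if "l < l'" "l' \<le> Suc k" for l l'
      proof (cases "l' \<le> p \<or> p < l")
        case True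
        then show ?thesis
          using that pk inj_maps_less[OF \<alpha>, of l l'] inj_maps_less[OF \<alpha>, of "l - 1" "l' - 1"] by (auto simp: \<beta>_def)
      next
        case F: False
        have "\<alpha> l \<le> \<alpha> (l' - 1)" using F that by (intro ord_mono[OF \<alpha>o]) auto
        then show ?thesis using F that by (auto simp: \<beta>_def)
      qed
    qed (simp add: \<beta>_def)
    note \<beta>o = inj_maps_ord[OF \<beta>]
    have e1': "compose {..Suc k} (codegen n (\<alpha> p)) \<beta> = compose {..Suc k} \<alpha> (codegen k p)"
    proof (rule ord_maps_eqI[of _ "Suc k"])
      fix l assume l: "l \<le> Suc k"
      show "compose {..Suc k} (codegen n (\<alpha> p)) \<beta> l = compose {..Suc k} \<alpha> (codegen k p) l"
      proof (cases "l \<le> p")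
        case True
        then have "\<alpha> l \<le> \<alpha> p" "\<alpha> l \<le> n" using pk by (auto intro: ord_mono[OF \<alpha>o] ord_le[OF \<alpha>o])
        then show ?thesis using True l pk by (simp add: compose_def \<beta>_def codegen_def)
      next
        case F: False
        then have "\<alpha> p \<le> \<alpha> (l - 1)" "\<alpha> (l - 1) \<le> n" using l by (auto intro!: ord_mono[OF \<alpha>o] ord_le[OF \<alpha>o])
        then show ?thesis using F l pk by (simp add: compose_def \<beta>_def codegen_def)
      qed
    qed (simp_all add: compose_def)
    have e1: "act X (Suc k) (Suc n) \<beta> (act X (Suc n) n (codegen n (\<alpha> p)) x) = act X (Suc k) k (codegen k p) ?x"
      using act_comp[OF sX \<beta>o codegen_ord[OF \<alpha>p] x(1)] act_comp[OF sX codegen_ord[OF pk] \<alpha>o x(1)] e1' by simp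
    have e2: "compose {..Suc k} (step (Suc n) (\<alpha> p)) \<beta> = step (Suc k) p"
    proof (rule ord_maps_eqI[of _ "Suc k"])
      fix l assume l: "l \<le> Suc k"
      show "compose {..Suc k} (step (Suc n) (\<alpha> p)) \<beta> l = step (Suc k) p l"
      proof (cases "l \<le> p")
        case True
        then have "\<alpha> l \<le> \<alpha> p" "\<alpha> l \<le> n" using pk by (auto intro: ord_mono[OF \<alpha>o] ord_le[OF \<alpha>o])
        then show ?thesis using True l pk by (simp add: compose_def \<beta>_def step_def)
      next
        case F: False
        then have "\<alpha> p \<le> \<alpha> (l - 1)" "\<alpha> (l - 1) \<le> n" using l by (auto intro!: ord_mono[OF \<alpha>o] ord_le[OF \<alpha>o])
        then show ?thesis using F l pk by (simp add: compose_def \<beta>_def step_def)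
      qed
    qed (simp_all add: compose_def step_def)
    have e3: "raised t j ?c = compose {..j} \<beta> (raised ?t j c)"
    proof (rule ord_maps_eqI[of _ j])
      fix i assume i: "i \<le> j"
      have f: "fst (c i) \<le> k" using prism_seq(1)[OF c i] .
      show "raised t j ?c i = compose {..j} \<beta> (raised ?t j c) i"
      proof (cases "side ?t c i = 0")
        case True
        then have "fst (c i) \<le> p" using p i by (simp add: valid_cut_def)
        then show ?thesis using True i f by (simp add: raised_def compose_def[of "{..j}"] si ci \<beta>_def)
      next
        case F: False
        then have s1: "side ?t c i = 1" using side_ord(1)[OF c x'(2) i] by simp
        then have "p \<le> fst (c i)" using p i by (simp add: valid_cut_def)
        then show ?thesis using s1 i f by (simp add: raised_def compose_def[of "{..j}"] si ci \<beta>_def)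
      qed
    qed (simp_all add: raised_def compose_def)
    note W = S_act[OF True codegen_ord[OF \<alpha>p]]
    have "bval k ?x p j (raised ?t j c) =
        act K j (Suc k) (raised ?t j c) (act K (Suc k) (Suc n) \<beta> (h (Suc n) (act X (Suc n) n (codegen n (\<alpha> p)) x) (step (Suc n) (\<alpha> p))))"
      unfolding bval_def straightens_act_inj[OF h \<beta> W step_ord, symmetric] e1 e2 ..
    also have "\<dots> = bval n x (\<alpha> p) j (raised t j ?c)"
      unfolding bval_def e3 by (rule act_comp[OF sK raised_ord[OF c x'(2)] \<beta>o straightens_in[OF h W step_ord]])
    finally show ?thesis
      using bdry_bval[OF ns x'(2) c p] bdry_bval[OF True x(2) c' p'] by simp
  qed
qed

definition topseq :: "nat \<Rightarrow> nat \<Rightarrow> nat \<times> nat" where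
  "topseq n = (\<lambda>i\<in>{..n}. (i, 1))"

lemma topseq_in: "topseq n \<in> prism.seqs n n"
  by (rule prism_seqI) (auto simp: topseq_def)

lemma bdry_top_zero:
  assumes x: "x \<in> simplices X n"
  shows "bdry n (x, const_simplex n 0) n (topseq n) = \<phi> n x"
proof -
  have "proj n (topseq n) = restrict id {..n}" by (auto simp: proj_def topseq_def)
  then show ?thesis
    using bdry_zero[OF topseq_in side_const[OF _ topseq_in], of n x] act_id[OF sK phi_in[OF x]] by simp
qed

text \<open>At height 1 the side of the vertex \<open>i\<close> is its type, so raising is the map
  from \<open>i\<close> to \<open>i + t i\<close>. It is injective and a section of the codegeneracy
  at the cut, hence naturality of \<open>h\<close> returns the typed simplex itself.\<close>

lemma bdry_top:
  assumes x: "x \<in> S n" and t: "t \<in> ord_maps n 1"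
  shows "bdry n (x, t) n (topseq n) = h n x t"
proof -
  obtain p where p: "valid_cut n t n (topseq n) p" using valid_cut_ex[OF topseq_in t] .
  then have pn: "p \<le> n" by (simp add: valid_cut_def)
  have s: "side t (topseq n) i = t i" if "i \<le> n" for i
    using that ord_le[OF t that] by (simp add: side_def topseq_def)
  define \<rho> where "\<rho> = raised t n (topseq n)"
  have \<rho>: "\<rho> i = i + t i" if "i \<le> n" for i
    using that s by (simp add: \<rho>_def raised_def) (simp add: topseq_def)
  have inj: "\<rho> \<in> inj_maps n (Suc n)"
  proof (rule inj_mapsI)
    show "\<rho> i \<le> Suc n" if "i \<le> n" for i using ord_le[OF t that] \<rho>[OF that] that by simp
    show "\<rho> i < \<rho> j" if "i < j" "j \<le> n" for i j
      using ord_mono[OF t, of i j] \<rho>[of i] \<rho>[of j] that by simp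
  qed (simp add: \<rho>_def raised_def)
  have t01: "t i = 0 \<and> i \<le> p \<or> t i = 1 \<and> p \<le> i" if "i \<le> n" for i
  proof -
    have "t i = 0 \<or> t i = 1" using ord_le[OF t that] by linarith
    moreover have "fst (topseq n i) = i" using that by (simp add: topseq_def)
    ultimately show ?thesis using p that s[OF that] unfolding valid_cut_def by auto
  qed
  have "compose {..n} (codegen n p) \<rho> = restrict id {..n}"
  proof (rule ord_maps_eqI[of _ n])
    show "compose {..n} (codegen n p) \<rho> i = restrict id {..n} i" if "i \<le> n" for i
      using t01[OF that] \<rho>[OF that] that by (auto simp: compose_def codegen_def)
  qed (auto simp: compose_def)
  then have e1: "act X n (Suc n) \<rho> (act X (Suc n) n (codegen n p) x) = x"
    using act_comp[OF sX inj_maps_ord[OF inj] codegen_ord[OF pn] S_in[OF x]] act_id[OF sX S_in[OF x]] by simp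
  have e2: "compose {..n} (step (Suc n) p) \<rho> = t"
  proof (rule ord_maps_eqI[of _ n])
    show "compose {..n} (step (Suc n) p) \<rho> i = t i" if "i \<le> n" for i
      using t01[OF that] \<rho>[OF that] that by (auto simp: compose_def step_def)
  qed (use t ord_maps_ext in \<open>auto simp: compose_def\<close>)
  show ?thesis
    using straightens_act_inj[OF h inj S_act[OF x codegen_ord[OF pn]] step_ord, of p]
    by (simp add: bdry_bval[OF x t topseq_in p] bval_def \<rho>_def[symmetric] e1 e2)
qed

end

text \<open>Typed words in \<open>[m]\<close> are the simplices of \<open>\<Delta>\<^sup>m \<times> \<Delta>\<^sup>1\<close>. To extend a straightening from the boundary of
  \<open>\<Delta>\<^sup>m\<close>, it suffices to treat the words that are injective on the letters of type \<open>1\<close>; among these, the words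
  that are non-surjective or have type \<open>0\<close> carry a homotopy to \<open>\<phi>\<close>, which \<open>prism.lift\<close> extends to all.\<close>

definition boundary_words :: "nat \<Rightarrow> nat \<Rightarrow> (nat \<Rightarrow> nat) set" where
  "boundary_words m n = {w \<in> ord_maps n m. w ` {..n} \<noteq> {..m}}"

lemma std_simplex_simps[simp]:
  "simplices (std_simplex m) n = ord_maps n m" "act (std_simplex m) k n \<theta> w = compose {..k} w \<theta>"
  by (simp_all add: std_simplex_def)

lemma nonsurj_compose: "w \<in> ord_maps n m \<Longrightarrow> w ` {..n} \<noteq> {..m} \<Longrightarrow> \<theta> \<in> ord_maps k n \<Longrightarrow>
    compose {..k} w \<theta> ` {..k} \<noteq> {..m}"
  using compose_image_ord[of \<theta> k n w] by (auto dest: ord_le)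

lemma subcomplex_boundary: "subcomplex (std_simplex m) (boundary_words m)"
  unfolding subcomplex_def
proof (intro conjI allI ballI)
  show "boundary_words m n \<subseteq> simplices (std_simplex m) n" for n by (auto simp: boundary_words_def)
  show "act (std_simplex m) k n \<sigma> x \<in> boundary_words m k"
    if "\<sigma> \<in> ord_maps k n" "x \<in> boundary_words m n" for k n \<sigma> x
    using that nonsurj_compose[of x n m \<sigma> k] by (simp add: boundary_words_def ord_maps_comp)
qed

locale cell_data =
  fixes K :: "'k sset" and m :: nat and \<phi> :: "nat \<Rightarrow> (nat \<Rightarrow> nat) \<Rightarrow> 'k"
    and \<epsilon>0 :: "nat \<Rightarrow> (nat \<Rightarrow> nat) \<Rightarrow> (nat \<Rightarrow> nat) \<Rightarrow> 'k"
  assumes K: "kan_complex K" and phi': "semisimplicial (std_simplex m) K \<phi>"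
    and eps: "straightens (std_simplex m) K (boundary_words m) \<phi> \<epsilon>0"

sublocale cell_data \<subseteq> straightening "std_simplex m" K "boundary_words m" \<phi> \<epsilon>0
  using K phi' eps by unfold_locales
    (simp_all add: simplicial_set_std_simplex kan_simplicial subcomplex_boundary)

context cell_data
begin

text \<open>These words are closed under injective operators but not under degeneracies, which is
  the structure \<open>prism.lift\<close> works with.\<close>

definition twords :: "nat \<Rightarrow> ((nat \<Rightarrow> nat) \<times> (nat \<Rightarrow> nat)) set" where
  "twords n = {(w, t). w \<in> ord_maps n m \<and> t \<in> ord_maps n 1 \<and> inj_on w {i. i \<le> n \<and> t i = 1}}"

definition wact :: "nat \<Rightarrow> nat \<Rightarrow> (nat \<Rightarrow> nat) \<Rightarrow> (nat \<Rightarrow> nat) \<times> (nat \<Rightarrow> nat) \<Rightarrow> (nat \<Rightarrow> nat) \<times> (nat \<Rightarrow> nat)" where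
  "wact k n \<alpha> b = (compose {..k} (fst b) \<alpha>, compose {..k} (snd b) \<alpha>)"

definition zend :: "nat \<Rightarrow> (nat \<Rightarrow> nat) \<times> (nat \<Rightarrow> nat) \<Rightarrow> nat \<Rightarrow> (nat \<Rightarrow> nat \<times> nat) \<Rightarrow> 'k" where
  "zend n b j = (\<lambda>c\<in>prism.bseqs n j. act K j n (proj j c) (\<phi> n (fst b)))"

lemma blev_lev: "c \<in> prism.bseqs n j \<Longrightarrow> c \<in> prism.seqs n j"
  by (simp add: cplx_simplex_iff prism.blev_def)

lemma blev_snd: "c \<in> prism.bseqs n j \<Longrightarrow> i \<le> j \<Longrightarrow> snd (c i) = 0"
  by (auto simp: cplx_simplex_iff prism.blev_def)

lemma zend_hom:
  assumes w: "fst b \<in> ord_maps n m"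
  shows "zend n b \<in> sset_hom (cplx ple (prism.blev n)) K"
proof -
  have "(\<lambda>j. restrict (zend n b j) (prism.bseqs n j)) \<in> sset_hom (cplx ple (prism.blev n)) K"
  proof (rule hom_restrictI[OF simplicial_set_cplx[OF prism.blev_closed]])
    fix j c assume c: "c \<in> prism.bseqs n j"
    then show "zend n b j c \<in> simplices K j"
      using act_closed[OF sK proj_ord[OF blev_lev[OF c]] phi_in[simplified, OF w]] by (simp add: zend_def)
  next
    fix i j \<theta> c assume \<theta>: "\<theta> \<in> ord_maps i j" and c: "c \<in> prism.bseqs n j"
    then show "zend n b i (act (cplx ple (prism.blev n)) i j \<theta> c) = act K i j \<theta> (zend n b j c)"
      using act_comp[OF sK \<theta> proj_ord[OF blev_lev[OF c]] phi_in[simplified, OF w]] cplx_act_closed[OF prism.blev_closed \<theta> c]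
      by (simp add: zend_def proj_compose[OF \<theta>])
  qed
  moreover have "(\<lambda>j. restrict (zend n b j) (prism.bseqs n j)) = zend n b"
    by (rule ext) (simp add: zend_def)
  ultimately show ?thesis by simp
qed

lemma proj_shift: "proj j (prism.shift \<alpha> j c) = compose {..j} \<alpha> (proj j c)"
  by (auto simp: proj_def prism.shift_def compose_def pmap_def)

text \<open>The homotopy extension property: every word receives a prism that starts at
  \<open>\<phi>\<close> and follows \<open>bdry\<close> where that is already defined. The ends at
  height 1 then give the values of the new straightening.\<close>

lemma strict_lift: "\<exists>P. \<forall>n. \<forall>b\<in>twords n. P n b \<in> sset_hom (cplx ple (prism.lev n)) K \<and>
    (\<forall>j. \<forall>c\<in>prism.bseqs n j. P n b j c = zend n b j c) \<and>
    (b \<in> twords n \<inter> bwords n \<longrightarrow> P n b = bdry n b) \<and>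
    (\<forall>k. \<forall>\<alpha>\<in>inj_maps k n. \<forall>j. \<forall>c\<in>prism.seqs k j.
      P k (wact k n \<alpha> b) j c = P n b j (prism.shift \<alpha> j c))"
proof (rule prism.lift)
  show tw: "wact k n \<alpha> b \<in> twords k" if \<alpha>: "\<alpha> \<in> inj_maps k n" and b: "b \<in> twords n" for k n \<alpha> b
  proof -
    obtain w t where wt: "b = (w, t)" by (cases b)
    have w: "w \<in> ord_maps n m" "t \<in> ord_maps n 1" "inj_on w {i. i \<le> n \<and> t i = 1}"
      using b by (auto simp: twords_def wt)
    have "inj_on (compose {..k} w \<alpha>) {i. i \<le> k \<and> compose {..k} t \<alpha> i = 1}"
    proof (rule inj_onI)
      fix i i' assume "i \<in> {i. i \<le> k \<and> compose {..k} t \<alpha> i = 1}" "i' \<in> {i. i \<le> k \<and> compose {..k} t \<alpha> i = 1}"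
        and e: "compose {..k} w \<alpha> i = compose {..k} w \<alpha> i'"
      then have i: "i \<le> k" "t (\<alpha> i) = 1" "i' \<le> k" "t (\<alpha> i') = 1" "w (\<alpha> i) = w (\<alpha> i')"
        by (auto simp: compose_def)
      then have "\<alpha> i = \<alpha> i'"
        using inj_onD[OF w(3), of "\<alpha> i" "\<alpha> i'"] ord_le[OF inj_maps_ord[OF \<alpha>]] by simp
      then show "i = i'" using i inj_maps_eq_iff[OF \<alpha>] by simp
    qed
    then show ?thesis
      using ord_maps_comp[OF inj_maps_ord[OF \<alpha>]] w(1,2) by (simp add: twords_def wact_def wt)
  qed
  show "wact j k \<beta> (wact k n \<alpha> b) = wact j n (compose {..j} \<alpha> \<beta>) b"
    if "\<beta> \<in> inj_maps j k" for j k n \<alpha> \<beta> b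
    by (simp add: wact_def compose_ord_assoc[OF inj_maps_ord[OF that]])
  show "wact n n (restrict id {..n}) b = b" if "b \<in> twords n" for n b
    using that by (cases b) (auto simp: twords_def wact_def intro!: compose_ord_id_right ord_maps_ext)
  show "twords n \<inter> bwords n \<subseteq> twords n" for n by simp
  show "wact k n \<alpha> b \<in> twords k \<inter> bwords k" if \<alpha>: "\<alpha> \<in> inj_maps k n" and b: "b \<in> twords n \<inter> bwords n" for k n \<alpha> b
  proof
    show "wact k n \<alpha> b \<in> bwords k"
      using b nonsurj_compose[OF _ _ inj_maps_ord[OF \<alpha>]] const_simplex_compose[OF inj_maps_ord[OF \<alpha>]]
        ord_maps_comp[OF inj_maps_ord[OF \<alpha>]]
      by (cases b) (auto simp: bwords_def boundary_words_def wact_def)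
  qed (use tw \<alpha> b in blast)
  show "zend n b \<in> sset_hom (cplx ple (prism.blev n)) K" if "b \<in> twords n" for n b
    using that by (intro zend_hom) (auto simp: twords_def)
  show "zend k (wact k n \<alpha> b) j c = zend n b j (prism.shift \<alpha> j c)"
    if \<alpha>: "\<alpha> \<in> inj_maps k n" and b: "b \<in> twords n" and c: "c \<in> prism.bseqs k j" for k n \<alpha> b j c
  proof -
    have w: "fst b \<in> ord_maps n m" using b by (auto simp: twords_def)
    show ?thesis
      using prism.shift_blev[OF c \<alpha>] c phi_nat[simplified, OF \<alpha> w]
        act_comp[OF sK proj_ord[OF blev_lev[OF c]] inj_maps_ord[OF \<alpha>] phi_in[simplified, OF w]]
      by (simp add: zend_def wact_def proj_shift)
  qed
  show "bdry n b \<in> sset_hom (cplx ple (prism.lev n)) K" if "b \<in> twords n \<inter> bwords n" for n b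
    using that bdry_hom by (cases b) auto
  show "bdry k (wact k n \<alpha> b) j c = bdry n b j (prism.shift \<alpha> j c)"
    if "\<alpha> \<in> inj_maps k n" "b \<in> twords n \<inter> bwords n" "c \<in> prism.seqs k j" for k n \<alpha> b j c
    using that bdry_nat[of \<alpha> k n "fst b" "snd b" c j] by (simp add: wact_def)
  show "bdry n b j c = zend n b j c"
    if "b \<in> twords n \<inter> bwords n" "c \<in> prism.bseqs n j" for n b j c
    using bdry_zero[OF blev_lev[OF that(2)], of "snd b" "fst b"] that(2) blev_snd[OF that(2)]
    by (simp add: zend_def side_def)
  show "\<exists>g\<in>sset_hom (cplx ple (prism.lev n)) K. \<forall>j. \<forall>c\<in>prism.lseqs n j. g j c = f j c"
    if "f \<in> sset_hom (cplx ple (prism.low n)) K" for n f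
    using prism_fill[OF K that] .
qed

text \<open>The quotient \<open>\<sigma>\<close> merges precisely equal letters of type 1, and
  \<open>s\<close> is a section of it. As \<open>\<sigma>\<close> is injective on letters of type 0,
  every straightening has to be compatible with it and is therefore determined by its values on
  \<open>twords\<close>.\<close>

definition collapses :: "nat \<Rightarrow> (nat \<Rightarrow> nat) \<Rightarrow> (nat \<Rightarrow> nat) \<Rightarrow> nat \<times> (nat \<Rightarrow> nat) \<times> (nat \<Rightarrow> nat) \<Rightarrow> bool" where
  "collapses n w t = (\<lambda>(k, \<sigma>, s). \<sigma> \<in> ord_maps n k \<and> s \<in> inj_maps k n \<and> (\<forall>p\<le>k. \<sigma> (s p) = p) \<and>
    (\<forall>i\<le>n. \<forall>j\<le>n. \<sigma> i = \<sigma> j \<longleftrightarrow> i = j \<or> t i = 1 \<and> t j = 1 \<and> w i = w j))"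

lemma collapses_ex:
  assumes w: "w \<in> ord_maps n m" and t: "t \<in> ord_maps n 1"
  shows "\<exists>z. collapses n w t z"
proof -
  \<comment> \<open>Letters of type 0 keep their own position as key and stay apart. The offset
    \<open>Suc n\<close> puts the keys of type 1 above all positions, so the two kinds never meet
    and monotonicity is preserved.\<close>
  define \<kappa> where "\<kappa> i = (if t i = 0 then i else Suc n + w i)" for i
  have mono: "\<kappa> i \<le> \<kappa> j" if "i \<le> j" "j \<le> n" for i j
    using ord_mono[OF w that] ord_mono[OF t that] that by (auto simp: \<kappa>_def)
  obtain k \<sigma> s where *: "\<sigma> \<in> ord_maps n k" "s \<in> inj_maps k n" "\<forall>p\<le>k. \<sigma> (s p) = p"
    and ker: "\<forall>i\<le>n. \<forall>j\<le>n. \<sigma> i = \<sigma> j \<longleftrightarrow> \<kappa> i = \<kappa> j"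
    using key_factor[of n \<kappa>, OF mono] by blast
  have "\<kappa> i = \<kappa> j \<longleftrightarrow> i = j \<or> t i = 1 \<and> t j = 1 \<and> w i = w j" if "i \<le> n" "j \<le> n" for i j
    using that ord_le[OF t that(1)] ord_le[OF t that(2)] by (auto simp: \<kappa>_def)
  then have "collapses n w t (k, \<sigma>, s)" using * ker by (simp add: collapses_def)
  then show ?thesis ..
qed

text \<open>Merged positions carry the same letter and the same type, so the word can be recovered;
  among the chosen representatives nothing of type 1 is left to merge.\<close>

lemma collapses_word:
  assumes w: "w \<in> ord_maps n m" and t: "t \<in> ord_maps n 1" and z: "collapses n w t (k, \<sigma>, s)"
  shows "(compose {..k} w s, compose {..k} t s) \<in> twords k"
    "compose {..n} (compose {..k} w s) \<sigma> = w" "compose {..n} (compose {..k} t s) \<sigma> = t"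
proof -
  have *: "\<sigma> \<in> ord_maps n k" "s \<in> inj_maps k n" "\<And>p. p \<le> k \<Longrightarrow> \<sigma> (s p) = p"
    and ker: "\<And>i j. i \<le> n \<Longrightarrow> j \<le> n \<Longrightarrow> \<sigma> i = \<sigma> j \<longleftrightarrow> i = j \<or> t i = 1 \<and> t j = 1 \<and> w i = w j"
    using z by (auto simp: collapses_def)
  have sn: "s p \<le> n" if "p \<le> k" for p using ord_le[OF inj_maps_ord[OF *(2)] that] .
  have "inj_on (compose {..k} w s) {i. i \<le> k \<and> compose {..k} t s i = 1}"
  proof (rule inj_onI)
    fix p q assume "p \<in> {i. i \<le> k \<and> compose {..k} t s i = 1}" "q \<in> {i. i \<le> k \<and> compose {..k} t s i = 1}"
      and "compose {..k} w s p = compose {..k} w s q"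
    then have p: "p \<le> k" "t (s p) = 1" "q \<le> k" "t (s q) = 1" "w (s p) = w (s q)" by (auto simp: compose_def)
    then have "\<sigma> (s p) = \<sigma> (s q)" using ker[OF sn sn] by blast
    then show "p = q" using *(3) p by simp
  qed
  then show "(compose {..k} w s, compose {..k} t s) \<in> twords k"
    using ord_maps_comp[OF inj_maps_ord[OF *(2)]] w t by (simp add: twords_def)
  have eq: "w (s (\<sigma> i)) = w i \<and> t (s (\<sigma> i)) = t i" if "i \<le> n" for i
  proof -
    have \<sigma>i: "\<sigma> i \<le> k" using ord_le[OF *(1) that] .
    have "\<sigma> (s (\<sigma> i)) = \<sigma> i" using *(3)[OF \<sigma>i] .
    then have "s (\<sigma> i) = i \<or> t (s (\<sigma> i)) = 1 \<and> t i = 1 \<and> w (s (\<sigma> i)) = w i"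
      using ker[OF sn[OF \<sigma>i] that] by simp
    then show ?thesis by auto
  qed
  show "compose {..n} (compose {..k} w s) \<sigma> = w"
    using eq ord_le[OF *(1)] by (intro ord_maps_eqI[of _ n]) (auto simp: compose_def ord_maps_ext[OF w])
  show "compose {..n} (compose {..k} t s) \<sigma> = t"
    using eq ord_le[OF *(1)] by (intro ord_maps_eqI[of _ n]) (auto simp: compose_def ord_maps_ext[OF t])
qed

text \<open>The ends of the lifted homotopies give \<open>G\<close> on words without repeated
  letters of type 1, and degenerating along collapses continues it to all words. Naturality for
  admissible operators then reduces to naturality of \<open>G\<close> for injections between
  collapsed words.\<close>

theorem cell_fill:
  "\<exists>\<epsilon>. (\<forall>n. \<forall>w\<in>ord_maps n m. \<forall>t\<in>ord_maps n 1. \<epsilon> n w t \<in> simplices K n \<and>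
      (w ` {..n} \<noteq> {..m} \<longrightarrow> \<epsilon> n w t = \<epsilon>0 n w t)) \<and>
    (\<forall>n. \<forall>w\<in>ord_maps n m. \<epsilon> n w (const_simplex n 0) = \<phi> n w) \<and>
    (\<forall>k n. \<forall>\<sigma>\<in>ord_maps k n. \<forall>w\<in>ord_maps n m. \<forall>t\<in>ord_maps n 1. inj_on \<sigma> {i. i \<le> k \<and> t (\<sigma> i) = 0} \<longrightarrow>
      \<epsilon> k (compose {..k} w \<sigma>) (compose {..k} t \<sigma>) = act K k n \<sigma> (\<epsilon> n w t))"
proof -
  obtain P where P: "\<And>n b. b \<in> twords n \<Longrightarrow> P n b \<in> sset_hom (cplx ple (prism.lev n)) K"
    "\<And>n b. b \<in> twords n \<Longrightarrow> b \<in> bwords n \<Longrightarrow> P n b = bdry n b"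
    "\<And>k n \<alpha> b j c. b \<in> twords n \<Longrightarrow> \<alpha> \<in> inj_maps k n \<Longrightarrow> c \<in> prism.seqs k j \<Longrightarrow>
      P k (wact k n \<alpha> b) j c = P n b j (prism.shift \<alpha> j c)"
    using strict_lift by (metis Int_iff)
  define G where "G n w t = P n (w, t) n (topseq n)" for n w t
  have G_in: "G n w t \<in> simplices K n" if "(w, t) \<in> twords n" for n w t
    unfolding G_def by (rule hom_in[OF P(1)[OF that] topseq_in])
  have G_nat: "G k (compose {..k} w \<alpha>) (compose {..k} t \<alpha>) = act K k n \<alpha> (G n w t)"
    if "(w, t) \<in> twords n" "\<alpha> \<in> inj_maps k n" for k n w t \<alpha>
  proof -
    have "prism.shift \<alpha> k (topseq k) = compose {..k} (topseq n) \<alpha>"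
      using ord_le[OF inj_maps_ord[OF that(2)]] by (auto simp: prism.shift_def topseq_def compose_def pmap_def)
    then show ?thesis
      using P(3)[OF that topseq_in] hom_act[OF P(1)[OF that(1)] inj_maps_ord[OF that(2)] topseq_in]
      by (simp add: G_def wact_def)
  qed
  have G_zero: "G n w (const_simplex n 0) = \<phi> n w" if "w \<in> ord_maps n m" for n w
  proof -
    have "(w, const_simplex n 0) \<in> twords n" "(w, const_simplex n 0) \<in> bwords n"
      using that const_simplex_ord by (auto simp: twords_def bwords_def) (auto simp: inj_on_def const_simplex_def)
    then show ?thesis using P(2) bdry_top_zero[simplified, OF that] by (simp add: G_def)
  qed
  have G_bdry: "G n w t = \<epsilon>0 n w t" if "(w, t) \<in> twords n" "w ` {..n} \<noteq> {..m}" for n w t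
  proof -
    have "w \<in> ord_maps n m" "t \<in> ord_maps n 1" using that by (auto simp: twords_def)
    then show ?thesis using P(2)[OF that(1)] bdry_top[of w n t] that(2) by (simp add: G_def bwords_def boundary_words_def)
  qed
  define pick where "pick n w t = (SOME z. collapses n w t z)" for n w t
  have pick: "collapses n w t (pick n w t)" if "w \<in> ord_maps n m" "t \<in> ord_maps n 1" for n w t
    unfolding pick_def using collapses_ex[OF that] by (rule someI_ex)
  define \<epsilon> where "\<epsilon> n w t = (case pick n w t of (k, \<sigma>, s) \<Rightarrow>
    act K n k \<sigma> (G k (compose {..k} w s) (compose {..k} t s)))" for n w t
  have \<epsilon>: "\<exists>k \<sigma> s. collapses n w t (k, \<sigma>, s) \<and> \<epsilon> n w t = act K n k \<sigma> (G k (compose {..k} w s) (compose {..k} t s))"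
    if "w \<in> ord_maps n m" "t \<in> ord_maps n 1" for n w t
    using pick[OF that] by (cases "pick n w t") (auto simp: \<epsilon>_def)
  have "\<epsilon> n w t \<in> simplices K n" if w: "w \<in> ord_maps n m" "t \<in> ord_maps n 1" for n w t
  proof -
    obtain k \<sigma> s where z: "collapses n w t (k, \<sigma>, s)" and e: "\<epsilon> n w t = act K n k \<sigma> (G k (compose {..k} w s) (compose {..k} t s))"
      using \<epsilon>[OF w] by blast
    have "\<sigma> \<in> ord_maps n k" using z by (simp add: collapses_def)
    then show ?thesis using act_closed[OF sK _ G_in[OF collapses_word(1)[OF w z]]] e by simp
  qed
  moreover have "\<epsilon> n w t = \<epsilon>0 n w t" if w: "w \<in> ord_maps n m" "t \<in> ord_maps n 1" and ns: "w ` {..n} \<noteq> {..m}" for n w t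
  proof -
    obtain k \<sigma> s where z: "collapses n w t (k, \<sigma>, s)" and e: "\<epsilon> n w t = act K n k \<sigma> (G k (compose {..k} w s) (compose {..k} t s))"
      using \<epsilon>[OF w] by blast
    have \<sigma>: "\<sigma> \<in> ord_maps n k" and s: "s \<in> ord_maps k n" using z by (auto simp: collapses_def inj_maps_def)
    note cw = collapses_word[OF w z]
    have ns': "compose {..k} w s ` {..k} \<noteq> {..m}" by (rule nonsurj_compose[OF w(1) ns s])
    have ker: "\<sigma> i = \<sigma> j \<longleftrightarrow> i = j \<or> t i = 1 \<and> t j = 1 \<and> w i = w j" if "i \<le> n" "j \<le> n" for i j
      using z that by (simp add: collapses_def)
    have ts: "compose {..k} t s (\<sigma> i) = t i" if "i \<le> n" for i
      using fun_cong[OF cw(3), of i] that by (simp add: compose_def[of "{..n}"])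
    \<comment> \<open>A collapse merges only letters of type 1, so it is among the operators that
      \<open>\<epsilon>0\<close> respects.\<close>
    have "inj_on \<sigma> {i. i \<le> n \<and> compose {..k} t s (\<sigma> i) = 0}"
      by (rule inj_onI) (use ker ts in fastforce)
    then have "\<epsilon>0 n w t = act K n k \<sigma> (\<epsilon>0 k (compose {..k} w s) (compose {..k} t s))"
      using straightens_act[OF eps \<sigma> _ ord_maps_comp[OF s w(2)], of "compose {..k} w s"]
        ord_maps_comp[OF s w(1)] ns' cw(2,3) by (simp add: boundary_words_def)
    then show ?thesis using G_bdry[OF cw(1) ns'] e by simp
  qed
  moreover have "\<epsilon> n w (const_simplex n 0) = \<phi> n w" if w: "w \<in> ord_maps n m" for n w
  proof -
    have t: "const_simplex n 0 \<in> ord_maps n 1" by (rule const_simplex_ord) simp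
    obtain k \<sigma> s where z: "collapses n w (const_simplex n 0) (k, \<sigma>, s)"
      and e: "\<epsilon> n w (const_simplex n 0) = act K n k \<sigma> (G k (compose {..k} w s) (compose {..k} (const_simplex n 0) s))"
      using \<epsilon>[OF w t] by blast
    have s: "s \<in> ord_maps k n" using z by (auto simp: collapses_def inj_maps_def)
    \<comment> \<open>At type 0 nothing is merged, so the collapse is injective and naturality of
      \<open>\<phi>\<close> applies to it.\<close>
    have \<sigma>: "\<sigma> \<in> inj_maps n k"
      using z by (auto simp: collapses_def inj_maps_def inj_on_def const_simplex_def)
    have "G k (compose {..k} w s) (compose {..k} (const_simplex n 0) s) = \<phi> k (compose {..k} w s)"
      using G_zero[OF ord_maps_comp[OF s w]] const_simplex_compose[OF s] by simp
    then show ?thesis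
      using phi_nat[simplified, OF \<sigma> ord_maps_comp[OF s w]] collapses_word(2)[OF w t z] e by simp
  qed
  moreover have "\<epsilon> k (compose {..k} w \<tau>) (compose {..k} t \<tau>) = act K k n \<tau> (\<epsilon> n w t)"
    if \<tau>: "\<tau> \<in> ord_maps k n" and w: "w \<in> ord_maps n m" "t \<in> ord_maps n 1"
      and adm: "inj_on \<tau> {i. i \<le> k \<and> t (\<tau> i) = 0}" for k n \<tau> w t
  proof -
    let ?w = "compose {..k} w \<tau>" and ?t = "compose {..k} t \<tau>"
    have w': "?w \<in> ord_maps k m" "?t \<in> ord_maps k 1" using ord_maps_comp[OF \<tau>] w by auto
    obtain k1 \<sigma> s where z: "collapses n w t (k1, \<sigma>, s)"
      and e: "\<epsilon> n w t = act K n k1 \<sigma> (G k1 (compose {..k1} w s) (compose {..k1} t s))"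
      using \<epsilon>[OF w] by blast
    obtain k2 \<sigma>' s' where z': "collapses k ?w ?t (k2, \<sigma>', s')"
      and e': "\<epsilon> k ?w ?t = act K k k2 \<sigma>' (G k2 (compose {..k2} ?w s') (compose {..k2} ?t s'))"
      using \<epsilon>[OF w'] by blast
    have \<sigma>: "\<sigma> \<in> ord_maps n k1" and s: "s \<in> ord_maps k1 n" and s'i: "s' \<in> inj_maps k2 k" and \<sigma>': "\<sigma>' \<in> ord_maps k k2"
      using z z' by (auto simp: collapses_def inj_maps_def)
    note s' = inj_maps_ord[OF s'i]
    have ker: "\<sigma> i = \<sigma> j \<longleftrightarrow> i = j \<or> t i = 1 \<and> t j = 1 \<and> w i = w j" if "i \<le> n" "j \<le> n" for i j
      using z that by (simp add: collapses_def)
    have ker': "\<sigma>' i = \<sigma>' j \<longleftrightarrow> i = j \<or> t (\<tau> i) = 1 \<and> t (\<tau> j) = 1 \<and> w (\<tau> i) = w (\<tau> j)" if "i \<le> k" "j \<le> k" for i j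
      using z' that by (simp add: collapses_def compose_def)
    have sec': "\<sigma>' (s' p) = p" if "p \<le> k2" for p using z' that by (simp add: collapses_def)
    \<comment> \<open>The map induced by \<open>\<tau>\<close> between the collapsed words. It is
      injective: admissibility keeps letters of type 0 apart, and equal letters of type 1 have
      already been merged in the source.\<close>
    define \<mu> where "\<mu> = compose {..k2} \<sigma> (compose {..k2} \<tau> s')"
    have \<tau>s': "compose {..k2} \<tau> s' \<in> ord_maps k2 n" by (rule ord_maps_comp[OF s' \<tau>])
    have \<mu>o: "\<mu> \<in> ord_maps k2 k1" unfolding \<mu>_def by (rule ord_maps_comp[OF \<tau>s' \<sigma>])
    have \<mu>: "\<mu> \<in> inj_maps k2 k1"
    proof -
      have "inj_on \<mu> {..k2}"
      proof (rule inj_onI)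
        fix p q assume pq: "p \<in> {..k2}" "q \<in> {..k2}" "\<mu> p = \<mu> q"
        then have sp: "s' p \<le> k" "s' q \<le> k" using ord_le[OF s'] by auto
        have \<tau>p: "\<tau> (s' p) \<le> n" "\<tau> (s' q) \<le> n" using sp ord_le[OF \<tau>] by auto
        have "\<sigma> (\<tau> (s' p)) = \<sigma> (\<tau> (s' q))" using pq by (simp add: \<mu>_def compose_def)
        then have c: "\<tau> (s' p) = \<tau> (s' q) \<or> t (\<tau> (s' p)) = 1 \<and> t (\<tau> (s' q)) = 1 \<and> w (\<tau> (s' p)) = w (\<tau> (s' q))"
          using ker[OF \<tau>p] by simp
        have "t (\<tau> (s' p)) = 0 \<or> t (\<tau> (s' p)) = 1" using ord_le[OF w(2) \<tau>p(1)] by auto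
        then have "s' p = s' q \<or> t (\<tau> (s' p)) = 1 \<and> t (\<tau> (s' q)) = 1 \<and> w (\<tau> (s' p)) = w (\<tau> (s' q))"
          using c inj_onD[OF adm, of "s' p" "s' q"] sp by auto
        then have "\<sigma>' (s' p) = \<sigma>' (s' q)" using ker'[OF sp] by simp
        then show "p = q" using sec' pq by simp
      qed
      then show ?thesis using \<mu>o by (simp add: inj_maps_def)
    qed
    have st: "compose {..k} \<sigma> \<tau> = compose {..k} \<mu> \<sigma>'"
    proof (rule ord_maps_eqI[of _ k])
      fix i assume i: "i \<le> k"
      then have \<sigma>i: "\<sigma>' i \<le> k2" "s' (\<sigma>' i) \<le> k" using ord_le[OF \<sigma>'] ord_le[OF s'] by auto
      have "\<sigma>' (s' (\<sigma>' i)) = \<sigma>' i" using sec' \<sigma>i by simp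
      then have "s' (\<sigma>' i) = i \<or> t (\<tau> (s' (\<sigma>' i))) = 1 \<and> t (\<tau> i) = 1 \<and> w (\<tau> (s' (\<sigma>' i))) = w (\<tau> i)"
        using ker'[OF \<sigma>i(2) i] by simp
      then have "\<sigma> (\<tau> (s' (\<sigma>' i))) = \<sigma> (\<tau> i)"
        using ker[OF ord_le[OF \<tau> \<sigma>i(2)] ord_le[OF \<tau> i]] by auto
      then show "compose {..k} \<sigma> \<tau> i = compose {..k} \<mu> \<sigma>' i" using i \<sigma>i by (simp add: \<mu>_def compose_def)
    qed (simp_all add: compose_def)
    note cw = collapses_word[OF w z]
    have red: "compose {..k2} (compose {..k1} v s) \<mu> = compose {..k2} (compose {..k} v \<tau>) s'"
      if "compose {..n} (compose {..k1} v s) \<sigma> = v" for v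
    proof -
      have "compose {..k2} (compose {..k1} v s) \<mu> = compose {..k2} (compose {..n} (compose {..k1} v s) \<sigma>) (compose {..k2} \<tau> s')"
        unfolding \<mu>_def by (simp add: compose_ord_assoc[OF \<tau>s'])
      also have "\<dots> = compose {..k2} (compose {..k} v \<tau>) s'"
        unfolding that by (simp add: compose_ord_assoc[OF s'])
      finally show ?thesis .
    qed
    have Gin: "G k1 (compose {..k1} w s) (compose {..k1} t s) \<in> simplices K k1" by (rule G_in[OF cw(1)])
    have "act K k n \<tau> (\<epsilon> n w t) = act K k k1 (compose {..k} \<mu> \<sigma>') (G k1 (compose {..k1} w s) (compose {..k1} t s))"
      unfolding e st[symmetric] by (rule act_comp[OF sK \<tau> \<sigma> Gin])
    also have "\<dots> = act K k k2 \<sigma>' (act K k2 k1 \<mu> (G k1 (compose {..k1} w s) (compose {..k1} t s)))"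
      by (rule act_comp[OF sK \<sigma>' \<mu>o Gin, symmetric])
    also have "act K k2 k1 \<mu> (G k1 (compose {..k1} w s) (compose {..k1} t s)) = G k2 (compose {..k2} ?w s') (compose {..k2} ?t s')"
      using G_nat[OF cw(1) \<mu>] red[OF cw(2)] red[OF cw(3)] by simp
    finally show ?thesis using e' by simp
  qed
  ultimately show ?thesis by blast
qed

end

section \<open>Induction over the skeleta\<close>

text \<open>The union of \<open>S\<close> with the skeleton of dimension \<open>p - 1\<close>. The
  shift makes the induction start at \<open>S\<close> itself for \<open>p = 0\<close>.\<close>

definition skel :: "'a sset \<Rightarrow> (nat \<Rightarrow> 'a set) \<Rightarrow> nat \<Rightarrow> nat \<Rightarrow> 'a set" where
  "skel X S p k = {y \<in> simplices X k. y \<in> S k \<or> (\<exists>j<p. \<exists>z\<in>simplices X j. \<exists>\<theta>\<in>ord_maps k j. y = act X k j \<theta> z)}"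

lemma skel_act:
  assumes X: "simplicial_set X" and S: "subcomplex X S" and \<sigma>: "\<sigma> \<in> ord_maps k n" and y: "y \<in> skel X S p n"
  shows "act X k n \<sigma> y \<in> skel X S p k"
proof -
  have "act X k n \<sigma> y \<in> simplices X k" using y act_closed[OF X \<sigma>] by (simp add: skel_def)
  moreover have "act X k n \<sigma> y \<in> S k" if "y \<in> S n" using S \<sigma> that unfolding subcomplex_def by blast
  moreover have "\<exists>j<p. \<exists>z\<in>simplices X j. \<exists>\<theta>\<in>ord_maps k j. act X k n \<sigma> y = act X k j \<theta> z"
    if "j < p" "z \<in> simplices X j" "\<theta> \<in> ord_maps n j" "y = act X n j \<theta> z" for j z \<theta>
    using act_comp[OF X \<sigma> that(3,2)] ord_maps_comp[OF \<sigma> that(3)] that by blast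
  ultimately show ?thesis using y unfolding skel_def by blast
qed

lemma skel_mono: "p \<le> q \<Longrightarrow> skel X S p k \<subseteq> skel X S q k"
  unfolding skel_def using order_less_le_trans by blast

lemma skel_all: "simplicial_set X \<Longrightarrow> x \<in> simplices X k \<Longrightarrow> k < p \<Longrightarrow> x \<in> skel X S p k"
  unfolding skel_def using act_id[of X x k] ord_maps_id[of k] by (metis (mono_tags, lifting) mem_Collect_eq)

lemma nonsurj_skel:
  assumes X: "simplicial_set X" and \<theta>: "\<theta> \<in> ord_maps k p" "\<theta> ` {..k} \<noteq> {..p}" and z: "z \<in> simplices X p"
  shows "act X k p \<theta> z \<in> skel X S p k"
proof -
  obtain m i \<theta>' where *: "p = Suc m" "\<theta>' \<in> ord_maps k m" "\<theta> = compose {..k} (coface m i) \<theta>'"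
    using nonsurj_factor[OF \<theta>] by metis
  have cf: "coface m i \<in> ord_maps m p" using inj_maps_ord[OF coface_inj] *(1) by simp
  have "act X k p \<theta> z = act X k m \<theta>' (act X m p (coface m i) z)"
    unfolding *(3) by (rule act_comp[OF X *(2) cf z, symmetric])
  moreover have "act X m p (coface m i) z \<in> simplices X m" by (rule act_closed[OF X cf z])
  moreover have "act X k p \<theta> z \<in> simplices X k" by (rule act_closed[OF X \<theta>(1) z])
  ultimately show ?thesis using *(1,2) unfolding skel_def by blast
qed

text \<open>The Eilenberg-Zilber argument. Applying a section \<open>s\<close> of
  \<open>\<theta>\<close> expresses \<open>z\<close> through \<open>z'\<close> by an endomap of
  \<open>[p]\<close>; as \<open>z\<close> is new, this endomap is surjective and hence the identity.
  So \<open>z = z'\<close>, every section of \<open>\<theta>\<close> is one of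
  \<open>\<theta>'\<close>, and sections through each point give
  \<open>\<theta> = \<theta>'\<close>.\<close>

lemma skel_unique:
  assumes X: "simplicial_set X" and S: "subcomplex X S"
    and z: "z \<in> simplices X p" "z \<notin> skel X S p p" "z' \<in> simplices X p" "z' \<notin> skel X S p p"
    and \<theta>: "\<theta> \<in> ord_maps k p" "\<theta>' \<in> ord_maps k p" and eq: "act X k p \<theta> z = act X k p \<theta>' z'"
    and y: "act X k p \<theta> z \<notin> skel X S p k"
  shows "z = z' \<and> \<theta> = \<theta>'"
proof -
  have surj: "\<theta> ` {..k} = {..p}" using nonsurj_skel[OF X \<theta>(1) _ z(1)] y by blast
  have *: "compose {..p} \<theta>' s = restrict id {..p} \<and> z = z'"
    if s: "s \<in> inj_maps p k" "compose {..p} \<theta> s = restrict id {..p}" for s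
  proof -
    note so = inj_maps_ord[OF s(1)]
    have "z = act X p k s (act X k p \<theta> z)" using act_comp[OF X so \<theta>(1) z(1)] s(2) act_id[OF X z(1)] by simp
    also have "\<dots> = act X p p (compose {..p} \<theta>' s) z'" using act_comp[OF X so \<theta>(2) z(3)] eq by simp
    finally have zz: "z = act X p p (compose {..p} \<theta>' s) z'" .
    have o: "compose {..p} \<theta>' s \<in> ord_maps p p" by (rule ord_maps_comp[OF so \<theta>(2)])
    have "compose {..p} \<theta>' s ` {..p} = {..p}" using nonsurj_skel[OF X o _ z(3)] zz z(2) by metis
    then have "compose {..p} \<theta>' s = restrict id {..p}" by (rule surj_self_id[OF o])
    then show ?thesis using zz act_id[OF X z(3)] by simp
  qed
  have "\<theta> = \<theta>'"
  proof (rule ord_maps_eqI[of _ k])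
    fix i assume i: "i \<le> k"
    obtain s where s: "s \<in> inj_maps p k" "compose {..p} \<theta> s = restrict id {..p}" "s (\<theta> i) = i"
      using surj_section[OF \<theta>(1) surj i] .
    have "\<theta> i \<le> p" using ord_le[OF \<theta>(1) i] .
    moreover have "compose {..p} \<theta>' s (\<theta> i) = restrict id {..p} (\<theta> i)" using *[OF s(1,2)] by simp
    ultimately show "\<theta> i = \<theta>' i" using s(3) by (simp add: compose_def)
  qed (use \<theta> ord_maps_ext in auto)
  moreover obtain s where "s \<in> inj_maps p k" "compose {..p} \<theta> s = restrict id {..p}"
    using surj_section[OF \<theta>(1) surj le0] by metis
  ultimately show ?thesis using * by blast
qed

text \<open>Each new simplex \<open>z\<close> of dimension \<open>p\<close> is treated as a cell: a
  word in \<open>[p]\<close> stands for the simplex of \<open>X\<close> it induces from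
  \<open>z\<close>. Words that are not surjective induce simplices of the smaller skeleton, where
  \<open>h\<close> is given.\<close>

lemma straighten_step:
  fixes X :: "'a sset" and K :: "'k sset"
  assumes X: "simplicial_set X" and K: "kan_complex K" and S: "subcomplex X S"
    and \<phi>: "semisimplicial X K \<phi>" and h: "straightens X K (skel X S p) \<phi> h"
  shows "\<exists>h'. straightens X K (skel X S (Suc p)) \<phi> h' \<and>
    (\<forall>k. \<forall>y\<in>skel X S p k. \<forall>t\<in>ord_maps k 1. h' k y t = h k y t)"
proof -
  let ?new = "simplices X p - skel X S p p"
  have "\<exists>\<epsilon>. (\<forall>n. \<forall>w\<in>ord_maps n p. \<forall>t\<in>ord_maps n 1. \<epsilon> n w t \<in> simplices K n \<and>
      (w ` {..n} \<noteq> {..p} \<longrightarrow> \<epsilon> n w t = h n (act X n p w z) t)) \<and>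
    (\<forall>n. \<forall>w\<in>ord_maps n p. \<epsilon> n w (const_simplex n 0) = \<phi> n (act X n p w z)) \<and>
    (\<forall>k n. \<forall>\<sigma>\<in>ord_maps k n. \<forall>w\<in>ord_maps n p. \<forall>t\<in>ord_maps n 1. inj_on \<sigma> {i. i \<le> k \<and> t (\<sigma> i) = 0} \<longrightarrow>
      \<epsilon> k (compose {..k} w \<sigma>) (compose {..k} t \<sigma>) = act K k n \<sigma> (\<epsilon> n w t))" if "z \<in> ?new" for z
  proof (rule cell_data.cell_fill)
    have z: "z \<in> simplices X p" using that by simp
    note nss = nonsurj_skel[OF X _ _ z]
    show "cell_data K p (\<lambda>n w. \<phi> n (act X n p w z)) (\<lambda>n w t. h n (act X n p w z) t)"
    proof
      show "semisimplicial (std_simplex p) K (\<lambda>n w. \<phi> n (act X n p w z))"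
        unfolding semisimplicial_def
      proof (intro conjI allI ballI)
        show "\<phi> n (act X n p w z) \<in> simplices K n" if "w \<in> simplices (std_simplex p) n" for n w
          using \<phi> act_closed[OF X _ z, of w n] that by (simp add: semisimplicial_def)
        show "\<phi> k (act X k p (act (std_simplex p) k n \<alpha> w) z) = act K k n \<alpha> (\<phi> n (act X n p w z))"
          if "\<alpha> \<in> inj_maps k n" "w \<in> simplices (std_simplex p) n" for k n \<alpha> w
        proof -
          have w: "w \<in> ord_maps n p" using that(2) by simp
          have "\<phi> k (act X k n \<alpha> (act X n p w z)) = act K k n \<alpha> (\<phi> n (act X n p w z))"
            using \<phi> that(1) act_closed[OF X w z] by (simp add: semisimplicial_def)
          then show ?thesis using act_comp[OF X inj_maps_ord[OF that(1)] w z] by simp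
        qed
      qed
      show "straightens (std_simplex p) K (boundary_words p) (\<lambda>n w. \<phi> n (act X n p w z)) (\<lambda>n w. h n (act X n p w z))"
      proof (rule straightensI)
        fix n w assume "w \<in> boundary_words p n"
        then have w: "w \<in> ord_maps n p" "w ` {..n} \<noteq> {..p}" by (auto simp: boundary_words_def)
        show "h n (act X n p w z) t \<in> simplices K n" if "t \<in> ord_maps n 1" for t
          using straightens_in[OF h nss[OF w] that] .
        show "h n (act X n p w z) (const_simplex n 0) = \<phi> n (act X n p w z)"
          using straightens_zero[OF h nss[OF w]] .
        show "h k (act X k p (act (std_simplex p) k n \<sigma> w) z) (compose {..k} t \<sigma>) = act K k n \<sigma> (h n (act X n p w z) t)"
          if "\<sigma> \<in> ord_maps k n" "t \<in> ord_maps n 1" "inj_on \<sigma> {i. i \<le> k \<and> t (\<sigma> i) = 0}" for k \<sigma> t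
          using straightens_act[OF h that(1) nss[OF w] that(2,3)] act_comp[OF X that(1) w(1) z] by simp
      qed
    qed (rule K)
  qed
  then have "\<exists>E. \<forall>z\<in>?new. (\<forall>n. \<forall>w\<in>ord_maps n p. \<forall>t\<in>ord_maps n 1. E z n w t \<in> simplices K n \<and>
      (w ` {..n} \<noteq> {..p} \<longrightarrow> E z n w t = h n (act X n p w z) t)) \<and>
    (\<forall>n. \<forall>w\<in>ord_maps n p. E z n w (const_simplex n 0) = \<phi> n (act X n p w z)) \<and>
    (\<forall>k n. \<forall>\<sigma>\<in>ord_maps k n. \<forall>w\<in>ord_maps n p. \<forall>t\<in>ord_maps n 1. inj_on \<sigma> {i. i \<le> k \<and> t (\<sigma> i) = 0} \<longrightarrow>
      E z k (compose {..k} w \<sigma>) (compose {..k} t \<sigma>) = act K k n \<sigma> (E z n w t))"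
    by (intro bchoice ballI)
  then obtain E where E: "\<forall>z\<in>?new. (\<forall>n. \<forall>w\<in>ord_maps n p. \<forall>t\<in>ord_maps n 1. E z n w t \<in> simplices K n \<and>
      (w ` {..n} \<noteq> {..p} \<longrightarrow> E z n w t = h n (act X n p w z) t)) \<and>
    (\<forall>n. \<forall>w\<in>ord_maps n p. E z n w (const_simplex n 0) = \<phi> n (act X n p w z)) \<and>
    (\<forall>k n. \<forall>\<sigma>\<in>ord_maps k n. \<forall>w\<in>ord_maps n p. \<forall>t\<in>ord_maps n 1. inj_on \<sigma> {i. i \<le> k \<and> t (\<sigma> i) = 0} \<longrightarrow>
      E z k (compose {..k} w \<sigma>) (compose {..k} t \<sigma>) = act K k n \<sigma> (E z n w t))" ..
  have E_in: "E z n w t \<in> simplices K n"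
    if "z \<in> ?new" "w \<in> ord_maps n p" "t \<in> ord_maps n 1" for z n w t
    using bspec[OF E that(1)] that(2,3) by simp
  have E_bd: "E z n w t = h n (act X n p w z) t"
    if "z \<in> ?new" "w \<in> ord_maps n p" "t \<in> ord_maps n 1" "w ` {..n} \<noteq> {..p}" for z n w t
    using bspec[OF E that(1)] that(2-4) by simp
  have E_zero: "E z n w (const_simplex n 0) = \<phi> n (act X n p w z)"
    if "z \<in> ?new" "w \<in> ord_maps n p" for z n w
    using bspec[OF E that(1)] that(2) by simp
  have E_nat: "E z k (compose {..k} w \<sigma>) (compose {..k} t \<sigma>) = act K k n \<sigma> (E z n w t)"
    if "z \<in> ?new" "\<sigma> \<in> ord_maps k n" "w \<in> ord_maps n p" "t \<in> ord_maps n 1"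
      "inj_on \<sigma> {i. i \<le> k \<and> t (\<sigma> i) = 0}" for z k n \<sigma> w t
  proof -
    have "\<forall>k n. \<forall>\<sigma>\<in>ord_maps k n. \<forall>w\<in>ord_maps n p. \<forall>t\<in>ord_maps n 1. inj_on \<sigma> {i. i \<le> k \<and> t (\<sigma> i) = 0} \<longrightarrow>
      E z k (compose {..k} w \<sigma>) (compose {..k} t \<sigma>) = act K k n \<sigma> (E z n w t)"
      using bspec[OF E that(1)] by (elim conjE)
    then show ?thesis using that(2-5) by simp
  qed
  \<comment> \<open>An arbitrary presentation is chosen; by \<open>skel_unique\<close> a simplex
    outside the smaller skeleton has only one.\<close>
  define rep where "rep k y = (SOME (z, \<theta>). z \<in> ?new \<and> \<theta> \<in> ord_maps k p \<and> y = act X k p \<theta> z)" for k y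
  define h' where "h' k y t = (if y \<in> skel X S p k then h k y t else case rep k y of (z, \<theta>) \<Rightarrow> E z k \<theta> t)" for k y t
  have old: "h' k y t = h k y t" if "y \<in> skel X S p k" for k y t using that by (simp add: h'_def)
  have new_ex: "\<exists>z \<theta>. z \<in> ?new \<and> \<theta> \<in> ord_maps k p \<and> y = act X k p \<theta> z"
    if y: "y \<in> skel X S (Suc p) k" "y \<notin> skel X S p k" for k y
  proof -
    obtain j z \<theta> where j: "j < Suc p" "z \<in> simplices X j" "\<theta> \<in> ord_maps k j" "y = act X k j \<theta> z"
      using y unfolding skel_def by blast
    have "\<not> j < p" using j(2-4) y unfolding skel_def by blast
    then have z: "z \<in> simplices X p" "\<theta> \<in> ord_maps k p" "y = act X k p \<theta> z"
      using j by (simp_all add: less_Suc_eq)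
    have "z \<notin> skel X S p p" using skel_act[OF X S z(2)] y(2) z(3) by blast
    then show ?thesis using z by blast
  qed
  have new: "h' k (act X k p \<theta> z) t = E z k \<theta> t"
    if z: "z \<in> ?new" "\<theta> \<in> ord_maps k p" and n: "act X k p \<theta> z \<notin> skel X S p k" for k \<theta> z t
  proof -
    let ?y = "act X k p \<theta> z"
    have "case rep k ?y of (z', \<theta>') \<Rightarrow> z' \<in> ?new \<and> \<theta>' \<in> ord_maps k p \<and> ?y = act X k p \<theta>' z'"
      unfolding rep_def by (rule someI[of _ "(z, \<theta>)"]) (use z in simp)
    then obtain z' \<theta>' where r: "rep k ?y = (z', \<theta>')" "z' \<in> ?new" "\<theta>' \<in> ord_maps k p" "?y = act X k p \<theta>' z'"
      by auto
    have "z = z' \<and> \<theta> = \<theta>'" using z r(2) by (intro skel_unique[OF X S _ _ _ _ z(2) r(3,4) n]) auto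
    then show ?thesis using n r(1) by (simp add: h'_def)
  qed
  \<comment> \<open>The formula also covers words that induce old simplices. Such a word cannot be
    surjective, since a section would then show that \<open>z\<close> itself is old, and on the
    other words \<open>E\<close> agrees with \<open>h\<close>.\<close>
  have new': "h' k (act X k p \<theta> z) t = E z k \<theta> t"
    if z: "z \<in> ?new" "\<theta> \<in> ord_maps k p" and t: "t \<in> ord_maps k 1" for k \<theta> z t
  proof (cases "act X k p \<theta> z \<in> skel X S p k")
    case True
    have "\<theta> ` {..k} \<noteq> {..p}"
    proof
      assume "\<theta> ` {..k} = {..p}"
      then obtain s where s: "s \<in> inj_maps p k" "compose {..p} \<theta> s = restrict id {..p}"
        using surj_section[OF z(2) _ le0] by metis
      have "act X p k s (act X k p \<theta> z) = z"
        using act_comp[OF X inj_maps_ord[OF s(1)] z(2)] s(2) act_id[OF X, of z] z(1) by simp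
      then show False using skel_act[OF X S inj_maps_ord[OF s(1)] True] z(1) by simp
    qed
    then show ?thesis using E_bd[OF z t] old[OF True] by simp
  qed (rule new[OF z])
  have "straightens X K (skel X S (Suc p)) \<phi> h'"
  proof (rule straightensI)
    fix n y assume y: "y \<in> skel X S (Suc p) n"
    show "h' n y t \<in> simplices K n" if t: "t \<in> ord_maps n 1" for t
    proof (cases "y \<in> skel X S p n")
      case True
      then show ?thesis using straightens_in[OF h True t] by (simp add: old)
    next
      case False
      then obtain z \<theta> where "z \<in> ?new" "\<theta> \<in> ord_maps n p" "y = act X n p \<theta> z" using new_ex[OF y] by blast
      then show ?thesis using new' E_in t by simp
    qed
    show "h' n y (const_simplex n 0) = \<phi> n y"
    proof (cases "y \<in> skel X S p n")
      case True
      then show ?thesis using straightens_zero[OF h True] by (simp add: old)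
    next
      case False
      then obtain z \<theta> where "z \<in> ?new" "\<theta> \<in> ord_maps n p" "y = act X n p \<theta> z" using new_ex[OF y] by blast
      then show ?thesis using new'[OF _ _ const_simplex_ord] E_zero by simp
    qed
    show "h' k (act X k n \<sigma> y) (compose {..k} t \<sigma>) = act K k n \<sigma> (h' n y t)"
      if \<sigma>: "\<sigma> \<in> ord_maps k n" and t: "t \<in> ord_maps n 1" and adm: "inj_on \<sigma> {i. i \<le> k \<and> t (\<sigma> i) = 0}" for k \<sigma> t
    proof (cases "y \<in> skel X S p n")
      case True
      then show ?thesis
        using straightens_act[OF h \<sigma> True t adm] skel_act[OF X S \<sigma> True] by (simp add: old)
    next
      case False
      then obtain z \<theta> where z: "z \<in> ?new" "\<theta> \<in> ord_maps n p" "y = act X n p \<theta> z" using new_ex[OF y] by blast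
      have zX: "z \<in> simplices X p" using z(1) by simp
      have "act X k n \<sigma> y = act X k p (compose {..k} \<theta> \<sigma>) z" using act_comp[OF X \<sigma> z(2) zX] z(3) by simp
      then show ?thesis
        using new'[OF z(1) ord_maps_comp[OF \<sigma> z(2)] ord_maps_comp[OF \<sigma> t]] new'[OF z(1,2) t] E_nat[OF z(1) \<sigma> z(2) t adm] z(3)
        by simp
    qed
  qed
  then show ?thesis using old by blast
qed

text \<open>Each step leaves earlier values unchanged, so the stages glue; any single instance of
  naturality involves two dimensions and is checked at one sufficiently late stage.\<close>

theorem straighten:
  fixes X :: "'a sset" and K :: "'k sset"
  assumes X: "simplicial_set X" and K: "kan_complex K" and S: "subcomplex X S"
    and \<phi>: "semisimplicial X K \<phi>" and h0: "straightens X K S \<phi> h0"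
  shows "\<exists>h. straightens X K (simplices X) \<phi> h \<and> (\<forall>n. \<forall>x\<in>S n. \<forall>t\<in>ord_maps n 1. h n x t = h0 n x t)"
proof -
  have s0: "skel X S 0 k = S k" for k using S by (auto simp: skel_def subcomplex_def)
  have "\<exists>hs. \<forall>p. (straightens X K (skel X S p) \<phi> (hs p) \<and> (p = 0 \<longrightarrow> hs p = h0)) \<and>
    (\<forall>k. \<forall>y\<in>skel X S p k. \<forall>t\<in>ord_maps k 1. hs (Suc p) k y t = hs p k y t)"
  proof (rule dependent_nat_choice)
    have "skel X S 0 = S" using s0 by auto
    then show "\<exists>h. straightens X K (skel X S 0) \<phi> h \<and> (0 = (0 :: nat) \<longrightarrow> h = h0)" using h0 by auto
  next
    fix h p assume "straightens X K (skel X S p) \<phi> h \<and> (p = 0 \<longrightarrow> h = h0)"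
    then show "\<exists>h'. (straightens X K (skel X S (Suc p)) \<phi> h' \<and> (Suc p = 0 \<longrightarrow> h' = h0)) \<and>
      (\<forall>k. \<forall>y\<in>skel X S p k. \<forall>t\<in>ord_maps k 1. h' k y t = h k y t)"
      using straighten_step[OF X K S \<phi>, of p h] by auto
  qed
  then obtain hs where hs: "\<And>p. straightens X K (skel X S p) \<phi> (hs p)" "hs 0 = h0"
    "\<And>p k y t. y \<in> skel X S p k \<Longrightarrow> t \<in> ord_maps k 1 \<Longrightarrow> hs (Suc p) k y t = hs p k y t"
    by blast
  have mono: "hs q k y t = hs p k y t" if "p \<le> q" "y \<in> skel X S p k" "t \<in> ord_maps k 1" for p q k y t
    using that
  proof (induction q rule: dec_induct)
    case (step q)
    have "y \<in> skel X S q k" by (rule subsetD[OF skel_mono[OF step.hyps(1)] step.prems(1)])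
    then show ?case using step hs(3) by simp
  qed simp
  \<comment> \<open>A simplex of dimension \<open>k\<close> belongs to the stage
    \<open>Suc k\<close> at the latest, so its value is settled there.\<close>
  define H where "H k y t = hs (Suc k) k y t" for k y t
  have H: "H k y t = hs q k y t" if "k < q" "y \<in> simplices X k" "t \<in> ord_maps k 1" for q k y t
    using mono[of "Suc k" q y k t] skel_all[OF X that(2) lessI] that unfolding H_def by simp
  have "straightens X K (simplices X) \<phi> H"
  proof (rule straightensI)
    fix n y assume y: "y \<in> simplices X n"
    note yn = skel_all[OF X y lessI]
    show "H n y t \<in> simplices K n" if "t \<in> ord_maps n 1" for t
      unfolding H_def by (rule straightens_in[OF hs(1) yn that])
    show "H n y (const_simplex n 0) = \<phi> n y"
      unfolding H_def by (rule straightens_zero[OF hs(1) yn])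
    show "H k (act X k n \<sigma> y) (compose {..k} t \<sigma>) = act K k n \<sigma> (H n y t)"
      if \<sigma>: "\<sigma> \<in> ord_maps k n" and t: "t \<in> ord_maps n 1" and adm: "inj_on \<sigma> {i. i \<le> k \<and> t (\<sigma> i) = 0}" for k \<sigma> t
    proof -
      define q where "q = Suc (max k n)"
      have q: "k < q" "n < q" by (auto simp: q_def)
      have "hs q k (act X k n \<sigma> y) (compose {..k} t \<sigma>) = act K k n \<sigma> (hs q n y t)"
        by (rule straightens_act[OF hs(1) \<sigma> skel_all[OF X y q(2)] t adm])
      then show ?thesis
        using H[OF q(1) act_closed[OF X \<sigma> y] ord_maps_comp[OF \<sigma> t]] H[OF q(2) y t] by simp
    qed
  qed
  moreover have "H n x t = h0 n x t" if "x \<in> S n" "t \<in> ord_maps n 1" for n x t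
    using mono[of 0 "Suc n" x n t] that s0 hs(2) by (simp add: H_def)
  ultimately show ?thesis by blast
qed

section \<open>Resolutions of maps on subdivisions\<close>

lemma cyl_seqI:
  assumes "c \<in> extensional {..j}" "\<And>i. i \<le> j \<Longrightarrow> jsupp (c i) \<noteq> {}" "\<And>i. i \<le> j \<Longrightarrow> jsupp (c i) \<subseteq> {..n}"
    "\<And>i i'. i \<le> i' \<Longrightarrow> i' \<le> j \<Longrightarrow> jle (c i) (c i')"
  shows "c \<in> cyl.seqs n j"
proof -
  have "jle (c i) (c i') \<or> jle (c i') (c i)" if "i \<le> j" "i' \<le> j" for i i'
    using assms(4)[of i i'] assms(4)[of i' i] that by linarith
  moreover have "finite (jsupp (c i))" if "i \<le> j" for i
    using finite_subset[OF assms(3)[OF that]] by simp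
  ultimately have "c ` {..j} \<in> cyl_chains"
    unfolding cyl_chains_def using assms(2) by auto
  moreover have "cyl.supp (c ` {..j}) \<subseteq> {..n}"
    using assms(3) by (auto simp: cyl.supp_def)
  ultimately show ?thesis using assms(1,4) by (simp add: cplx_simplex_iff cyl.lev_def)
qed

lemma cyl_seqD:
  assumes "c \<in> cyl.seqs n j"
  shows "c \<in> extensional {..j}" "i \<le> j \<Longrightarrow> jsupp (c i) \<noteq> {}" "i \<le> j \<Longrightarrow> jsupp (c i) \<subseteq> {..n}"
    "i \<le> i' \<Longrightarrow> i' \<le> j \<Longrightarrow> jle (c i) (c i')"
proof -
  have F: "c ` {..j} \<in> cyl_chains" "cyl.supp (c ` {..j}) \<subseteq> {..n}"
    using assms by (simp_all add: cplx_simplex_iff cyl.lev_def)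
  show "i \<le> j \<Longrightarrow> jsupp (c i) \<noteq> {}" using F(1) unfolding cyl_chains_def by blast
  show "i \<le> j \<Longrightarrow> jsupp (c i) \<subseteq> {..n}" using F(2) unfolding cyl.supp_def by blast
qed (use assms in \<open>simp_all add: cplx_simplex_iff\<close>)

definition flag :: "nat \<Rightarrow> nat \<Rightarrow> (nat \<Rightarrow> nat set) \<Rightarrow> bool" where
  "flag n j A \<longleftrightarrow> (\<forall>i\<le>j. A i \<noteq> {} \<and> A i \<subseteq> {..n}) \<and> (\<forall>i'\<le>j. \<forall>i\<le>i'. A i \<subseteq> A i')"

lemma flagD:
  assumes "flag n j A" "i \<le> j"
  shows "A i \<noteq> {}" "A i \<subseteq> {..n}" "finite (A i)"
  using assms finite_subset[of "A i" "{..n}"] by (auto simp: flag_def)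

lemma flag_mono: "flag n j A \<Longrightarrow> i \<le> i' \<Longrightarrow> i' \<le> j \<Longrightarrow> A i \<subseteq> A i'"
  by (simp add: flag_def)

lemma flag_compose: "flag n j A \<Longrightarrow> \<theta> \<in> ord_maps i j \<Longrightarrow> flag n i (\<lambda>l. A (\<theta> l))"
  by (simp add: flag_def ord_le ord_mono)

definition fseq :: "nat \<Rightarrow> (nat \<Rightarrow> nat set) \<Rightarrow> nat \<Rightarrow> nat + nat set" where
  "fseq j A = (\<lambda>i\<in>{..j}. Inr (A i))"

lemma fseq_in: "flag n j A \<Longrightarrow> fseq j A \<in> cyl.bseqs n j"
proof -
  assume A: "flag n j A"
  have "fseq j A \<in> cyl.seqs n j"
    using flagD[OF A] flag_mono[OF A] by (intro cyl_seqI) (auto simp: fseq_def)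
  then show ?thesis by (auto simp: cplx_simplex_iff cyl.blev_def fseq_def)
qed

lemma blev_fseq:
  assumes "c \<in> cyl.bseqs n j"
  shows "flag n j (\<lambda>i. jsupp (c i))" "c = fseq j (\<lambda>i. jsupp (c i))"
proof -
  have c: "c \<in> cyl.seqs n j" and b: "c ` {..j} \<subseteq> range Inr"
    using assms by (simp_all add: cplx_simplex_iff cyl.blev_def)
  have r: "c i = Inr (jsupp (c i))" if "i \<le> j" for i
  proof -
    have "c i \<in> range Inr" using b that by blast
    then show ?thesis by auto
  qed
  have "jsupp (c i) \<subseteq> jsupp (c i')" if "i \<le> i'" "i' \<le> j" for i i'
    using cyl_seqD(4)[OF c that] r[of i] r[of i'] that by (metis jle.simps(3) order_trans)
  then show "flag n j (\<lambda>i. jsupp (c i))" using cyl_seqD(2,3)[OF c] by (simp add: flag_def)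
  show "c = fseq j (\<lambda>i. jsupp (c i))"
    using r cyl_seqD(1)[OF c] by (intro extensionalityI[of _ "{..j}"]) (auto simp: fseq_def)
qed

definition vseq :: "nat \<Rightarrow> nat \<Rightarrow> nat + nat set" where
  "vseq n = (\<lambda>i\<in>{..n}. Inl i)"

lemma vseq_in: "vseq n \<in> cyl.seqs n n"
  by (rule cyl_seqI) (auto simp: vseq_def)

lemma shift_vseq: "\<alpha> \<in> ord_maps k n \<Longrightarrow> cyl.shift \<alpha> k (vseq k) = compose {..k} (vseq n) \<alpha>"
  by (auto simp: cyl.shift_def vseq_def compose_def jmap_def ord_le)

text \<open>\<open>bary_family X K d\<close>: the family \<open>d\<close> is a semisimplicial map from \<open>X\<close> to \<open>Ex(K)\<close>.\<close>

definition bary_family :: "'a sset \<Rightarrow> 'k sset \<Rightarrow> (nat \<Rightarrow> 'a \<Rightarrow> nat \<Rightarrow> (nat \<Rightarrow> nat + nat set) \<Rightarrow> 'k) \<Rightarrow> bool" where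
  "bary_family X K d \<longleftrightarrow> (\<forall>n. \<forall>y\<in>simplices X n. d n y \<in> sset_hom (cplx jle (cyl.blev n)) K \<and>
    (\<forall>k. \<forall>\<alpha>\<in>inj_maps k n. \<forall>j. \<forall>c\<in>cyl.bseqs k j.
      d k (act X k n \<alpha> y) j c = d n y j (cyl.shift \<alpha> j c)))"

definition cyl_family :: "'a sset \<Rightarrow> 'k sset \<Rightarrow> (nat \<Rightarrow> 'a set) \<Rightarrow> (nat \<Rightarrow> 'a \<Rightarrow> nat \<Rightarrow> (nat \<Rightarrow> nat + nat set) \<Rightarrow> 'k) \<Rightarrow>
    (nat \<Rightarrow> 'a \<Rightarrow> nat \<Rightarrow> (nat \<Rightarrow> nat + nat set) \<Rightarrow> 'k) \<Rightarrow> bool" where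
  "cyl_family X K S d \<psi> \<longleftrightarrow> (\<forall>n. \<forall>y\<in>S n. \<psi> n y \<in> sset_hom (cplx jle (cyl.lev n)) K \<and>
    (\<forall>j. \<forall>c\<in>cyl.bseqs n j. \<psi> n y j c = d n y j c) \<and>
    (\<forall>k. \<forall>\<alpha>\<in>inj_maps k n. \<forall>j. \<forall>c\<in>cyl.seqs k j.
      \<psi> k (act X k n \<alpha> y) j c = \<psi> n y j (cyl.shift \<alpha> j c)))"

text \<open>The semisimplicial map \<open>X \<rightarrow> K\<close> at the end of the mapping cylinders.\<close>

definition vert :: "(nat \<Rightarrow> 'a \<Rightarrow> nat \<Rightarrow> (nat \<Rightarrow> nat + nat set) \<Rightarrow> 'k) \<Rightarrow> nat \<Rightarrow> 'a \<Rightarrow> 'k" where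
  "vert \<psi> n y = \<psi> n y n (vseq n)"

definition resolves :: "'a sset \<Rightarrow> 'k sset \<Rightarrow> (nat \<Rightarrow> 'a set) \<Rightarrow> (nat \<Rightarrow> 'a \<Rightarrow> nat \<Rightarrow> (nat \<Rightarrow> nat + nat set) \<Rightarrow> 'k) \<Rightarrow>
    (nat \<Rightarrow> 'a \<Rightarrow> nat \<Rightarrow> (nat \<Rightarrow> nat + nat set) \<Rightarrow> 'k) \<Rightarrow> (nat \<Rightarrow> 'a \<Rightarrow> (nat \<Rightarrow> nat) \<Rightarrow> 'k) \<Rightarrow> bool" where
  "resolves X K S d \<psi> h \<longleftrightarrow> cyl_family X K S d \<psi> \<and> straightens X K S (vert \<psi>) h"

lemma cyl_family_hom: "cyl_family X K S d \<psi> \<Longrightarrow> y \<in> S n \<Longrightarrow> \<psi> n y \<in> sset_hom (cplx jle (cyl.lev n)) K"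
  by (simp add: cyl_family_def)

lemma cyl_family_base: "cyl_family X K S d \<psi> \<Longrightarrow> y \<in> S n \<Longrightarrow> c \<in> cyl.bseqs n j \<Longrightarrow>
    \<psi> n y j c = d n y j c"
  by (simp add: cyl_family_def)

lemma cyl_family_nat: "cyl_family X K S d \<psi> \<Longrightarrow> y \<in> S n \<Longrightarrow> \<alpha> \<in> inj_maps k n \<Longrightarrow>
    c \<in> cyl.seqs k j \<Longrightarrow> \<psi> k (act X k n \<alpha> y) j c = \<psi> n y j (cyl.shift \<alpha> j c)"
  by (simp add: cyl_family_def)

lemma semisimplicial_vert:
  assumes "cyl_family X K (simplices X) d \<psi>"
  shows "semisimplicial X K (vert \<psi>)"
  unfolding semisimplicial_def
proof (intro conjI allI ballI)
  show "vert \<psi> n y \<in> simplices K n" if "y \<in> simplices X n" for n y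
    unfolding vert_def by (rule hom_in[OF cyl_family_hom[OF assms that] vseq_in])
  show "vert \<psi> k (act X k n \<alpha> y) = act K k n \<alpha> (vert \<psi> n y)"
    if "\<alpha> \<in> inj_maps k n" "y \<in> simplices X n" for k n \<alpha> y
    using cyl_family_nat[OF assms that(2,1) vseq_in] shift_vseq[OF inj_maps_ord[OF that(1)]]
      hom_act[OF cyl_family_hom[OF assms that(2)] inj_maps_ord[OF that(1)] vseq_in]
    by (simp add: vert_def)
qed

text \<open>The cylinders only have to match faces, so they come from \<open>cyl.lift\<close>;
  degeneracies are dealt with afterwards by \<open>straighten\<close>. Both extensions respect the
  data over \<open>S\<close>.\<close>

theorem resolution_exists:
  fixes X :: "'a sset" and K :: "'k sset"
  assumes X: "simplicial_set X" and K: "kan_complex K" and S: "subcomplex X S"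
    and d: "bary_family X K d" and r: "resolves X K S d \<psi>0 h0"
  shows "\<exists>\<psi> h. resolves X K (simplices X) d \<psi> h \<and>
    (\<forall>n. \<forall>y\<in>S n. \<psi> n y = \<psi>0 n y \<and> (\<forall>t\<in>ord_maps n 1. h n y t = h0 n y t))"
proof -
  have c0: "cyl_family X K S d \<psi>0" and h0: "straightens X K S (vert \<psi>0) h0"
    using r by (simp_all add: resolves_def)
  have "\<exists>P. \<forall>n. \<forall>b\<in>simplices X n. P n b \<in> sset_hom (cplx jle (cyl.lev n)) K \<and>
    (\<forall>j. \<forall>c\<in>cyl.bseqs n j. P n b j c = d n b j c) \<and>
    (b \<in> S n \<longrightarrow> P n b = \<psi>0 n b) \<and>
    (\<forall>k. \<forall>\<alpha>\<in>inj_maps k n. \<forall>j. \<forall>c\<in>cyl.seqs k j.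
      P k (act X k n \<alpha> b) j c = P n b j (cyl.shift \<alpha> j c))"
  proof (rule cyl.lift)
    show "act X k n \<alpha> b \<in> simplices X k" if "\<alpha> \<in> inj_maps k n" "b \<in> simplices X n" for k n \<alpha> b
      using act_closed[OF X inj_maps_ord[OF that(1)] that(2)] .
    show "act X j k \<beta> (act X k n \<alpha> b) = act X j n (compose {..j} \<alpha> \<beta>) b"
      if "\<beta> \<in> inj_maps j k" "\<alpha> \<in> inj_maps k n" "b \<in> simplices X n" for j k n \<alpha> \<beta> b
      using act_comp[OF X inj_maps_ord[OF that(1)] inj_maps_ord[OF that(2)] that(3)] .
    show "act X n n (restrict id {..n}) b = b" if "b \<in> simplices X n" for n b using act_id[OF X that] .
    show "S n \<subseteq> simplices X n" for n using S by (simp add: subcomplex_def)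
    show "act X k n \<alpha> b \<in> S k" if "\<alpha> \<in> inj_maps k n" "b \<in> S n" for k n \<alpha> b
      using S that inj_maps_ord[OF that(1)] by (simp add: subcomplex_def)
    show "d n b \<in> sset_hom (cplx jle (cyl.blev n)) K" if "b \<in> simplices X n" for n b
      using d that by (simp add: bary_family_def)
    show "d k (act X k n \<alpha> b) j c = d n b j (cyl.shift \<alpha> j c)"
      if "\<alpha> \<in> inj_maps k n" "b \<in> simplices X n" "c \<in> cyl.bseqs k j" for k n \<alpha> b j c
      using d that by (simp add: bary_family_def)
    show "\<exists>g\<in>sset_hom (cplx jle (cyl.lev n)) K. \<forall>j. \<forall>c\<in>cyl.lseqs n j. g j c = f j c"
      if "f \<in> sset_hom (cplx jle (cyl.low n)) K" for n f
      using cyl_fill[OF K that] .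
  qed (use cyl_family_hom[OF c0] cyl_family_nat[OF c0] cyl_family_base[OF c0] in auto)
  then obtain \<psi> where P: "\<forall>n. \<forall>b\<in>simplices X n. \<psi> n b \<in> sset_hom (cplx jle (cyl.lev n)) K \<and>
    (\<forall>j. \<forall>c\<in>cyl.bseqs n j. \<psi> n b j c = d n b j c) \<and>
    (b \<in> S n \<longrightarrow> \<psi> n b = \<psi>0 n b) \<and>
    (\<forall>k. \<forall>\<alpha>\<in>inj_maps k n. \<forall>j. \<forall>c\<in>cyl.seqs k j.
      \<psi> k (act X k n \<alpha> b) j c = \<psi> n b j (cyl.shift \<alpha> j c))" ..
  have "b \<in> simplices X n" if "b \<in> S n" for b n using S that by (auto simp: subcomplex_def)
  then have \<psi>: "cyl_family X K (simplices X) d \<psi>" "\<And>n b. b \<in> S n \<Longrightarrow> \<psi> n b = \<psi>0 n b"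
    using P by (simp_all add: cyl_family_def)
  \<comment> \<open>On \<open>S\<close> the new cylinders coincide with the old ones, so the given
    straightening still starts at the new \<open>vert \<psi>\<close>.\<close>
  have "straightens X K S (vert \<psi>) h0"
    using h0 \<psi>(2) unfolding straightens_def by (simp add: vert_def)
  from straighten[OF X K S semisimplicial_vert[OF \<psi>(1)] this]
  obtain h where "straightens X K (simplices X) (vert \<psi>) h" "\<And>n x t. x \<in> S n \<Longrightarrow> t \<in> ord_maps n 1 \<Longrightarrow> h n x t = h0 n x t"
    by auto
  then have "resolves X K (simplices X) d \<psi> h \<and>
    (\<forall>n. \<forall>y\<in>S n. \<psi> n y = \<psi>0 n y \<and> (\<forall>t\<in>ord_maps n 1. h n y t = h0 n y t))"
    using \<psi> by (simp add: resolves_def)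
  then show ?thesis by blast
qed

definition end_map :: "'a sset \<Rightarrow> (nat \<Rightarrow> 'a \<Rightarrow> (nat \<Rightarrow> nat) \<Rightarrow> 'k) \<Rightarrow> nat \<Rightarrow> 'a \<Rightarrow> 'k" where
  "end_map X h = (\<lambda>n. restrict (\<lambda>x. h n x (const_simplex n 1)) (simplices X n))"

text \<open>At type constantly 1 there are no vertices of type 0, so every operator is admissible
  and the end is compatible with degeneracies as well.\<close>

lemma end_map_hom:
  assumes X: "simplicial_set X" and h: "straightens X K (simplices X) \<phi> h"
  shows "end_map X h \<in> sset_hom X K"
  unfolding end_map_def
proof (rule hom_restrictI[OF X])
  show "h n x (const_simplex n 1) \<in> simplices K n" if "x \<in> simplices X n" for n x
    using straightens_in[OF h that const_simplex_ord] by simp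
  show "h m (act X m n \<theta> x) (const_simplex m 1) = act K m n \<theta> (h n x (const_simplex n 1))"
    if "\<theta> \<in> ord_maps m n" "x \<in> simplices X n" for m n \<theta> x
  proof -
    have eq: "{i. i \<le> m \<and> const_simplex n 1 (\<theta> i) = 0} = {}"
      using ord_le[OF that(1)] by (auto simp: const_simplex_def)
    have "inj_on \<theta> {i. i \<le> m \<and> const_simplex n 1 (\<theta> i) = 0}" unfolding eq by (rule inj_on_empty)
    from straightens_act[OF h that const_simplex_ord this] show ?thesis
      using const_simplex_compose[OF that(1), of 1] by simp
  qed
qed

section \<open>Flags and simplices of the subdivision\<close>

definition smap :: "'a sset \<Rightarrow> nat \<Rightarrow> 'a \<Rightarrow> nat \<Rightarrow> (nat \<Rightarrow> nat) \<Rightarrow> 'a" where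
  "smap X n y = (\<lambda>m. \<lambda>\<sigma>\<in>ord_maps m n. act X m n \<sigma> y)"

lemma smap_hom: "simplicial_set X \<Longrightarrow> y \<in> simplices X n \<Longrightarrow> smap X n y \<in> sset_hom (std_simplex n) X"
  using hom_restrictI[OF simplicial_set_std_simplex, of n "\<lambda>m \<sigma>. act X m n \<sigma> y" X]
  by (simp add: smap_def act_closed act_comp)

lemma smap_yoneda:
  assumes X: "simplicial_set X" and f: "f \<in> sset_hom (std_simplex n) X"
  shows "f n (restrict id {..n}) \<in> simplices X n" "smap X n (f n (restrict id {..n})) = f"
proof -
  show y: "f n (restrict id {..n}) \<in> simplices X n" using hom_in[OF f] ord_maps_id by simp
  show "smap X n (f n (restrict id {..n})) = f"
  proof (rule hom_eqI[OF smap_hom[OF X y] f])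
    fix m \<sigma> assume "\<sigma> \<in> simplices (std_simplex n) m"
    then have \<sigma>: "\<sigma> \<in> ord_maps m n" by simp
    show "smap X n (f n (restrict id {..n})) m \<sigma> = f m \<sigma>"
      using hom_act[OF f \<sigma>, of "restrict id {..n}"] ord_maps_id \<sigma> by (simp add: smap_def compose_ord_id_left)
  qed
qed

lemma smap_act:
  assumes X: "simplicial_set X" and y: "y \<in> simplices X n" and \<alpha>: "\<alpha> \<in> ord_maps k n"
  shows "sset_comp (std_simplex k) (smap X n y) (std_simplex_map k \<alpha>) = smap X k (act X k n \<alpha> y)"
  using ord_maps_comp[OF _ \<alpha>] act_comp[OF X _ \<alpha> y]
  by (auto simp: sset_comp_def smap_def std_simplex_map_def compose_def[of "ord_maps _ _"] fun_eq_iff)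

lemma smap_eval: "simplicial_set X \<Longrightarrow> y \<in> simplices X n \<Longrightarrow> smap X n y n (restrict id {..n}) = y"
  by (simp add: smap_def ord_maps_id act_id)

text \<open>The inclusion of the face \<open>U\<close> into the face \<open>V\<close>, rewritten as
  an operator between their numberings.\<close>

definition farrow :: "nat set \<Rightarrow> nat set \<Rightarrow> nat \<Rightarrow> nat" where
  "farrow U V = compose {..card U - 1} (rank_in V) (enum_set U)"

lemma farrow:
  assumes "finite V" "U \<noteq> {}" "U \<subseteq> V"
  shows "farrow U V \<in> inj_maps (card U - 1) (card V - 1)"
    "compose {..card U - 1} (enum_set V) (farrow U V) = enum_set U"
    "U = V \<Longrightarrow> farrow U V = restrict id {..card U - 1}"
    "farrow U V ` {..card U - 1} = rank_in V ` U"
proof -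
  have U: "finite U" using assms finite_subset by blast
  have e: "enum_set U i \<in> V" if "i \<le> card U - 1" for i using enum_set_in[OF U assms(2) that] assms(3) by blast
  show "farrow U V \<in> inj_maps (card U - 1) (card V - 1)"
  proof (rule inj_mapsI)
    show "farrow U V i \<le> card V - 1" if "i \<le> card U - 1" for i
      using enum_rank_in(2)[OF assms(1) e[OF that]] that by (simp add: farrow_def compose_def)
    show "farrow U V i < farrow U V j" if "i < j" "j \<le> card U - 1" for i j
      using rank_in_less[OF assms(1) e[of i] enum_set_less[OF U that]] that by (simp add: farrow_def compose_def)
  qed (simp add: farrow_def compose_def)
  show "compose {..card U - 1} (enum_set V) (farrow U V) = enum_set U"
    using enum_rank_in(1)[OF assms(1) e]
    by (intro ord_maps_eqI[of _ "card U - 1"]) (simp_all add: farrow_def compose_def enum_set_def[of U])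
  show "U = V \<Longrightarrow> farrow U V = restrict id {..card U - 1}"
    using rank_enum_set[OF U assms(2)] by (auto simp: farrow_def compose_def)
  show "farrow U V ` {..card U - 1} = rank_in V ` U"
  proof -
    have "farrow U V ` {..card U - 1} = rank_in V ` enum_set U ` {..card U - 1}"
      by (auto simp: farrow_def compose_def)
    then show ?thesis using enum_set_surj[OF U assms(2)] by simp
  qed
qed

lemma farrow_comp:
  assumes "finite W" "U \<noteq> {}" "U \<subseteq> V" "V \<subseteq> W"
  shows "farrow U W = compose {..card U - 1} (farrow V W) (farrow U V)"
proof -
  have V: "finite V" "V \<noteq> {}" using assms finite_subset by auto
  have U: "finite U" using V assms finite_subset by blast
  show ?thesis
  proof (rule ord_maps_eqI[of _ "card U - 1"])
    fix i assume i: "i \<le> card U - 1"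
    have "enum_set U i \<in> V" using enum_set_in[OF U assms(2) i] assms(3) by blast
    from enum_rank_in[OF V(1) this] show "farrow U W i = compose {..card U - 1} (farrow V W) (farrow U V) i"
      using i by (simp add: farrow_def compose_def)
  qed (simp_all add: farrow_def compose_def)
qed

lemma farrow_image:
  assumes \<alpha>: "\<alpha> \<in> inj_maps k n" and U: "U \<noteq> {}" "U \<subseteq> V" "V \<subseteq> {..k}"
  shows "farrow (\<alpha> ` U) (\<alpha> ` V) = farrow U V"
proof (rule ord_maps_eqI[of _ "card U - 1"])
  have f: "finite U" using U finite_subset[of U "{..k}"] by auto
  have Uk: "U \<subseteq> {..k}" "V \<noteq> {}" using U by auto
  note e = enum_set_image[OF \<alpha> Uk(1) U(1)]
  show "farrow (\<alpha> ` U) (\<alpha> ` V) i = farrow U V i" if i: "i \<le> card U - 1" for i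
  proof -
    have "enum_set U i \<in> V" using enum_set_in[OF f U(1) i] U(2) by blast
    then show ?thesis
      using i enum_set_image(3)[OF \<alpha> U(3) Uk(2)] by (simp add: farrow_def compose_def e)
  qed
  show "farrow (\<alpha> ` U) (\<alpha> ` V) \<in> extensional {..card U - 1}" using e(2) by (simp add: farrow_def compose_def)
qed (simp add: farrow_def compose_def)

text \<open>The image of the flag \<open>A\<close>, a simplex of the barycentric subdivision of
  \<open>\<Delta>\<^sup>n\<close>, under the map induced by \<open>y\<close>: its objects are the
  faces of \<open>y\<close> spanned by the sets \<open>A i\<close>.\<close>

definition bchain :: "'a sset \<Rightarrow> nat \<Rightarrow> 'a \<Rightarrow> nat \<Rightarrow> (nat \<Rightarrow> nat set) \<Rightarrow>
    (nat \<Rightarrow> 'a simplex_obj) \<times> (nat \<times> nat \<Rightarrow> nat \<Rightarrow> nat)" where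
  "bchain X n y k A =
    (\<lambda>i\<in>{..k}. (card (A i) - 1, smap X (card (A i) - 1) (act X (card (A i) - 1) n (enum_set (A i)) y)),
     \<lambda>(i, j)\<in>poset_arrows k. farrow (A i) (A j))"

lemma bchain_cong:
  assumes "\<And>i. i \<le> k \<Longrightarrow> A i = B i"
  shows "bchain X n y k A = bchain X n y k B"
  using assms by (auto simp: bchain_def poset_arrows_def fun_eq_iff restrict_def)

lemma nerve_simplex_iff: "(c, a) \<in> simplices (nerve C) k \<longleftrightarrow>
    c \<in> extensional {..k} \<and> (\<forall>i\<le>k. c i \<in> Obj C) \<and> a \<in> extensional (poset_arrows k) \<and>
    (\<forall>i j. i \<le> j \<and> j \<le> k \<longrightarrow> a (i, j) \<in> Hom C (c i) (c j)) \<and> (\<forall>i\<le>k. a (i, i) = Id C (c i)) \<and>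
    (\<forall>i j l. i \<le> j \<and> j \<le> l \<and> l \<le> k \<longrightarrow> a (i, l) = Comp C (c i) (c j) (c l) (a (j, l)) (a (i, j)))"
  by (auto simp: nerve_def poset_arrows_def PiE_def)

lemma nerve_act: "act (nerve C) m n \<theta> (c, a) = (compose {..m} c \<theta>, \<lambda>(i, j)\<in>poset_arrows m. a (\<theta> i, \<theta> j))"
  by (simp add: nerve_def)

lemma bchain_in:
  assumes X: "simplicial_set X" and y: "y \<in> simplices X n" and A: "flag n k A"
  shows "bchain X n y k A \<in> simplices (subdiv X) k"
proof -
  have e: "enum_set (A i) \<in> ord_maps (card (A i) - 1) n" if "i \<le> k" for i
    using enum_set_inj_maps[OF flagD(3,1,2)[OF A that]] by (rule inj_maps_ord)
  have obj: "(card (A i) - 1, smap X (card (A i) - 1) (act X (card (A i) - 1) n (enum_set (A i)) y)) \<in> Obj (simplex_category X)"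
    if "i \<le> k" for i
    using smap_hom[OF X act_closed[OF X e[OF that] y]] by (simp add: simplex_category_def)
  have hom: "farrow (A i) (A j) \<in> Hom (simplex_category X)
      (card (A i) - 1, smap X (card (A i) - 1) (act X (card (A i) - 1) n (enum_set (A i)) y))
      (card (A j) - 1, smap X (card (A j) - 1) (act X (card (A j) - 1) n (enum_set (A j)) y))"
    if "i \<le> j" "j \<le> k" for i j
  proof -
    have i: "i \<le> k" using that by simp
    note fa = farrow[OF flagD(3)[OF A that(2)] flagD(1)[OF A i] flag_mono[OF A that]]
    note fo = inj_maps_ord[OF fa(1)]
    have "act X (card (A i) - 1) (card (A j) - 1) (farrow (A i) (A j)) (act X (card (A j) - 1) n (enum_set (A j)) y) =
        act X (card (A i) - 1) n (enum_set (A i)) y"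
      using act_comp[OF X fo e[OF that(2)] y] fa(2) by simp
    then have "sset_comp (std_simplex (card (A i) - 1)) (smap X (card (A j) - 1) (act X (card (A j) - 1) n (enum_set (A j)) y))
        (std_simplex_map (card (A i) - 1) (farrow (A i) (A j))) =
        smap X (card (A i) - 1) (act X (card (A i) - 1) n (enum_set (A i)) y)"
      using smap_act[OF X act_closed[OF X e[OF that(2)] y] fo] by simp
    then show ?thesis using fa(1) by (simp add: simplex_category_def inj_maps_def)
  qed
  have cmp: "farrow (A i) (A l) = compose {..card (A i) - 1} (farrow (A j) (A l)) (farrow (A i) (A j))"
    if "i \<le> j" "j \<le> l" "l \<le> k" for i j l
    using that by (intro farrow_comp flagD[OF A] flag_mono[OF A]) auto
  have ident: "farrow (A i) (A i) = restrict id {..card (A i) - 1}" if "i \<le> k" for i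
    using farrow(3)[OF flagD(3,1)[OF A that]] by simp
  define c where "c = (\<lambda>i\<in>{..k}. (card (A i) - 1, smap X (card (A i) - 1) (act X (card (A i) - 1) n (enum_set (A i)) y)))"
  define a where "a = (\<lambda>(i, j)\<in>poset_arrows k. farrow (A i) (A j))"
  have c: "c i = (card (A i) - 1, smap X (card (A i) - 1) (act X (card (A i) - 1) n (enum_set (A i)) y))" if "i \<le> k" for i
    using that by (simp add: c_def)
  have a: "a (i, j) = farrow (A i) (A j)" if "i \<le> j" "j \<le> k" for i j
    using that by (simp add: a_def poset_arrows_def)
  have "(c, a) \<in> simplices (nerve (simplex_category X)) k"
    unfolding nerve_simplex_iff
  proof (intro conjI allI impI)
    show "c i \<in> Obj (simplex_category X)" if "i \<le> k" for i
      unfolding c[OF that] by (rule obj[OF that])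
    show "a (i, j) \<in> Hom (simplex_category X) (c i) (c j)" if "i \<le> j \<and> j \<le> k" for i j
    proof -
      have ij: "i \<le> j" "j \<le> k" "i \<le> k" using that by auto
      show ?thesis unfolding a[OF ij(1,2)] c[OF ij(2)] c[OF ij(3)] by (rule hom[OF ij(1,2)])
    qed
    show "a (i, i) = Id (simplex_category X) (c i)" if "i \<le> k" for i
      using ident[OF that] by (simp add: a[OF order_refl that] c[OF that] simplex_category_def)
    show "a (i, l) = Comp (simplex_category X) (c i) (c j) (c l) (a (j, l)) (a (i, j))"
      if "i \<le> j \<and> j \<le> l \<and> l \<le> k" for i j l
    proof -
      have ij: "i \<le> j" "j \<le> l" "l \<le> k" "i \<le> l" "j \<le> k" "i \<le> k" using that by auto
      show ?thesis
        using cmp[OF ij(1-3)] by (simp add: a[OF ij(4,3)] a[OF ij(2,3)] a[OF ij(1,5)] c[OF ij(6)] simplex_category_def)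
    qed
  qed (simp_all add: c_def a_def)
  then show ?thesis by (simp add: subdiv_def bchain_def c_def a_def)
qed

lemma bchain_act:
  assumes \<theta>: "\<theta> \<in> ord_maps m k"
  shows "act (subdiv X) m k \<theta> (bchain X n y k A) = bchain X n y m (\<lambda>i. A (\<theta> i))"
  unfolding subdiv_def bchain_def nerve_act
  using ord_le[OF \<theta>] ord_mono[OF \<theta>] by (auto simp: compose_def poset_arrows_def fun_eq_iff restrict_def)

text \<open>A face of a face of \<open>y\<close> is named by the image of its vertex set.
  Injectivity of \<open>\<alpha>\<close> preserves cardinalities and hence the dimensions of the
  objects.\<close>

lemma bchain_nat:
  assumes X: "simplicial_set X" and y: "y \<in> simplices X n" and \<alpha>: "\<alpha> \<in> inj_maps k n" and A: "flag k j A"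
  shows "bchain X k (act X k n \<alpha> y) j A = bchain X n y j (\<lambda>i. \<alpha> ` A i)"
proof -
  have 1: "card (\<alpha> ` A i) = card (A i)" "act X (card (A i) - 1) k (enum_set (A i)) (act X k n \<alpha> y) =
      act X (card (A i) - 1) n (enum_set (\<alpha> ` A i)) y" if "i \<le> j" for i
  proof -
    note e = enum_set_image[OF \<alpha> flagD(2,1)[OF A that]]
    have o: "enum_set (A i) \<in> ord_maps (card (A i) - 1) k"
      using enum_set_inj_maps[OF flagD(3,1,2)[OF A that]] by (rule inj_maps_ord)
    show "card (\<alpha> ` A i) = card (A i)" by (rule e(2))
    show "act X (card (A i) - 1) k (enum_set (A i)) (act X k n \<alpha> y) = act X (card (A i) - 1) n (enum_set (\<alpha> ` A i)) y"
      using act_comp[OF X o inj_maps_ord[OF \<alpha>] y] e(1) by simp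
  qed
  have 2: "farrow (\<alpha> ` A i) (\<alpha> ` A i') = farrow (A i) (A i')" if "i \<le> i'" "i' \<le> j" for i i'
    using that flagD(1)[OF A, of i] flagD(2)[OF A that(2)] flag_mono[OF A that] by (intro farrow_image[OF \<alpha>]) auto
  have "restrict (\<lambda>i. (card (A i) - 1, smap X (card (A i) - 1) (act X (card (A i) - 1) k (enum_set (A i)) (act X k n \<alpha> y)))) {..j} =
    restrict (\<lambda>i. (card (\<alpha> ` A i) - 1, smap X (card (\<alpha> ` A i) - 1) (act X (card (\<alpha> ` A i) - 1) n (enum_set (\<alpha> ` A i)) y))) {..j}"
    by (rule restrict_ext) (simp only: 1 atMost_iff)
  moreover have "restrict (\<lambda>(i, i'). farrow (A i) (A i')) (poset_arrows j) = restrict (\<lambda>(i, i'). farrow (\<alpha> ` A i) (\<alpha> ` A i')) (poset_arrows j)"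
    by (rule restrict_ext) (auto simp: poset_arrows_def 2)
  ultimately show ?thesis unfolding bchain_def by simp
qed

text \<open>A simplex of the subdivision is recovered from its last object and a flag of faces of it.\<close>

definition nf_dim :: "nat \<Rightarrow> (nat \<Rightarrow> 'a simplex_obj) \<times> (nat \<times> nat \<Rightarrow> nat \<Rightarrow> nat) \<Rightarrow> nat" where
  "nf_dim k s = fst (fst s k)"

definition nf_top :: "nat \<Rightarrow> (nat \<Rightarrow> 'a simplex_obj) \<times> (nat \<times> nat \<Rightarrow> nat \<Rightarrow> nat) \<Rightarrow> 'a" where
  "nf_top k s = snd (fst s k) (nf_dim k s) (restrict id {..nf_dim k s})"

definition nf_flag :: "nat \<Rightarrow> (nat \<Rightarrow> 'a simplex_obj) \<times> (nat \<times> nat \<Rightarrow> nat \<Rightarrow> nat) \<Rightarrow> nat \<Rightarrow> nat set" where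
  "nf_flag k s i = snd s (i, k) ` {..fst (fst s i)}"

text \<open>All arrows into the last object are injections, so the earlier objects are faces of it
  and form a flag there. Conversely an injection is the enumeration of its image, which gives back
  the objects and the arrows.\<close>

lemma normal_form:
  assumes X: "simplicial_set X" and s: "s \<in> simplices (subdiv X) k"
  shows "nf_top k s \<in> simplices X (nf_dim k s)" "flag (nf_dim k s) k (nf_flag k s)"
    "bchain X (nf_dim k s) (nf_top k s) k (nf_flag k s) = s"
proof -
  obtain c a where sa: "s = (c, a)" by (cases s)
  define n where "n i = fst (c i)" for i
  define f where "f i = snd (c i)" for i
  have cnf: "c i = (n i, f i)" for i by (simp add: n_def f_def)
  let ?C = "simplex_category X"
  have c: "c \<in> extensional {..k}" "a \<in> extensional (poset_arrows k)"
    and obj: "\<And>i. i \<le> k \<Longrightarrow> c i \<in> Obj ?C" and hom: "\<And>i j. i \<le> j \<Longrightarrow> j \<le> k \<Longrightarrow> a (i, j) \<in> Hom ?C (c i) (c j)"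
    and cmp: "\<And>i j l. i \<le> j \<Longrightarrow> j \<le> l \<Longrightarrow> l \<le> k \<Longrightarrow> a (i, l) = Comp ?C (c i) (c j) (c l) (a (j, l)) (a (i, j))"
    using s unfolding sa subdiv_def nerve_simplex_iff by simp_all
  have f: "f i \<in> sset_hom (std_simplex (n i)) X" if "i \<le> k" for i
    using obj[OF that] by (simp add: simplex_category_def cnf)
  have a: "a (i, j) \<in> inj_maps (n i) (n j)"
    "sset_comp (std_simplex (n i)) (f j) (std_simplex_map (n i) (a (i, j))) = f i" if "i \<le> j" "j \<le> k" for i j
    using hom[OF that] by (simp_all add: simplex_category_def cnf inj_maps_def)
  have ac: "a (i, l) = compose {..n i} (a (j, l)) (a (i, j))" if "i \<le> j" "j \<le> l" "l \<le> k" for i j l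
    using cmp[OF that] by (simp add: simplex_category_def cnf)
  define A where "A i = a (i, k) ` {..n i}" for i
  define y where "y = f k (n k) (restrict id {..n k})"
  have nf: "nf_dim k s = n k" "nf_top k s = y" "nf_flag k s = A"
    by (simp_all add: nf_dim_def nf_top_def nf_flag_def sa n_def y_def f_def A_def fun_eq_iff)
  have y: "y \<in> simplices X (n k)" and fy: "smap X (n k) y = f k"
    unfolding y_def using smap_yoneda[OF X f[OF order_refl]] by auto
  have en: "enum_set (A i) = a (i, k)" "card (A i) - 1 = n i" if "i \<le> k" for i
    unfolding A_def using enum_set_unique[OF a(1)[OF that order_refl]] by auto
  have fl: "flag (n k) k A"
    unfolding flag_def
  proof (intro conjI allI impI)
    show "A i \<noteq> {}" for i by (auto simp: A_def)
    show "A i \<subseteq> {..n k}" if "i \<le> k" for i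
      using ord_le[OF inj_maps_ord[OF a(1)[OF that order_refl]]] by (auto simp: A_def)
    show "A i \<subseteq> A j" if "j \<le> k" "i \<le> j" for i j
      using ac[OF that(2,1) order_refl] ord_le[OF inj_maps_ord[OF a(1)[OF that(2,1)]]]
      by (auto simp: A_def compose_def)
  qed
  have obj_eq: "(card (A i) - 1, smap X (card (A i) - 1) (act X (card (A i) - 1) (n k) (enum_set (A i)) y)) = c i"
    if "i \<le> k" for i
    using smap_act[OF X y inj_maps_ord[OF a(1)[OF that order_refl]]] a(2)[OF that order_refl] fy
    by (simp only: en[OF that] cnf)
  have arr_eq: "farrow (A i) (A j) = a (i, j)" if ij: "i \<le> j" "j \<le> k" for i j
  proof -
    have i: "i \<le> k" using ij by simp
    note aij = inj_maps_ord[OF a(1)[OF ij]]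
    have "rank_in (A j) (a (i, k) l) = a (i, j) l" if l: "l \<le> n i" for l
      using enum_set_unique(3)[OF a(1)[OF ij(2) order_refl] ord_le[OF aij l]] ac[OF ij(1,2) order_refl] l
      by (simp add: A_def compose_def)
    then show ?thesis
      unfolding farrow_def en[OF i]
      by (intro ord_maps_eqI[of _ "n i"]) (auto simp: compose_def ord_maps_ext[OF aij])
  qed
  have "bchain X (n k) y k A = (c, a)"
  proof -
    have "restrict (\<lambda>i. (card (A i) - 1, smap X (card (A i) - 1) (act X (card (A i) - 1) (n k) (enum_set (A i)) y))) {..k} = c"
      using obj_eq by (intro extensionalityI[OF restrict_extensional c(1)]) auto
    moreover have "restrict (\<lambda>(i, j). farrow (A i) (A j)) (poset_arrows k) = a"
      using arr_eq by (intro extensionalityI[OF restrict_extensional c(2)]) (auto simp: poset_arrows_def)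
    ultimately show ?thesis unfolding bchain_def by simp
  qed
  then show "nf_top k s \<in> simplices X (nf_dim k s)" "flag (nf_dim k s) k (nf_flag k s)"
    "bchain X (nf_dim k s) (nf_top k s) k (nf_flag k s) = s"
    unfolding nf using y fl sa by simp_all
qed

lemma normal_form_bchain:
  assumes X: "simplicial_set X" and y: "y \<in> simplices X n" and A: "flag n k A"
  defines "s \<equiv> bchain X n y k A"
  shows "nf_dim k s = card (A k) - 1" "nf_top k s = act X (card (A k) - 1) n (enum_set (A k)) y"
    "i \<le> k \<Longrightarrow> nf_flag k s i = rank_in (A k) ` A i"
proof -
  have e: "enum_set (A k) \<in> ord_maps (card (A k) - 1) n"
    using enum_set_inj_maps[OF flagD(3,1,2)[OF A order_refl]] by (rule inj_maps_ord)
  show d: "nf_dim k s = card (A k) - 1" by (simp add: nf_dim_def s_def bchain_def)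
  show "nf_top k s = act X (card (A k) - 1) n (enum_set (A k)) y"
    unfolding nf_top_def d using smap_eval[OF X act_closed[OF X e y]] by (simp add: s_def bchain_def)
  show "nf_flag k s i = rank_in (A k) ` A i" if "i \<le> k"
    using farrow(4)[OF flagD(3)[OF A order_refl] flagD(1)[OF A that] flag_mono[OF A that order_refl]] that
    by (simp add: nf_flag_def s_def bchain_def poset_arrows_def)
qed

text \<open>The normal form of a flag is the same flag seen inside its largest face
  \<open>A k\<close>. Invariance under the single injection enumerating \<open>A k\<close> therefore
  suffices to evaluate \<open>\<Psi>\<close> on any presentation.\<close>

lemma normal_form_invariant:
  assumes X: "simplicial_set X" and y: "y \<in> simplices X n" and A: "flag n k A"
    and inv: "\<And>m \<alpha> B. \<alpha> \<in> inj_maps m n \<Longrightarrow> flag m k B \<Longrightarrow> \<Psi> m (act X m n \<alpha> y) B = \<Psi> n y (\<lambda>i. \<alpha> ` B i)"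
    and cong: "\<And>m z B B'. (\<And>i. i \<le> k \<Longrightarrow> B i = B' i) \<Longrightarrow> \<Psi> m z B = \<Psi> m z B'"
  defines "s \<equiv> bchain X n y k A"
  shows "\<Psi> (nf_dim k s) (nf_top k s) (nf_flag k s) = \<Psi> n y A"
proof -
  let ?U = "A k"
  note U = flagD(3,1,2)[OF A order_refl]
  note e = enum_set_inj_maps[OF U]
  note nf = normal_form_bchain[OF X y A, folded s_def]
  have er: "enum_set ?U ` rank_in ?U ` A i = A i" if "i \<le> k" for i
  proof -
    have "enum_set ?U (rank_in ?U x) = x" if "x \<in> A i" for x
      using enum_rank_in(1)[OF U(1)] flag_mono[OF A \<open>i \<le> k\<close> order_refl] that by blast
    then show ?thesis by (simp add: image_comp cong: image_cong_simp)
  qed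
  have "s \<in> simplices (subdiv X) k" unfolding s_def by (rule bchain_in[OF X y A])
  then have "flag (card ?U - 1) k (nf_flag k s)" using normal_form(2)[OF X] nf(1) by metis
  then have "\<Psi> (nf_dim k s) (nf_top k s) (nf_flag k s) = \<Psi> n y (\<lambda>i. enum_set ?U ` nf_flag k s i)"
    unfolding nf(1,2) by (rule inv[OF e])
  also have "\<dots> = \<Psi> n y A" by (rule cong) (simp add: nf(3) er)
  finally show ?thesis .
qed

section \<open>Homotopies\<close>

lemma sset_prod_simps[simp]:
  "simplices (sset_prod X Y) n = simplices X n \<times> simplices Y n"
  "act (sset_prod X Y) m n \<theta> (x, y) = (act X m n \<theta> x, act Y m n \<theta> y)"
  by (simp_all add: sset_prod_def)

definition hend :: "'a sset \<Rightarrow> (nat \<Rightarrow> (nat \<Rightarrow> nat) \<times> 'a \<Rightarrow> 'k) \<Rightarrow> nat \<Rightarrow> nat \<Rightarrow> 'a \<Rightarrow> 'k" where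
  "hend Y H i = (\<lambda>n. restrict (\<lambda>x. H n (const_simplex n i, x)) (simplices Y n))"

lemma hend_hom:
  assumes Y: "simplicial_set Y" and H: "H \<in> sset_hom (sset_prod (std_simplex 1) Y) K" and i: "i \<le> 1"
  shows "hend Y H i \<in> sset_hom Y K"
  unfolding hend_def
proof (rule hom_restrictI[OF Y])
  show "H n (const_simplex n i, x) \<in> simplices K n" if "x \<in> simplices Y n" for n x
    using hom_in[OF H, of "(const_simplex n i, x)" n] const_simplex_ord[OF i] that by simp
  show "H m (const_simplex m i, act Y m n \<theta> x) = act K m n \<theta> (H n (const_simplex n i, x))"
    if "\<theta> \<in> ord_maps m n" "x \<in> simplices Y n" for m n \<theta> x
    using hom_act[OF H that(1), of "(const_simplex n i, x)"] const_simplex_ord[OF i] const_simplex_compose[OF that(1)] that(2)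
    by simp
qed

lemma hend_elementary:
  assumes "simplicial_set Y" "H \<in> sset_hom (sset_prod (std_simplex 1) Y) K"
  shows "elementary_homotopic Y K (hend Y H 0) (hend Y H 1)"
  unfolding elementary_homotopic_def using hend_hom[OF assms] assms(2) by (auto simp: hend_def)

lemma elementary_homotopic_refl:
  assumes Y: "simplicial_set Y" and f: "f \<in> sset_hom Y K"
  shows "elementary_homotopic Y K f f"
proof -
  have "(\<lambda>n. restrict (\<lambda>p. f n (snd p)) (simplices (sset_prod (std_simplex 1) Y) n)) \<in> sset_hom (sset_prod (std_simplex 1) Y) K"
    by (rule hom_restrictI[OF simplicial_set_prod[OF simplicial_set_std_simplex Y]])
       (use hom_in[OF f] hom_act[OF f] in auto)
  then show ?thesis
    unfolding elementary_homotopic_def using f const_simplex_ord by (intro conjI bexI) auto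
qed

lemma sset_homotopic_refl: "f \<in> sset_hom X Y \<Longrightarrow> sset_homotopic X Y f f"
  by (simp add: sset_homotopic_def)

lemma sset_homotopic_sym: "sset_homotopic X Y f g \<Longrightarrow> sset_homotopic X Y g f"
  by (simp add: sset_homotopic_def equivclp_sym)

lemma sset_homotopic_trans: "sset_homotopic X Y f g \<Longrightarrow> sset_homotopic X Y g h \<Longrightarrow> sset_homotopic X Y f h"
  unfolding sset_homotopic_def by (meson equivclp_trans)

lemma elementary_sset_homotopic: "elementary_homotopic X Y f g \<Longrightarrow> sset_homotopic X Y f g"
  by (simp add: sset_homotopic_def elementary_homotopic_def r_into_equivclp)

lemma sset_comp_apply: "x \<in> simplices X n \<Longrightarrow> sset_comp X g f n x = g n (f n x)"
  by (simp add: sset_comp_def compose_def)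

section \<open>The last vertex map\<close>

definition mx :: "nat \<Rightarrow> (nat \<Rightarrow> nat set) \<Rightarrow> nat \<Rightarrow> nat" where
  "mx k A = (\<lambda>i\<in>{..k}. Max (A i))"

lemma mx_ord:
  assumes A: "flag n k A"
  shows "mx k A \<in> ord_maps k n"
proof (rule ord_mapsI)
  show "mx k A i \<le> n" if "i \<le> k" for i
    using flagD[OF A that] Max_in[of "A i"] that by (auto simp: mx_def)
  show "mx k A i \<le> mx k A j" if "i \<le> j" "j \<le> k" for i j
    using Max_mono[OF flag_mono[OF A that]] flagD[OF A, of i] flagD[OF A, of j] that by (simp add: mx_def)
qed (simp add: mx_def)

lemma Max_ord_image:
  assumes "\<alpha> \<in> ord_maps m n" "B \<noteq> {}" "B \<subseteq> {..m}"
  shows "Max (\<alpha> ` B) = \<alpha> (Max B)"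
proof -
  have f: "finite B" using assms(3) finite_subset by blast
  have "b \<le> m" if "b \<in> B" for b using assms(3) that by auto
  moreover have "Max B \<in> B" using f assms(2) by simp
  ultimately have "\<alpha> b \<le> \<alpha> (Max B)" if "b \<in> B" for b
    using ord_mono[OF assms(1) Max_ge[OF f that]] by blast
  then show ?thesis using f assms(2) by (intro Max_eqI) auto
qed

lemma mx_image: "\<alpha> \<in> ord_maps m n \<Longrightarrow> flag m k B \<Longrightarrow> mx k (\<lambda>i. \<alpha> ` B i) = compose {..k} \<alpha> (mx k B)"
  by (auto simp: mx_def compose_def Max_ord_image flagD)

lemma mx_compose: "\<theta> \<in> ord_maps m k \<Longrightarrow> mx m (\<lambda>i. A (\<theta> i)) = compose {..m} (mx k A) \<theta>"
  by (auto simp: mx_def compose_def ord_le)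

lemma mx_cong: "(\<And>i. i \<le> k \<Longrightarrow> A i = B i) \<Longrightarrow> mx k A = mx k B"
  by (auto simp: mx_def)

text \<open>In the normal form this is the classical last vertex map: a flag goes to the sequence of
  the maxima of its faces, which then acts on the last simplex.\<close>

definition last_vertex :: "'a sset \<Rightarrow> nat \<Rightarrow> (nat \<Rightarrow> 'a simplex_obj) \<times> (nat \<times> nat \<Rightarrow> nat \<Rightarrow> nat) \<Rightarrow> 'a" where
  "last_vertex X = (\<lambda>k. restrict (\<lambda>s. act X k (nf_dim k s) (mx k (nf_flag k s)) (nf_top k s)) (simplices (subdiv X) k))"

lemma last_vertex_bchain:
  assumes X: "simplicial_set X" and y: "y \<in> simplices X n" and A: "flag n k A"
  shows "last_vertex X k (bchain X n y k A) = act X k n (mx k A) y"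
proof -
  let ?s = "bchain X n y k A"
  have "(\<lambda>m z B. act X k m (mx k B) z) (nf_dim k ?s) (nf_top k ?s) (nf_flag k ?s) = act X k n (mx k A) y"
  proof (rule normal_form_invariant[OF X y A])
    fix m \<alpha> B assume a: "\<alpha> \<in> inj_maps m n" "flag m k B"
    then show "act X k m (mx k B) (act X m n \<alpha> y) = act X k n (mx k (\<lambda>i. \<alpha> ` B i)) y"
      using act_comp[OF X mx_ord[OF a(2)] inj_maps_ord[OF a(1)] y] mx_image[OF inj_maps_ord[OF a(1)] a(2)] by simp
  next
    show "act X k m (mx k B) z = act X k m (mx k B') z" if "\<And>i. i \<le> k \<Longrightarrow> B i = B' i" for m z B B'
      using mx_cong[OF that] by simp
  qed
  then show ?thesis using bchain_in[OF X y A] by (simp add: last_vertex_def)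
qed

lemma subdiv_cases:
  assumes "simplicial_set X" "s \<in> simplices (subdiv X) k"
  obtains n y A where "y \<in> simplices X n" "flag n k A" "s = bchain X n y k A"
  using normal_form[OF assms] by metis

lemma last_vertex_hom:
  assumes X: "simplicial_set X"
  shows "last_vertex X \<in> sset_hom (subdiv X) X"
proof -
  have "(\<lambda>k. restrict (last_vertex X k) (simplices (subdiv X) k)) \<in> sset_hom (subdiv X) X"
  proof (rule hom_restrictI[OF simplicial_set_subdiv[OF X]])
    fix k s assume s: "s \<in> simplices (subdiv X) k"
    obtain n y A where y: "y \<in> simplices X n" "flag n k A" "s = bchain X n y k A"
      using subdiv_cases[OF X s] .
    show "last_vertex X k s \<in> simplices X k"
      using last_vertex_bchain[OF X y(1,2)] act_closed[OF X mx_ord[OF y(2)] y(1)] y(3) by simp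
    show "last_vertex X m (act (subdiv X) m k \<theta> s) = act X m k \<theta> (last_vertex X k s)" if \<theta>: "\<theta> \<in> ord_maps m k" for m \<theta>
      using last_vertex_bchain[OF X y(1,2)] last_vertex_bchain[OF X y(1) flag_compose[OF y(2) \<theta>]]
        act_comp[OF X \<theta> mx_ord[OF y(2)] y(1)] by (simp add: y(3) bchain_act[OF \<theta>] mx_compose[OF \<theta>])
  qed
  then show ?thesis by (simp add: last_vertex_def restrict_def cong: if_cong)
qed

text \<open>A simplex of the subdivision has many presentations as a flag in a simplex. A formula in
  the presentation descends once it does not change when the ambient simplex is replaced by a larger
  one that has it as a face.\<close>

lemma descend_homotopy:
  fixes \<Psi> :: "nat \<Rightarrow> (nat \<Rightarrow> nat) \<Rightarrow> nat \<Rightarrow> 'a \<Rightarrow> (nat \<Rightarrow> nat set) \<Rightarrow> 'k"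
  assumes X: "simplicial_set X"
    and \<Psi>_in: "\<And>k t n y A. t \<in> ord_maps k 1 \<Longrightarrow> y \<in> simplices X n \<Longrightarrow> flag n k A \<Longrightarrow> \<Psi> k t n y A \<in> simplices K k"
    and \<Psi>_act: "\<And>m k \<theta> t n y A. \<theta> \<in> ord_maps m k \<Longrightarrow> t \<in> ord_maps k 1 \<Longrightarrow> y \<in> simplices X n \<Longrightarrow> flag n k A \<Longrightarrow>
      \<Psi> m (compose {..m} t \<theta>) n y (\<lambda>i. A (\<theta> i)) = act K m k \<theta> (\<Psi> k t n y A)"
    and \<Psi>_inv: "\<And>m n \<alpha> k t y B. \<alpha> \<in> inj_maps m n \<Longrightarrow> t \<in> ord_maps k 1 \<Longrightarrow> y \<in> simplices X n \<Longrightarrow> flag m k B \<Longrightarrow>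
      \<Psi> k t m (act X m n \<alpha> y) B = \<Psi> k t n y (\<lambda>i. \<alpha> ` B i)"
    and \<Psi>_cong: "\<And>k t m z B B'. (\<And>i. i \<le> k \<Longrightarrow> B i = B' i) \<Longrightarrow> \<Psi> k t m z B = \<Psi> k t m z B'"
  shows "\<exists>H\<in>sset_hom (sset_prod (std_simplex 1) (subdiv X)) K.
    \<forall>k. \<forall>t\<in>ord_maps k 1. \<forall>n. \<forall>y\<in>simplices X n. \<forall>A. flag n k A \<longrightarrow> H k (t, bchain X n y k A) = \<Psi> k t n y A"
proof -
  define H where "H k p = \<Psi> k (fst p) (nf_dim k (snd p)) (nf_top k (snd p)) (nf_flag k (snd p))" for k p
  have H: "H k (t, bchain X n y k A) = \<Psi> k t n y A" if "t \<in> ord_maps k 1" "y \<in> simplices X n" "flag n k A" for k t n y A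
    unfolding H_def fst_conv snd_conv
    by (rule normal_form_invariant[OF X that(2,3) \<Psi>_inv[OF _ that(1,2)] \<Psi>_cong])
  let ?P = "sset_prod (std_simplex 1) (subdiv X)"
  have hom: "(\<lambda>k. restrict (H k) (simplices ?P k)) \<in> sset_hom ?P K"
  proof (rule hom_restrictI[OF simplicial_set_prod[OF simplicial_set_std_simplex simplicial_set_subdiv[OF X]]])
    fix k p assume "p \<in> simplices ?P k"
    then obtain t s where p: "p = (t, s)" "t \<in> ord_maps k 1" "s \<in> simplices (subdiv X) k" by auto
    obtain n y A where y: "y \<in> simplices X n" "flag n k A" "s = bchain X n y k A"
      using subdiv_cases[OF X p(3)] .
    show "H k p \<in> simplices K k" using H[OF p(2) y(1,2)] \<Psi>_in[OF p(2) y(1,2)] by (simp add: p(1) y(3))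
    show "H m (act ?P m k \<theta> p) = act K m k \<theta> (H k p)" if \<theta>: "\<theta> \<in> ord_maps m k" for m \<theta>
      using H[OF p(2) y(1,2)] H[OF ord_maps_comp[OF \<theta> p(2)] y(1) flag_compose[OF y(2) \<theta>]] \<Psi>_act[OF \<theta> p(2) y(1,2)]
      by (simp add: p(1) y(3) bchain_act[OF \<theta>])
  qed
  have ev: "restrict (H k) (simplices ?P k) (t, bchain X n y k A) = \<Psi> k t n y A"
    if "t \<in> ord_maps k 1" "y \<in> simplices X n" "flag n k A" for k t n y A
    using H[OF that] bchain_in[OF X that(2,3)] that(1) by simp
  show ?thesis by (intro bexI[OF _ hom] allI ballI impI) (rule ev)
qed

section \<open>Maps on the subdivision and their resolutions\<close>

text \<open>Chains in the base of the cylinder are flags written with \<open>Inr\<close>, so a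
  formula for flags becomes a function of such chains.\<close>

definition flag_family :: "(nat \<Rightarrow> 'a \<Rightarrow> nat \<Rightarrow> (nat \<Rightarrow> nat set) \<Rightarrow> 'k) \<Rightarrow>
    nat \<Rightarrow> 'a \<Rightarrow> nat \<Rightarrow> (nat \<Rightarrow> nat + nat set) \<Rightarrow> 'k" where
  "flag_family D = (\<lambda>n y j. \<lambda>c\<in>cyl.bseqs n j. D n y j (\<lambda>i. jsupp (c i)))"

lemma jsupp_shift: "i \<le> j \<Longrightarrow> jsupp (cyl.shift \<alpha> j c i) = \<alpha> ` jsupp (c i)"
  by (simp add: cyl.shift_def cyl.mp_sp)

lemma bary_flag_family:
  fixes D :: "nat \<Rightarrow> 'a \<Rightarrow> nat \<Rightarrow> (nat \<Rightarrow> nat set) \<Rightarrow> 'k"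
  assumes D_in: "\<And>n y j A. y \<in> simplices X n \<Longrightarrow> flag n j A \<Longrightarrow> D n y j A \<in> simplices K j"
    and D_act: "\<And>n y i j \<theta> A. \<theta> \<in> ord_maps i j \<Longrightarrow> y \<in> simplices X n \<Longrightarrow> flag n j A \<Longrightarrow>
      D n y i (\<lambda>l. A (\<theta> l)) = act K i j \<theta> (D n y j A)"
    and D_inv: "\<And>k n \<alpha> y j B. \<alpha> \<in> inj_maps k n \<Longrightarrow> y \<in> simplices X n \<Longrightarrow> flag k j B \<Longrightarrow>
      D k (act X k n \<alpha> y) j B = D n y j (\<lambda>i. \<alpha> ` B i)"
    and D_cong: "\<And>n y j B B'. (\<And>i. i \<le> j \<Longrightarrow> B i = B' i) \<Longrightarrow> D n y j B = D n y j B'"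
  shows "bary_family X K (flag_family D)"
  unfolding bary_family_def
proof (intro conjI allI ballI)
  fix n y assume y: "y \<in> simplices X n"
  have "(\<lambda>j. restrict (\<lambda>c. D n y j (\<lambda>i. jsupp (c i))) (cyl.bseqs n j)) \<in> sset_hom (cplx jle (cyl.blev n)) K"
  proof (rule hom_restrictI[OF simplicial_set_cplx[OF cyl.blev_closed]])
    show "D n y j (\<lambda>i. jsupp (c i)) \<in> simplices K j" if "c \<in> cyl.bseqs n j" for j c
      by (rule D_in[OF y blev_fseq(1)[OF that]])
    show "D n y i (\<lambda>l. jsupp (act (cplx jle (cyl.blev n)) i j \<theta> c l)) = act K i j \<theta> (D n y j (\<lambda>i. jsupp (c i)))"
      if "\<theta> \<in> ord_maps i j" "c \<in> cyl.bseqs n j" for i j \<theta> c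
    proof -
      have "D n y i (\<lambda>l. jsupp (act (cplx jle (cyl.blev n)) i j \<theta> c l)) = D n y i (\<lambda>l. jsupp (c (\<theta> l)))"
        by (rule D_cong) (simp add: compose_def)
      also have "\<dots> = act K i j \<theta> (D n y j (\<lambda>i. jsupp (c i)))"
        by (rule D_act[OF that(1) y blev_fseq(1)[OF that(2)]])
      finally show ?thesis .
    qed
  qed
  then show "flag_family D n y \<in> sset_hom (cplx jle (cyl.blev n)) K" by (simp add: flag_family_def)
  show "flag_family D k (act X k n \<alpha> y) j c = flag_family D n y j (cyl.shift \<alpha> j c)"
    if "\<alpha> \<in> inj_maps k n" "c \<in> cyl.bseqs k j" for k \<alpha> j c
  proof -
    have "D n y j (\<lambda>i. \<alpha> ` jsupp (c i)) = D n y j (\<lambda>i. jsupp (cyl.shift \<alpha> j c i))"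
      by (rule D_cong) (simp add: jsupp_shift)
    then show ?thesis
      using D_inv[OF that(1) y blev_fseq(1)[OF that(2)]] that(2) cyl.shift_blev[OF that(2,1)]
      by (simp add: flag_family_def)
  qed
qed

definition subdiv_family :: "'a sset \<Rightarrow> (nat \<Rightarrow> (nat \<Rightarrow> 'a simplex_obj) \<times> (nat \<times> nat \<Rightarrow> nat \<Rightarrow> nat) \<Rightarrow> 'k) \<Rightarrow>
    nat \<Rightarrow> 'a \<Rightarrow> nat \<Rightarrow> (nat \<Rightarrow> nat + nat set) \<Rightarrow> 'k" where
  "subdiv_family X g = flag_family (\<lambda>n y j A. g j (bchain X n y j A))"

lemma subdiv_family_bary:
  assumes X: "simplicial_set X" and g: "g \<in> sset_hom (subdiv X) K"
  shows "bary_family X K (subdiv_family X g)"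
  unfolding subdiv_family_def
proof (rule bary_flag_family)
  show "g j (bchain X n y j A) \<in> simplices K j" if "y \<in> simplices X n" "flag n j A" for n y j A
    by (rule hom_in[OF g bchain_in[OF X that]])
  show "g i (bchain X n y i (\<lambda>l. A (\<theta> l))) = act K i j \<theta> (g j (bchain X n y j A))"
    if "\<theta> \<in> ord_maps i j" "y \<in> simplices X n" "flag n j A" for n y i j \<theta> A
    using hom_act[OF g that(1) bchain_in[OF X that(2,3)]] by (simp add: bchain_act[OF that(1)])
  show "g j (bchain X k (act X k n \<alpha> y) j B) = g j (bchain X n y j (\<lambda>i. \<alpha> ` B i))"
    if "\<alpha> \<in> inj_maps k n" "y \<in> simplices X n" "flag k j B" for k n \<alpha> y j B
    using bchain_nat[OF X that(2,1,3)] by simp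
  show "g j (bchain X n y j B) = g j (bchain X n y j B')" if "\<And>i. i \<le> j \<Longrightarrow> B i = B' i" for n y j B B'
    using bchain_cong[of j B B' X n y] that by simp
qed

text \<open>A path through the mapping cylinder: at type 0 the last vertices, at type 1 the flag
  itself. It is a chain because \<open>Max (A i)\<close> belongs to every later face.\<close>

definition cseq :: "nat \<Rightarrow> (nat \<Rightarrow> nat) \<Rightarrow> (nat \<Rightarrow> nat set) \<Rightarrow> nat \<Rightarrow> nat + nat set" where
  "cseq k t A = (\<lambda>i\<in>{..k}. if t i = 0 then Inl (Max (A i)) else Inr (A i))"

lemma cseq_in:
  assumes A: "flag n k A" and t: "t \<in> ord_maps k 1"
  shows "cseq k t A \<in> cyl.seqs n k"
proof (rule cyl_seqI)
  have mxA: "Max (A i) \<in> A i" if "i \<le> k" for i using flagD[OF A that] by simp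
  show "jsupp (cseq k t A i) \<noteq> {}" "jsupp (cseq k t A i) \<subseteq> {..n}" if "i \<le> k" for i
    using flagD[OF A that] mxA[OF that] that by (auto simp: cseq_def)
  show "jle (cseq k t A i) (cseq k t A i')" if "i \<le> i'" "i' \<le> k" for i i'
    using ord_mono[OF t that] ord_mono[OF mx_ord[OF A] that] flag_mono[OF A that] mxA[of i] that
    by (auto simp: cseq_def mx_def)
qed (simp add: cseq_def)

text \<open>The path over the sequence of last vertices from height 0 to height 1 of the
  prism.\<close>

definition pseq :: "nat \<Rightarrow> (nat \<Rightarrow> nat) \<Rightarrow> (nat \<Rightarrow> nat set) \<Rightarrow> nat \<Rightarrow> nat \<times> nat" where
  "pseq k t A = (\<lambda>i\<in>{..k}. (Max (A i), t i))"

lemma pseq_in: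
  assumes A: "flag n k A" and t: "t \<in> ord_maps k 1"
  shows "pseq k t A \<in> prism.seqs n k"
  using ord_le[OF mx_ord[OF A]] ord_mono[OF mx_ord[OF A]] ord_le[OF t] ord_mono[OF t]
  by (intro prism_seqI) (auto simp: pseq_def mx_def)

text \<open>The cylinders give a homotopy \<open>H1\<close> between the last vertices and
  \<open>g\<close>, the prisms a homotopy \<open>H2\<close> from the last vertices to the end map.
  They meet in the map that lets the maxima of a flag act on \<open>vert \<psi> n y\<close>. This
  map is simplicial on the subdivision although \<open>vert \<psi>\<close> is only semisimplicial,
  because presentations differ by injective operators only.\<close>

theorem resolved_homotopic:
  fixes X :: "'a sset" and K :: "'k sset"
  assumes X: "simplicial_set X" and K: "simplicial_set K" and g: "g \<in> sset_hom (subdiv X) K"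
    and r: "resolves X K (simplices X) (subdiv_family X g) \<psi> h"
  shows "sset_homotopic (subdiv X) K g (sset_comp (subdiv X) (end_map X h) (last_vertex X))"
proof -
  have \<psi>: "cyl_family X K (simplices X) (subdiv_family X g) \<psi>"
    and h: "straightens X K (simplices X) (vert \<psi>) h" using r by (simp_all add: resolves_def)
  have SX: "subcomplex X (simplices X)" by (simp add: subcomplex_def act_closed[OF X])
  interpret st: straightening X K "simplices X" "vert \<psi>" h
    by unfold_locales (use X K SX semisimplicial_vert[OF \<psi>] h in auto)
  note sub = simplicial_set_subdiv[OF X]
  have "\<exists>H\<in>sset_hom (sset_prod (std_simplex 1) (subdiv X)) K. \<forall>k. \<forall>t\<in>ord_maps k 1. \<forall>n. \<forall>y\<in>simplices X n. \<forall>A.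
    flag n k A \<longrightarrow> H k (t, bchain X n y k A) = \<psi> n y k (cseq k t A)"
  proof (rule descend_homotopy[OF X])
    show "\<psi> n y k (cseq k t A) \<in> simplices K k" if "t \<in> ord_maps k 1" "y \<in> simplices X n" "flag n k A" for k t n y A
      by (rule hom_in[OF cyl_family_hom[OF \<psi> that(2)] cseq_in[OF that(3,1)]])
    show "\<psi> n y m (cseq m (compose {..m} t \<theta>) (\<lambda>i. A (\<theta> i))) = act K m k \<theta> (\<psi> n y k (cseq k t A))"
      if "\<theta> \<in> ord_maps m k" "t \<in> ord_maps k 1" "y \<in> simplices X n" "flag n k A" for m k \<theta> t n y A
    proof -
      have "cseq m (compose {..m} t \<theta>) (\<lambda>i. A (\<theta> i)) = compose {..m} (cseq k t A) \<theta>"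
        using ord_le[OF that(1)] by (auto simp: cseq_def compose_def)
      then show ?thesis using hom_act[OF cyl_family_hom[OF \<psi> that(3)] that(1) cseq_in[OF that(4,2)]] by simp
    qed
    show "\<psi> m (act X m n \<alpha> y) k (cseq k t B) = \<psi> n y k (cseq k t (\<lambda>i. \<alpha> ` B i))"
      if "\<alpha> \<in> inj_maps m n" "t \<in> ord_maps k 1" "y \<in> simplices X n" "flag m k B" for m n \<alpha> k t y B
    proof -
      have "cyl.shift \<alpha> k (cseq k t B) = cseq k t (\<lambda>i. \<alpha> ` B i)"
        using Max_ord_image[OF inj_maps_ord[OF that(1)]] flagD[OF that(4)]
        by (auto simp: cyl.shift_def cseq_def jmap_def)
      then show ?thesis using cyl_family_nat[OF \<psi> that(3,1) cseq_in[OF that(4,2)]] by simp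
    qed
    show "\<psi> m z k (cseq k t B) = \<psi> m z k (cseq k t B')" if "\<And>i. i \<le> k \<Longrightarrow> B i = B' i" for k t m z B B'
    proof -
      have "cseq k t B = cseq k t B'" using that by (auto simp: cseq_def)
      then show ?thesis by simp
    qed
  qed
  then obtain H1 where H1: "H1 \<in> sset_hom (sset_prod (std_simplex 1) (subdiv X)) K"
    "\<And>k t n y A. t \<in> ord_maps k 1 \<Longrightarrow> y \<in> simplices X n \<Longrightarrow> flag n k A \<Longrightarrow> H1 k (t, bchain X n y k A) = \<psi> n y k (cseq k t A)"
    by blast
  have c1: "compose {..m} (const_simplex n 1) \<alpha> = const_simplex m 1" if "\<alpha> \<in> ord_maps m n" for m n \<alpha>
    using const_simplex_compose[OF that] .
  \<comment> \<open>The straightening is now given on all of \<open>X\<close>, so every type is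
    allowed. Type constantly 1 selects the prism from \<open>vert \<psi>\<close> to the end
    map.\<close>
  have bw: "(y, const_simplex n 1) \<in> st.bwords n" if "y \<in> simplices X n" for n y
    using that const_simplex_ord by (simp add: st.bwords_def)
  have "\<exists>H\<in>sset_hom (sset_prod (std_simplex 1) (subdiv X)) K. \<forall>k. \<forall>t\<in>ord_maps k 1. \<forall>n. \<forall>y\<in>simplices X n. \<forall>A.
    flag n k A \<longrightarrow> H k (t, bchain X n y k A) = st.bdry n (y, const_simplex n 1) k (pseq k t A)"
  proof (rule descend_homotopy[OF X])
    show "st.bdry n (y, const_simplex n 1) k (pseq k t A) \<in> simplices K k"
      if "t \<in> ord_maps k 1" "y \<in> simplices X n" "flag n k A" for k t n y A
      by (rule hom_in[OF st.bdry_hom[OF bw[OF that(2)]] pseq_in[OF that(3,1)]])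
    show "st.bdry n (y, const_simplex n 1) m (pseq m (compose {..m} t \<theta>) (\<lambda>i. A (\<theta> i))) =
        act K m k \<theta> (st.bdry n (y, const_simplex n 1) k (pseq k t A))"
      if "\<theta> \<in> ord_maps m k" "t \<in> ord_maps k 1" "y \<in> simplices X n" "flag n k A" for m k \<theta> t n y A
    proof -
      have "pseq m (compose {..m} t \<theta>) (\<lambda>i. A (\<theta> i)) = compose {..m} (pseq k t A) \<theta>"
        using ord_le[OF that(1)] by (auto simp: pseq_def compose_def)
      then show ?thesis using hom_act[OF st.bdry_hom[OF bw[OF that(3)]] that(1) pseq_in[OF that(4,2)]] by simp
    qed
    show "st.bdry m (act X m n \<alpha> y, const_simplex m 1) k (pseq k t B) = st.bdry n (y, const_simplex n 1) k (pseq k t (\<lambda>i. \<alpha> ` B i))"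
      if "\<alpha> \<in> inj_maps m n" "t \<in> ord_maps k 1" "y \<in> simplices X n" "flag m k B" for m n \<alpha> k t y B
    proof -
      have "prism.shift \<alpha> k (pseq k t B) = pseq k t (\<lambda>i. \<alpha> ` B i)"
        using Max_ord_image[OF inj_maps_ord[OF that(1)]] flagD[OF that(4)]
        by (auto simp: prism.shift_def pseq_def pmap_def)
      then show ?thesis
        using st.bdry_nat[OF that(1) bw[OF that(3)] pseq_in[OF that(4,2)]] c1[OF inj_maps_ord[OF that(1)]] by simp
    qed
    show "st.bdry m (z, const_simplex m 1) k (pseq k t B) = st.bdry m (z, const_simplex m 1) k (pseq k t B')"
      if "\<And>i. i \<le> k \<Longrightarrow> B i = B' i" for k t m z B B'
    proof -
      have "pseq k t B = pseq k t B'" using that by (auto simp: pseq_def)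
      then show ?thesis by simp
    qed
  qed
  then obtain H2 where H2: "H2 \<in> sset_hom (sset_prod (std_simplex 1) (subdiv X)) K"
    "\<And>k t n y A. t \<in> ord_maps k 1 \<Longrightarrow> y \<in> simplices X n \<Longrightarrow> flag n k A \<Longrightarrow>
      H2 k (t, bchain X n y k A) = st.bdry n (y, const_simplex n 1) k (pseq k t A)"
    by blast
  have t01: "const_simplex k 0 \<in> ord_maps k 1" "const_simplex k 1 \<in> ord_maps k 1" for k
    by (simp_all add: const_simplex_ord)
  note ends = hend_hom[OF sub H1(1)] hend_hom[OF sub H2(1)]
  note comp = sset_comp_hom[OF sub last_vertex_hom[OF X] end_map_hom[OF X h]]
  have e1: "hend (subdiv X) H1 1 = g"
  proof (rule hom_eqI[OF ends(1) g])
    fix k s assume s: "s \<in> simplices (subdiv X) k"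
    obtain n y A where y: "y \<in> simplices X n" "flag n k A" "s = bchain X n y k A" using subdiv_cases[OF X s] .
    have "cseq k (const_simplex k 1) A = fseq k A" by (auto simp: cseq_def fseq_def const_simplex_def)
    moreover have "g k (bchain X n y k (\<lambda>i. jsupp (fseq k A i))) = g k (bchain X n y k A)"
      by (rule arg_cong[OF bchain_cong]) (simp add: fseq_def)
    ultimately show "hend (subdiv X) H1 1 k s = g k s"
      using s H1(2)[OF t01(2) y(1,2)] cyl_family_base[OF \<psi> y(1) fseq_in[OF y(2)]] fseq_in[OF y(2)]
      by (simp add: hend_def y(3) subdiv_family_def flag_family_def)
  qed simp
  have e2: "hend (subdiv X) H1 0 = hend (subdiv X) H2 0"
  proof (rule hom_eqI[OF ends])
    fix k s assume s: "s \<in> simplices (subdiv X) k"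
    obtain n y A where y: "y \<in> simplices X n" "flag n k A" "s = bchain X n y k A" using subdiv_cases[OF X s] .
    have "cseq k (const_simplex k 0) A = compose {..k} (vseq n) (mx k A)"
      using ord_le[OF mx_ord[OF y(2)]] by (auto simp: cseq_def const_simplex_def vseq_def compose_def mx_def)
    then have 1: "\<psi> n y k (cseq k (const_simplex k 0) A) = act K k n (mx k A) (vert \<psi> n y)"
      using hom_act[OF cyl_family_hom[OF \<psi> y(1)] mx_ord[OF y(2)] vseq_in] by (simp add: vert_def)
    have "proj k (pseq k (const_simplex k 0) A) = mx k A" by (auto simp: proj_def pseq_def mx_def)
    moreover have "side (const_simplex n 1) (pseq k (const_simplex k 0) A) i = 0" if "i \<le> k" for i
      using that by (simp add: side_def pseq_def const_simplex_def)
    ultimately have "st.bdry n (y, const_simplex n 1) k (pseq k (const_simplex k 0) A) = act K k n (mx k A) (vert \<psi> n y)"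
      using st.bdry_zero[OF pseq_in[OF y(2) t01(1)]] by simp
    then show "hend (subdiv X) H1 0 k s = hend (subdiv X) H2 0 k s"
      using s H1(2)[OF t01(1) y(1,2)] H2(2)[OF t01(1) y(1,2)] 1 by (simp add: hend_def y(3))
  qed simp_all
  have e3: "hend (subdiv X) H2 1 = sset_comp (subdiv X) (end_map X h) (last_vertex X)"
  proof (rule hom_eqI[OF ends(2) comp])
    fix k s assume s: "s \<in> simplices (subdiv X) k"
    obtain n y A where y: "y \<in> simplices X n" "flag n k A" "s = bchain X n y k A" using subdiv_cases[OF X s] .
    note mo = mx_ord[OF y(2)]
    have "pseq k (const_simplex k 1) A = compose {..k} (st.topseq n) (mx k A)"
      using ord_le[OF mo] by (auto simp: pseq_def const_simplex_def st.topseq_def compose_def mx_def)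
    then have "st.bdry n (y, const_simplex n 1) k (pseq k (const_simplex k 1) A) = act K k n (mx k A) (h n y (const_simplex n 1))"
      using hom_act[OF st.bdry_hom[OF bw[OF y(1)]] mo st.topseq_in] st.bdry_top[OF y(1) t01(2)] by simp
    also have "\<dots> = end_map X h k (act X k n (mx k A) y)"
      using hom_act[OF end_map_hom[OF X h] mo y(1)] y(1) by (simp add: end_map_def)
    finally show "hend (subdiv X) H2 1 k s = sset_comp (subdiv X) (end_map X h) (last_vertex X) k s"
      using s H2(2)[OF t01(2) y(1,2)] last_vertex_bchain[OF X y(1,2)] by (simp add: hend_def y(3) sset_comp_apply)
  qed simp
  have "sset_homotopic (subdiv X) K (hend (subdiv X) H1 0) g"
    using elementary_sset_homotopic[OF hend_elementary[OF sub H1(1)]] e1 by simp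
  moreover have "sset_homotopic (subdiv X) K (hend (subdiv X) H1 0) (sset_comp (subdiv X) (end_map X h) (last_vertex X))"
    using elementary_sset_homotopic[OF hend_elementary[OF sub H2(1)]] e2 e3 by simp
  ultimately show ?thesis by (blast intro: sset_homotopic_sym sset_homotopic_trans)
qed

section \<open>Resolution as a relation between maps\<close>

text \<open>A relation and not a function, since a resolution depends on choices of fillers; its
  single-valuedness up to homotopy is a consequence of \<open>resolved_by_homotopic\<close> for a
  constant homotopy.\<close>

definition resolved_by :: "'a sset \<Rightarrow> 'k sset \<Rightarrow> (nat \<Rightarrow> (nat \<Rightarrow> 'a simplex_obj) \<times> (nat \<times> nat \<Rightarrow> nat \<Rightarrow> nat) \<Rightarrow> 'k) \<Rightarrow>
    (nat \<Rightarrow> 'a \<Rightarrow> 'k) \<Rightarrow> bool" where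
  "resolved_by X K g f \<longleftrightarrow> (\<exists>\<psi> h. resolves X K (simplices X) (subdiv_family X g) \<psi> h \<and> f = end_map X h)"

lemma resolved_by_hom: "simplicial_set X \<Longrightarrow> resolved_by X K g f \<Longrightarrow> f \<in> sset_hom X K"
  unfolding resolved_by_def resolves_def using end_map_hom by blast

lemma resolved_by_exists:
  assumes X: "simplicial_set X" and K: "kan_complex K" and g: "g \<in> sset_hom (subdiv X) K"
  obtains f where "resolved_by X K g f"
proof -
  \<comment> \<open>The absolute case is relative to the empty subcomplex, over which
    \<open>undefined\<close> meets all requirements vacuously.\<close>
  have "subcomplex X (\<lambda>n. {})" by (simp add: subcomplex_def)
  moreover have "resolves X K (\<lambda>n. {}) (subdiv_family X g) undefined undefined"
    by (simp add: resolves_def cyl_family_def straightens_def)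
  ultimately obtain \<psi> h where "resolves X K (simplices X) (subdiv_family X g) \<psi> h"
    using resolution_exists[OF X K _ subdiv_family_bary[OF X g]] by blast
  then show ?thesis using that unfolding resolved_by_def by blast
qed

text \<open>Sending each node to the largest vertex of its support retracts the cylinder onto the
  simplex and restricts to the last vertex map on the base.\<close>

lemma Max_jsupp_ord:
  assumes c: "c \<in> cyl.seqs n j"
  shows "(\<lambda>i\<in>{..j}. Max (jsupp (c i))) \<in> ord_maps j n"
proof (rule ord_mapsI)
  note D = cyl_seqD[OF c]
  have f: "finite (jsupp (c i))" if "i \<le> j" for i using D(3)[OF that] finite_subset by blast
  have m: "Max (jsupp (c i)) \<in> jsupp (c i)" if "i \<le> j" for i using f D(2) that by simp
  show "(\<lambda>i\<in>{..j}. Max (jsupp (c i))) i \<le> n" if "i \<le> j" for i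
    using m[OF that] D(3)[OF that] that by auto
  show "(\<lambda>i\<in>{..j}. Max (jsupp (c i))) i \<le> (\<lambda>i\<in>{..j}. Max (jsupp (c i))) i'" if "i \<le> i'" "i' \<le> j" for i i'
  proof -
    have i: "i \<le> j" using that by simp
    have "Max (jsupp (c i)) \<le> Max (jsupp (c i'))"
    proof (cases "c i")
      case (Inl z)
      show ?thesis
      proof (cases "c i'")
        case (Inr A)
        then show ?thesis using D(4)[OF that] \<open>c i = Inl z\<close> f[OF that(2)] by simp
      qed (use D(4)[OF that] Inl in simp)
    next
      case (Inr A)
      then have "jsupp (c i) \<subseteq> jsupp (c i')" using D(4)[OF that] by (cases "c i'") auto
      then show ?thesis using Max_mono D(2)[OF i] f[OF that(2)] by blast
    qed
    then show ?thesis using that by simp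
  qed
qed simp

text \<open>For a simplicial \<open>f\<close> both stages can be taken constant: the cylinders
  factor through the retraction by maxima, and the straightening does not depend on the
  type.\<close>

lemma resolved_by_last_vertex:
  fixes X :: "'a sset" and K :: "'k sset"
  assumes X: "simplicial_set X" and K: "simplicial_set K" and f: "f \<in> sset_hom X K"
  shows "resolved_by X K (sset_comp (subdiv X) f (last_vertex X)) f"
proof -
  define mj :: "nat \<Rightarrow> (nat \<Rightarrow> nat + nat set) \<Rightarrow> nat \<Rightarrow> nat" where "mj j c = (\<lambda>i\<in>{..j}. Max (jsupp (c i)))" for j c
  define \<psi> where "\<psi> n y j = (\<lambda>c\<in>cyl.seqs n j. act K j n (mj j c) (f n y))" for n y j
  define h :: "nat \<Rightarrow> 'a \<Rightarrow> (nat \<Rightarrow> nat) \<Rightarrow> 'k" where "h n y t = f n y" for n y t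
  have mo: "mj j c \<in> ord_maps j n" if "c \<in> cyl.seqs n j" for j n c
    unfolding mj_def by (rule Max_jsupp_ord[OF that])
  have "cyl_family X K (simplices X) (subdiv_family X (sset_comp (subdiv X) f (last_vertex X))) \<psi>"
    unfolding cyl_family_def
  proof (intro conjI allI ballI)
    fix n y assume y: "y \<in> simplices X n"
    have fy: "f n y \<in> simplices K n" by (rule hom_in[OF f y])
    have "(\<lambda>j. restrict (\<lambda>c. act K j n (mj j c) (f n y)) (cyl.seqs n j)) \<in> sset_hom (cplx jle (cyl.lev n)) K"
    proof (rule hom_restrictI[OF simplicial_set_cplx[OF cyl.lev_closed]])
      show "act K j n (mj j c) (f n y) \<in> simplices K j" if "c \<in> cyl.seqs n j" for j c
        by (rule act_closed[OF K mo[OF that] fy])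
      show "act K i n (mj i (act (cplx jle (cyl.lev n)) i j \<theta> c)) (f n y) = act K i j \<theta> (act K j n (mj j c) (f n y))"
        if "\<theta> \<in> ord_maps i j" "c \<in> cyl.seqs n j" for i j \<theta> c
      proof -
        have "mj i (compose {..i} c \<theta>) = compose {..i} (mj j c) \<theta>"
          using ord_le[OF that(1)] by (auto simp: mj_def compose_def)
        then show ?thesis using act_comp[OF K that(1) mo[OF that(2)] fy] by simp
      qed
    qed
    moreover have "\<psi> n y = (\<lambda>j. restrict (\<lambda>c. act K j n (mj j c) (f n y)) (cyl.seqs n j))"
      by (rule ext) (simp add: \<psi>_def)
    ultimately show "\<psi> n y \<in> sset_hom (cplx jle (cyl.lev n)) K" by simp
    show "\<psi> n y j c = subdiv_family X (sset_comp (subdiv X) f (last_vertex X)) n y j c"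
      if c: "c \<in> cyl.bseqs n j" for j c
    proof -
      let ?A = "\<lambda>i. jsupp (c i)"
      note A = blev_fseq(1)[OF c]
      have cl: "c \<in> cyl.seqs n j" using c by (simp add: cplx_simplex_iff cyl.blev_def)
      have "subdiv_family X (sset_comp (subdiv X) f (last_vertex X)) n y j c = f j (act X j n (mx j ?A) y)"
        using c last_vertex_bchain[OF X y A] bchain_in[OF X y A]
        by (simp add: subdiv_family_def flag_family_def sset_comp_apply)
      also have "\<dots> = act K j n (mx j ?A) (f n y)" by (rule hom_act[OF f mx_ord[OF A] y])
      finally show ?thesis using cl by (simp add: \<psi>_def mj_def mx_def)
    qed
    show "\<psi> k (act X k n \<alpha> y) j c = \<psi> n y j (cyl.shift \<alpha> j c)"
      if \<alpha>: "\<alpha> \<in> inj_maps k n" and c: "c \<in> cyl.seqs k j" for k \<alpha> j c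
    proof -
      note \<alpha>o = inj_maps_ord[OF \<alpha>]
      have "mj j (cyl.shift \<alpha> j c) = compose {..j} \<alpha> (mj j c)"
        using Max_ord_image[OF \<alpha>o] cyl_seqD(2,3)[OF c] by (auto simp: mj_def compose_def jsupp_shift)
      then show ?thesis
        using c cyl.shift_lev[OF c \<alpha>] hom_act[OF f \<alpha>o y] act_comp[OF K mo[OF c] \<alpha>o fy] by (simp add: \<psi>_def)
    qed
  qed
  moreover have "vert \<psi> n y = f n y" if y: "y \<in> simplices X n" for n y
  proof -
    have "mj n (vseq n) = restrict id {..n}" by (auto simp: mj_def vseq_def)
    then show ?thesis using vseq_in act_id[OF K hom_in[OF f y]] by (simp add: vert_def \<psi>_def)
  qed
  then have "straightens X K (simplices X) (vert \<psi>) h"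
    using hom_in[OF f] hom_act[OF f] by (intro straightensI) (auto simp: h_def)
  moreover have "f = end_map X h"
  proof (rule hom_eqI[OF f])
    show "end_map X h \<in> sset_hom X K" by (rule end_map_hom[OF X \<open>straightens X K (simplices X) (vert \<psi>) h\<close>])
  qed (simp add: end_map_def h_def)
  ultimately show ?thesis unfolding resolved_by_def resolves_def by blast
qed

text \<open>A homotopy between maps on the subdivision of \<open>X\<close> is resolved over \<open>\<Delta>\<^sup>1 \<times> X\<close>, relative to the given
  resolutions over the two ends.\<close>

lemma resolved_by_homotopic:
  fixes X :: "'a sset" and K :: "'k sset"
  assumes X: "simplicial_set X" and K: "kan_complex K" and e: "elementary_homotopic (subdiv X) K g0 g1"
    and r0: "resolved_by X K g0 f0" and r1: "resolved_by X K g1 f1"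
  shows "elementary_homotopic X K f0 f1"
proof -
  obtain \<psi>0 h0 where 0: "cyl_family X K (simplices X) (subdiv_family X g0) \<psi>0" "straightens X K (simplices X) (vert \<psi>0) h0" "f0 = end_map X h0"
    using r0 unfolding resolved_by_def resolves_def by blast
  obtain \<psi>1 h1 where 1: "cyl_family X K (simplices X) (subdiv_family X g1) \<psi>1" "straightens X K (simplices X) (vert \<psi>1) h1" "f1 = end_map X h1"
    using r1 unfolding resolved_by_def resolves_def by blast
  obtain H where H: "H \<in> sset_hom (sset_prod (std_simplex 1) (subdiv X)) K"
    and Hends: "\<And>n x. x \<in> simplices (subdiv X) n \<Longrightarrow> H n (const_simplex n 0, x) = g0 n x \<and> H n (const_simplex n 1, x) = g1 n x"
    using e unfolding elementary_homotopic_def by blast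
  let ?P = "sset_prod (std_simplex 1) X"
  have P: "simplicial_set ?P" by (rule simplicial_set_prod[OF simplicial_set_std_simplex X])
  \<comment> \<open>The pullback of \<open>H\<close> along the map from the subdivision of
    \<open>\<Delta>\<^sup>1 \<times> X\<close> to \<open>\<Delta>\<^sup>1 \<times> subdiv X\<close>
    that is the last vertex map in the first factor.\<close>
  define D :: "nat \<Rightarrow> (nat \<Rightarrow> nat) \<times> 'a \<Rightarrow> nat \<Rightarrow> (nat \<Rightarrow> nat set) \<Rightarrow> 'k" where
    "D n p j A = H j (compose {..j} (fst p) (mx j A), bchain X n (snd p) j A)" for n p j A
  have d: "bary_family ?P K (flag_family D)"
  proof (rule bary_flag_family)
    fix n p assume "p \<in> simplices ?P n"
    then have p: "fst p \<in> ord_maps n 1" "snd p \<in> simplices X n" by auto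
    have in_prod: "(compose {..j} (fst p) (mx j A), bchain X n (snd p) j A) \<in> simplices (sset_prod (std_simplex 1) (subdiv X)) j"
      if "flag n j A" for j A
      using ord_maps_comp[OF mx_ord[OF that] p(1)] bchain_in[OF X p(2) that] by simp
    show "D n p j A \<in> simplices K j" if "flag n j A" for j A
      unfolding D_def by (rule hom_in[OF H in_prod[OF that]])
    show "D n p i (\<lambda>l. A (\<theta> l)) = act K i j \<theta> (D n p j A)" if "\<theta> \<in> ord_maps i j" "flag n j A" for i j \<theta> A
      using hom_act[OF H that(1) in_prod[OF that(2)]]
      by (simp add: D_def mx_compose[OF that(1)] bchain_act[OF that(1)] compose_ord_assoc[OF that(1)])
    show "D k (act ?P k n \<alpha> p) j B = D n p j (\<lambda>i. \<alpha> ` B i)" if "\<alpha> \<in> inj_maps k n" "flag k j B" for k \<alpha> j B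
      using bchain_nat[OF X p(2) that] mx_image[OF inj_maps_ord[OF that(1)] that(2)]
      by (cases p) (simp add: D_def compose_ord_assoc[OF mx_ord[OF that(2)]])
  next
    show "D n p j B = D n p j B'" if "\<And>i. i \<le> j \<Longrightarrow> B i = B' i" for n p j B B'
      using mx_cong[of j B B'] bchain_cong[of j B B' X n "snd p"] that by (simp add: D_def)
  qed
  \<comment> \<open>The two ends of the cylinder \<open>\<Delta>\<^sup>1 \<times> X\<close>, where
    the given resolutions are kept, so that the end map of the new resolution restricts to
    \<open>f0\<close> and \<open>f1\<close>.\<close>
  define S where "S n = {const_simplex n 0, const_simplex n 1} \<times> simplices X n" for n
  have c01: "const_simplex n 0 \<noteq> const_simplex n (Suc 0)" for n by (auto simp: const_simplex_def fun_eq_iff)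
  have S: "subcomplex ?P S"
    using const_simplex_ord const_simplex_compose act_closed[OF X] by (auto simp: subcomplex_def S_def)
  define \<psi> where "\<psi> n p = (if fst p = const_simplex n 0 then \<psi>0 n (snd p) else \<psi>1 n (snd p))" for n p
  define h where "h n p = (if fst p = const_simplex n 0 then h0 n (snd p) else h1 n (snd p))" for n p
  have cc: "compose {..j} (const_simplex n i) (mx j A) = const_simplex j i" if "flag n j A" for n j i A
    by (rule const_simplex_compose[OF mx_ord[OF that]])
  have Sc: "\<exists>y\<in>simplices X n. p = (const_simplex n 0, y) \<or> p = (const_simplex n 1, y)" if "p \<in> S n" for n p
    using that by (auto simp: S_def)
  have "cyl_family ?P K S (flag_family D) \<psi>"
    unfolding cyl_family_def
  proof (intro conjI allI ballI)
    fix n p assume "p \<in> S n"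
    then obtain y where y: "y \<in> simplices X n" "p = (const_simplex n 0, y) \<or> p = (const_simplex n 1, y)" using Sc by blast
    show "\<psi> n p \<in> sset_hom (cplx jle (cyl.lev n)) K"
      using y(2) cyl_family_hom[OF 0(1) y(1)] cyl_family_hom[OF 1(1) y(1)] by (auto simp: \<psi>_def)
    show "\<psi> n p j c = flag_family D n p j c" if c: "c \<in> cyl.bseqs n j" for j c
      using y(2) cyl_family_base[OF 0(1) y(1) c] cyl_family_base[OF 1(1) y(1) c] c01[of n] c
        Hends[OF bchain_in[OF X y(1) blev_fseq(1)[OF c]]] cc[OF blev_fseq(1)[OF c]]
      by (auto simp: \<psi>_def subdiv_family_def flag_family_def D_def)
    show "\<psi> k (act ?P k n \<alpha> p) j c = \<psi> n p j (cyl.shift \<alpha> j c)"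
      if "\<alpha> \<in> inj_maps k n" "c \<in> cyl.seqs k j" for k \<alpha> j c
      using y(2) cyl_family_nat[OF 0(1) y(1) that] cyl_family_nat[OF 1(1) y(1) that] c01[of k] c01[of n]
        const_simplex_compose[OF inj_maps_ord[OF that(1)]] by (auto simp: \<psi>_def)
  qed
  moreover have "straightens ?P K S (vert \<psi>) h"
  proof (rule straightensI)
    fix n p assume "p \<in> S n"
    then obtain y where y: "y \<in> simplices X n" "p = (const_simplex n 0, y) \<or> p = (const_simplex n 1, y)" using Sc by blast
    show "h n p t \<in> simplices K n" if "t \<in> ord_maps n 1" for t
      using y(2) straightens_in[OF 0(2) y(1) that] straightens_in[OF 1(2) y(1) that] by (auto simp: h_def)
    show "h n p (const_simplex n 0) = vert \<psi> n p"
      using y(2) straightens_zero[OF 0(2) y(1)] straightens_zero[OF 1(2) y(1)] c01[of n]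
      by (auto simp: h_def vert_def \<psi>_def)
    show "h k (act ?P k n \<sigma> p) (compose {..k} t \<sigma>) = act K k n \<sigma> (h n p t)"
      if "\<sigma> \<in> ord_maps k n" "t \<in> ord_maps n 1" "inj_on \<sigma> {i. i \<le> k \<and> t (\<sigma> i) = 0}" for k \<sigma> t
      using y(2) straightens_act[OF 0(2) that(1) y(1) that(2,3)] straightens_act[OF 1(2) that(1) y(1) that(2,3)] c01[of k] c01[of n]
        const_simplex_compose[OF that(1)] by (auto simp: h_def)
  qed
  ultimately have "resolves ?P K S (flag_family D) \<psi> h" by (simp add: resolves_def)
  from resolution_exists[OF P K S d this] obtain \<psi>' h' where r: "resolves ?P K (simplices ?P) (flag_family D) \<psi>' h'"
    and agree: "\<And>n p t. p \<in> S n \<Longrightarrow> t \<in> ord_maps n 1 \<Longrightarrow> h' n p t = h n p t" by blast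
  then have F: "end_map ?P h' \<in> sset_hom ?P K" using end_map_hom[OF P] unfolding resolves_def by blast
  have t1: "const_simplex n 1 \<in> ord_maps n 1" "const_simplex n 0 \<in> ord_maps n 1" for n by (simp_all add: const_simplex_ord)
  have "end_map ?P h' n (const_simplex n 0, x) = f0 n x \<and> end_map ?P h' n (const_simplex n 1, x) = f1 n x"
    if x: "x \<in> simplices X n" for n x
    using agree[of "(const_simplex n 0, x)" n, OF _ t1(1)] agree[of "(const_simplex n 1, x)" n, OF _ t1(1)] x t1 c01[of n] 0(3) 1(3)
    by (simp add: end_map_def S_def h_def)
  then show ?thesis
    unfolding elementary_homotopic_def using F resolved_by_hom[OF X r0] resolved_by_hom[OF X r1] by blast
qed

section \<open>Bijectivity on homotopy classes\<close>

theorem last_vertex_surj: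
  assumes X: "simplicial_set X" and K: "kan_complex K" and g: "g \<in> sset_hom (subdiv X) K"
  obtains f where "f \<in> sset_hom X K" "sset_homotopic (subdiv X) K (sset_comp (subdiv X) f (last_vertex X)) g"
proof -
  obtain f where f: "resolved_by X K g f" using resolved_by_exists[OF X K g] .
  then obtain \<psi> h where "resolves X K (simplices X) (subdiv_family X g) \<psi> h" "f = end_map X h"
    unfolding resolved_by_def by blast
  then have "sset_homotopic (subdiv X) K g (sset_comp (subdiv X) f (last_vertex X))"
    using resolved_homotopic[OF X kan_simplicial[OF K] g] by blast
  then show ?thesis using that resolved_by_hom[OF X f] sset_homotopic_sym by blast
qed

text \<open>The given homotopy is a zigzag of elementary ones, and each of them is converted into a
  homotopy between resolutions. At the two ends \<open>f\<close> and \<open>f'\<close> are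
  themselves resolutions of the composites.\<close>

theorem last_vertex_inj:
  fixes X :: "'a sset" and K :: "'k sset"
  assumes X: "simplicial_set X" and K: "kan_complex K" and f: "f \<in> sset_hom X K" "f' \<in> sset_hom X K"
    and hom: "sset_homotopic (subdiv X) K (sset_comp (subdiv X) f (last_vertex X)) (sset_comp (subdiv X) f' (last_vertex X))"
  shows "sset_homotopic X K f f'"
proof -
  note sK = kan_simplicial[OF K] and sub = simplicial_set_subdiv[OF X]
  let ?g = "sset_comp (subdiv X) f (last_vertex X)"
  have g: "?g \<in> sset_hom (subdiv X) K" using hom by (simp add: sset_homotopic_def)
  have "equivclp (elementary_homotopic (subdiv X) K) ?g (sset_comp (subdiv X) f' (last_vertex X))"
    using hom by (simp add: sset_homotopic_def)
  \<comment> \<open>The induction claim ranges over all resolutions of the current map, because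
    consecutive steps of the zigzag may have been resolved by different choices.\<close>
  then have "\<forall>u. resolved_by X K (sset_comp (subdiv X) f' (last_vertex X)) u \<longrightarrow> sset_homotopic X K f u"
  proof (induction rule: equivclp_induct)
    case base
    show ?case
      using resolved_by_homotopic[OF X K elementary_homotopic_refl[OF sub g] resolved_by_last_vertex[OF X sK f(1)]]
        elementary_sset_homotopic by blast
  next
    case (step y z)
    have y: "y \<in> sset_hom (subdiv X) K" using step.hyps(2) by (auto simp: elementary_homotopic_def)
    obtain u where u: "resolved_by X K y u" using resolved_by_exists[OF X K y] .
    show ?case
    proof (intro allI impI)
      fix v assume v: "resolved_by X K z v"
      have "sset_homotopic X K u v"
        using step.hyps(2) resolved_by_homotopic[OF X K _ u v] resolved_by_homotopic[OF X K _ v u]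
          elementary_sset_homotopic sset_homotopic_sym by blast
      then show "sset_homotopic X K f v" using step.IH u sset_homotopic_trans by blast
    qed
  qed
  then show ?thesis using resolved_by_last_vertex[OF X sK f(2)] by blast
qed

section \<open>Weak homotopy equivalences\<close>

lemma sset_comp_assoc:
  assumes "f \<in> sset_hom A B"
  shows "sset_comp A (sset_comp B h g) f = sset_comp A h (sset_comp A g f)"
proof (intro ext)
  show "sset_comp A (sset_comp B h g) f n x = sset_comp A h (sset_comp A g f) n x" for n x
    using hom_in[OF assms, of x n] by (cases "x \<in> simplices A n") (simp_all add: sset_comp_def compose_def)
qed

lemma sset_comp_id_left:
  assumes "f \<in> sset_hom A B"
  shows "sset_comp A (sset_id B) f = f"
proof -
  have "f n \<in> extensional (simplices A n)" for n using assms by (auto simp: sset_hom_def PiE_def)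
  then show ?thesis
    using hom_in[OF assms] by (auto simp: sset_comp_def sset_id_def compose_def fun_eq_iff extensional_def)
qed

lemma elementary_homotopic_postcomp:
  assumes A: "simplicial_set A" and k: "k \<in> sset_hom K L" and e: "elementary_homotopic A K u v"
  shows "elementary_homotopic A L (sset_comp A k u) (sset_comp A k v)"
proof -
  let ?P = "sset_prod (std_simplex 1) A"
  have P: "simplicial_set ?P" by (rule simplicial_set_prod[OF simplicial_set_std_simplex A])
  obtain H where H: "H \<in> sset_hom ?P K" "\<And>n x. x \<in> simplices A n \<Longrightarrow>
      H n (const_simplex n 0, x) = u n x \<and> H n (const_simplex n 1, x) = v n x"
    and uv: "u \<in> sset_hom A K" "v \<in> sset_hom A K"
    using e unfolding elementary_homotopic_def by blast
  have "sset_comp ?P k H n (const_simplex n 0, x) = sset_comp A k u n x \<and>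
      sset_comp ?P k H n (const_simplex n 1, x) = sset_comp A k v n x" if "x \<in> simplices A n" for n x
    using H(2)[OF that] that const_simplex_ord by (simp add: sset_comp_apply)
  then show ?thesis
    unfolding elementary_homotopic_def using sset_comp_hom[OF P H(1) k] sset_comp_hom[OF A _ k] uv by blast
qed

lemma elementary_homotopic_precomp:
  assumes A: "simplicial_set A" and i: "i \<in> sset_hom A B" and e: "elementary_homotopic B K u v"
  shows "elementary_homotopic A K (sset_comp A u i) (sset_comp A v i)"
proof -
  let ?P = "sset_prod (std_simplex 1) A"
  have P: "simplicial_set ?P" by (rule simplicial_set_prod[OF simplicial_set_std_simplex A])
  obtain H where H: "H \<in> sset_hom (sset_prod (std_simplex 1) B) K" "\<And>n x. x \<in> simplices B n \<Longrightarrow>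
      H n (const_simplex n 0, x) = u n x \<and> H n (const_simplex n 1, x) = v n x"
    and uv: "u \<in> sset_hom B K" "v \<in> sset_hom B K"
    using e unfolding elementary_homotopic_def by blast
  let ?H = "\<lambda>n. restrict (\<lambda>p. H n (fst p, i n (snd p))) (simplices ?P n)"
  have hH: "?H \<in> sset_hom ?P K"
  proof (rule hom_restrictI[OF P])
    fix n p assume "p \<in> simplices ?P n"
    then obtain t x where p: "p = (t, x)" "t \<in> ord_maps n 1" "x \<in> simplices A n" by auto
    have tx: "(t, i n x) \<in> simplices (sset_prod (std_simplex 1) B) n" using p hom_in[OF i p(3)] by simp
    show "H n (fst p, i n (snd p)) \<in> simplices K n" using hom_in[OF H(1) tx] p(1) by simp
    show "H m (fst (act ?P m n \<theta> p), i m (snd (act ?P m n \<theta> p))) = act K m n \<theta> (H n (fst p, i n (snd p)))"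
      if "\<theta> \<in> ord_maps m n" for m \<theta>
      using hom_act[OF H(1) that tx] hom_act[OF i that p(3)] p(1) by simp
  qed
  have ev: "?H n (const_simplex n 0, x) = sset_comp A u i n x \<and> ?H n (const_simplex n 1, x) = sset_comp A v i n x"
    if "x \<in> simplices A n" for n x
    using H(2)[OF hom_in[OF i that]] that const_simplex_ord by (simp add: sset_comp_apply)
  show ?thesis
    unfolding elementary_homotopic_def
    by (intro conjI bexI[OF _ hH] allI ballI sset_comp_hom[OF A i uv(1)] sset_comp_hom[OF A i uv(2)] conjunct1[OF ev] conjunct2[OF ev])
qed

lemma equivclp_map:
  assumes "equivclp R a b" "\<And>a b. R a b \<Longrightarrow> Q (F a) (F b)"
  shows "equivclp Q (F a) (F b)"
  using assms(1)
proof (induction rule: equivclp_induct)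
  case (step y z)
  then have "equivclp Q (F y) (F z)"
    using assms(2) by (metis equivclp_sym r_into_equivclp)
  then show ?case using step.IH equivclp_trans by metis
qed simp

lemma sset_homotopic_postcomp:
  assumes A: "simplicial_set A" and k: "k \<in> sset_hom K L" and h: "sset_homotopic A K u v"
  shows "sset_homotopic A L (sset_comp A k u) (sset_comp A k v)"
proof -
  have "equivclp (elementary_homotopic A L) (sset_comp A k u) (sset_comp A k v)"
    by (rule equivclp_map[where R = "elementary_homotopic A K" and F = "sset_comp A k"])
       (use h elementary_homotopic_postcomp[OF A k] in \<open>auto simp: sset_homotopic_def\<close>)
  then show ?thesis using h sset_comp_hom[OF A _ k] by (simp add: sset_homotopic_def)
qed

lemma sset_homotopic_precomp:
  assumes A: "simplicial_set A" and i: "i \<in> sset_hom A B" and h: "sset_homotopic B K u v"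
  shows "sset_homotopic A K (sset_comp A u i) (sset_comp A v i)"
proof -
  have "equivclp (elementary_homotopic A K) (sset_comp A u i) (sset_comp A v i)"
  proof (rule equivclp_map[where R = "elementary_homotopic B K" and F = "\<lambda>w. sset_comp A w i"])
    show "equivclp (elementary_homotopic B K) u v" using h by (simp add: sset_homotopic_def)
  qed (rule elementary_homotopic_precomp[OF A i])
  moreover have "u \<in> sset_hom B K" "v \<in> sset_hom B K" using h by (simp_all add: sset_homotopic_def)
  note this[THEN sset_comp_hom[OF A i]]
  ultimately show ?thesis by (simp add: sset_homotopic_def)
qed

text \<open>Bijectivity on homotopy classes expressed by maps, with the type of \<open>K\<close>
  left free, unlike in the definition of weak homotopy equivalences.\<close>

definition test_bijective :: "'a sset \<Rightarrow> 'b sset \<Rightarrow> (nat \<Rightarrow> 'a \<Rightarrow> 'b) \<Rightarrow> 'k sset \<Rightarrow> bool" where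
  "test_bijective A B i K \<longleftrightarrow>
    (\<forall>u\<in>sset_hom A K. \<exists>v\<in>sset_hom B K. sset_homotopic A K (sset_comp A v i) u) \<and>
    (\<forall>v\<in>sset_hom B K. \<forall>v'\<in>sset_hom B K. sset_homotopic A K (sset_comp A v i) (sset_comp A v' i) \<longrightarrow>
      sset_homotopic B K v v')"

lemma homotopy_classes_alt: "homotopy_classes A K = (\<lambda>v. {w. sset_homotopic A K v w}) ` sset_hom A K"
  by (auto simp: homotopy_classes_def quotient_def)

lemma homotopy_class_eq_iff:
  assumes "v \<in> sset_hom A K" "w \<in> sset_hom A K"
  shows "{u. sset_homotopic A K v u} = {u. sset_homotopic A K w u} \<longleftrightarrow> sset_homotopic A K v w"
  using assms by (blast intro: sset_homotopic_refl sset_homotopic_sym sset_homotopic_trans)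

lemma bij_betw_classes_iff:
  assumes A: "simplicial_set A" and i: "i \<in> sset_hom A B"
  shows "bij_betw (\<lambda>C. {u. \<exists>v\<in>C. sset_homotopic A K (sset_comp A v i) u})
      (homotopy_classes B K) (homotopy_classes A K) \<longleftrightarrow> test_bijective A B i K"
proof -
  let ?\<Phi> = "\<lambda>C. {u. \<exists>v\<in>C. sset_homotopic A K (sset_comp A v i) u}"
  let ?B = "\<lambda>v. {w. sset_homotopic B K v w}" and ?A = "\<lambda>u. {w. sset_homotopic A K u w}"
  have \<Phi>: "?\<Phi> (?B v) = ?A (sset_comp A v i)" if v: "v \<in> sset_hom B K" for v
  proof (intro equalityI subsetI; clarify)
    fix u w assume "sset_homotopic B K v w" "sset_homotopic A K (sset_comp A w i) u"
    then show "sset_homotopic A K (sset_comp A v i) u"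
      using sset_homotopic_precomp[OF A i] sset_homotopic_trans by blast
  next
    fix u assume "sset_homotopic A K (sset_comp A v i) u"
    then show "\<exists>w\<in>?B v. sset_homotopic A K (sset_comp A w i) u" using sset_homotopic_refl[OF v] by blast
  qed
  have comp: "sset_comp A v i \<in> sset_hom A K" if "v \<in> sset_hom B K" for v using sset_comp_hom[OF A i that] .
  have im: "?\<Phi> ` homotopy_classes B K = (\<lambda>v. ?A (sset_comp A v i)) ` sset_hom B K"
    unfolding homotopy_classes_alt image_image using \<Phi> by (rule image_cong[OF refl])
  have inj: "inj_on ?\<Phi> (homotopy_classes B K) \<longleftrightarrow>
    (\<forall>v\<in>sset_hom B K. \<forall>v'\<in>sset_hom B K. sset_homotopic A K (sset_comp A v i) (sset_comp A v' i) \<longrightarrow> sset_homotopic B K v v')"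
  proof -
    have "inj_on ?\<Phi> (?B ` sset_hom B K) \<longleftrightarrow>
      (\<forall>v\<in>sset_hom B K. \<forall>v'\<in>sset_hom B K. ?\<Phi> (?B v) = ?\<Phi> (?B v') \<longrightarrow> ?B v = ?B v')"
      unfolding inj_on_def by blast
    also have "\<dots> \<longleftrightarrow> (\<forall>v\<in>sset_hom B K. \<forall>v'\<in>sset_hom B K.
      sset_homotopic A K (sset_comp A v i) (sset_comp A v' i) \<longrightarrow> sset_homotopic B K v v')"
    proof (intro ball_cong refl)
      fix v v' assume v: "v \<in> sset_hom B K" "v' \<in> sset_hom B K"
      show "(?\<Phi> (?B v) = ?\<Phi> (?B v') \<longrightarrow> ?B v = ?B v') \<longleftrightarrow>
        (sset_homotopic A K (sset_comp A v i) (sset_comp A v' i) \<longrightarrow> sset_homotopic B K v v')"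
        unfolding \<Phi>[OF v(1)] \<Phi>[OF v(2)] homotopy_class_eq_iff[OF v] homotopy_class_eq_iff[OF comp[OF v(1)] comp[OF v(2)]] ..
    qed
    finally show ?thesis unfolding homotopy_classes_alt .
  qed
  have surj: "?\<Phi> ` homotopy_classes B K = homotopy_classes A K \<longleftrightarrow>
    (\<forall>u\<in>sset_hom A K. \<exists>v\<in>sset_hom B K. sset_homotopic A K (sset_comp A v i) u)"
  proof
    assume L: "?\<Phi> ` homotopy_classes B K = homotopy_classes A K"
    show "\<forall>u\<in>sset_hom A K. \<exists>v\<in>sset_hom B K. sset_homotopic A K (sset_comp A v i) u"
    proof
      fix u assume u: "u \<in> sset_hom A K"
      then have "?A u \<in> homotopy_classes A K" unfolding homotopy_classes_alt by (rule imageI)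
      then have "?A u \<in> (\<lambda>v. ?A (sset_comp A v i)) ` sset_hom B K" unfolding L[symmetric] im .
      then obtain v where "v \<in> sset_hom B K" "?A u = ?A (sset_comp A v i)" by blast
      then show "\<exists>v\<in>sset_hom B K. sset_homotopic A K (sset_comp A v i) u" using sset_homotopic_refl[OF u] by blast
    qed
  next
    assume R: "\<forall>u\<in>sset_hom A K. \<exists>v\<in>sset_hom B K. sset_homotopic A K (sset_comp A v i) u"
    show "?\<Phi> ` homotopy_classes B K = homotopy_classes A K"
      unfolding im
    proof (intro equalityI subsetI)
      fix C assume "C \<in> homotopy_classes A K"
      then obtain u where u: "u \<in> sset_hom A K" "C = ?A u" by (auto simp: homotopy_classes_alt)
      then obtain v where v: "v \<in> sset_hom B K" "sset_homotopic A K (sset_comp A v i) u" using R by blast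
      then have "C = ?A (sset_comp A v i)" using homotopy_class_eq_iff[OF comp[OF v(1)] u(1)] u(2) by simp
      then show "C \<in> (\<lambda>v. ?A (sset_comp A v i)) ` sset_hom B K" using v(1) by blast
    qed (use comp in \<open>auto simp: homotopy_classes_alt\<close>)
  qed
  show ?thesis unfolding bij_betw_def inj surj test_bijective_def by blast
qed

section \<open>Transport along injections of types\<close>

text \<open>An isomorphic copy over another type; on simplices of the copy \<open>inv e\<close> is
  applied only to values of \<open>e\<close>.\<close>

definition transport :: "('a \<Rightarrow> 'c) \<Rightarrow> 'a sset \<Rightarrow> 'c sset" where
  "transport e X = \<lparr> simplices = (\<lambda>n. e ` simplices X n), act = (\<lambda>m n \<theta> z. e (act X m n \<theta> (inv e z))) \<rparr>"

lemma transport_maps: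
  assumes X: "simplicial_set X" and e: "inj e"
  defines "k \<equiv> (\<lambda>n. restrict e (simplices X n))"
    and "k' \<equiv> (\<lambda>n. restrict (inv e) (simplices (transport e X) n))"
  shows "simplicial_set (transport e X)" "k \<in> sset_hom X (transport e X)" "k' \<in> sset_hom (transport e X) X"
    "sset_comp X k' k = sset_id X" "sset_comp (transport e X) k k' = sset_id (transport e X)"
proof -
  have ie: "inv e (e x) = x" for x using e by simp
  show T: "simplicial_set (transport e X)"
    unfolding simplicial_set_def transport_def
    using act_closed[OF X] act_id[OF X] act_comp[OF X] by (auto simp: ie)
  show "k \<in> sset_hom X (transport e X)"
    unfolding k_def by (rule hom_restrictI[OF X]) (auto simp: transport_def ie)
  show "k' \<in> sset_hom (transport e X) X"
    unfolding k'_def by (rule hom_restrictI[OF T]) (auto simp: transport_def ie)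
  show "sset_comp X k' k = sset_id X"
    by (auto simp: sset_comp_def sset_id_def compose_def k_def k'_def transport_def ie fun_eq_iff)
  show "sset_comp (transport e X) k k' = sset_id (transport e X)"
    by (auto simp: sset_comp_def sset_id_def compose_def k_def k'_def transport_def ie fun_eq_iff)
qed

lemma kan_transport:
  assumes X: "kan_complex X" and e: "inj e"
  shows "kan_complex (transport e X)"
proof -
  note sX = kan_simplicial[OF X]
  define k where "k = (\<lambda>n. restrict e (simplices X n))"
  define k' where "k' = (\<lambda>n. restrict (inv e) (simplices (transport e X) n))"
  note T = transport_maps[OF sX e, folded k_def k'_def]
  have "\<exists>g\<in>sset_hom (std_simplex n) (transport e X). \<forall>m. \<forall>\<sigma>\<in>simplices (horn n i) m. g m \<sigma> = f m \<sigma>"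
    if n: "1 \<le> n" "i \<le> n" and f: "f \<in> sset_hom (horn n i) (transport e X)" for n i f
  proof -
    obtain g where g: "g \<in> sset_hom (std_simplex n) X"
      "\<And>m \<sigma>. \<sigma> \<in> simplices (horn n i) m \<Longrightarrow> g m \<sigma> = sset_comp (horn n i) k' f m \<sigma>"
      using kan_filler[OF X n sset_comp_hom[OF simplicial_set_horn f T(3)]] by blast
    have "sset_comp (std_simplex n) k g m \<sigma> = f m \<sigma>" if \<sigma>: "\<sigma> \<in> simplices (horn n i) m" for m \<sigma>
    proof -
      have "\<sigma> \<in> simplices (std_simplex n) m" using \<sigma> by (simp add: horn_def)
      then have "sset_comp (std_simplex n) k g m \<sigma> = sset_comp (transport e X) k k' m (f m \<sigma>)"
        using g(2)[OF \<sigma>] \<sigma> hom_in[OF f \<sigma>] by (simp add: sset_comp_apply)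
      then show ?thesis using T(5) hom_in[OF f \<sigma>] by (simp add: sset_id_def)
    qed
    then show ?thesis using sset_comp_hom[OF simplicial_set_std_simplex g(1) T(2)] by blast
  qed
  then show ?thesis using T(1) by (simp add: kan_complex_def)
qed

text \<open>The isomorphism between \<open>K\<close> and its copy carries maps and homotopies in
  both directions, so a test against the copy is a test against \<open>K\<close>.\<close>

lemma test_bijective_transport:
  assumes A: "simplicial_set A" and B: "simplicial_set B" and i: "i \<in> sset_hom A B"
    and K: "simplicial_set K" and e: "inj e" and t: "test_bijective A B i (transport e K)"
  shows "test_bijective A B i K"
proof -
  define k where "k = (\<lambda>n. restrict e (simplices K n))"
  define k' where "k' = (\<lambda>n. restrict (inv e) (simplices (transport e K) n))"
  note T = transport_maps[OF K e, folded k_def k'_def]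
  have retrA: "sset_comp A k' (sset_comp A k u) = u" if "u \<in> sset_hom A K" for u
    using sset_comp_assoc[OF that, of k' k] T(4) sset_comp_id_left[OF that] by simp
  have retrB: "sset_comp B k' (sset_comp B k u) = u" if "u \<in> sset_hom B K" for u
    using sset_comp_assoc[OF that, of k' k] T(4) sset_comp_id_left[OF that] by simp
  show ?thesis
    unfolding test_bijective_def
  proof (intro conjI ballI impI)
    fix u assume u: "u \<in> sset_hom A K"
    then obtain v where v: "v \<in> sset_hom B (transport e K)" "sset_homotopic A (transport e K) (sset_comp A v i) (sset_comp A k u)"
      using t sset_comp_hom[OF A u T(2)] unfolding test_bijective_def by blast
    have "sset_homotopic A K (sset_comp A (sset_comp B k' v) i) u"
      using sset_homotopic_postcomp[OF A T(3) v(2)] retrA[OF u] sset_comp_assoc[OF i, of k' v] by simp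
    then show "\<exists>v\<in>sset_hom B K. sset_homotopic A K (sset_comp A v i) u"
      using sset_comp_hom[OF B v(1) T(3)] by blast
  next
    fix v v' assume v: "v \<in> sset_hom B K" "v' \<in> sset_hom B K" and h: "sset_homotopic A K (sset_comp A v i) (sset_comp A v' i)"
    have "sset_homotopic A (transport e K) (sset_comp A (sset_comp B k v) i) (sset_comp A (sset_comp B k v') i)"
      using sset_homotopic_postcomp[OF A T(2) h] by (simp add: sset_comp_assoc[OF i])
    then have "sset_homotopic B (transport e K) (sset_comp B k v) (sset_comp B k v')"
      using t sset_comp_hom[OF B _ T(2)] v unfolding test_bijective_def by blast
    then show "sset_homotopic B K v v'"
      using sset_homotopic_postcomp[OF B T(3)] retrB[OF v(1)] retrB[OF v(2)] by metis
  qed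
qed

lemma test_bijective_last_vertex:
  assumes X: "simplicial_set X" and K: "kan_complex K"
  shows "test_bijective (subdiv X) X (last_vertex X) K"
  unfolding test_bijective_def using last_vertex_surj[OF X K] last_vertex_inj[OF X K] by blast

section \<open>Existence and uniqueness of the Kan completion\<close>

theorem kan_completion_last_vertex:
  assumes "kan_complex X"
  shows "kan_completion (subdiv X) X (last_vertex X)"
proof -
  note X = kan_simplicial[OF assms]
  note l = last_vertex_hom[OF X] and S = simplicial_set_subdiv[OF X]
  show ?thesis
    unfolding kan_completion_def weak_homotopy_equivalence_def bij_betw_classes_iff[OF S l]
    using assms l test_bijective_last_vertex[OF X] by blast
qed

theorem lemma5p4:
  fixes X :: "'a sset"
  assumes "kan_complex X"
  shows "(\<exists>(Y' :: 'a sset) i. kan_completion (subdiv X) Y' i) \<and>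
         (\<forall>(Y' :: 'b sset) i. kan_completion (subdiv X) Y' i \<longrightarrow> homotopy_equivalent Y' X)"
proof (intro conjI allI impI)
  show "\<exists>(Y' :: 'a sset) i. kan_completion (subdiv X) Y' i"
    using kan_completion_last_vertex[OF assms] by blast
next
  fix Y' :: "'b sset" and i
  assume c: "kan_completion (subdiv X) Y' i"
  let ?S = "subdiv X" and ?l = "last_vertex X"
  note X = kan_simplicial[OF assms]
  note l = last_vertex_hom[OF X] and S = simplicial_set_subdiv[OF X]
  have Y: "kan_complex Y'" and i: "i \<in> sset_hom ?S Y'"
    using c by (simp_all add: kan_completion_def weak_homotopy_equivalence_def)
  note Y' = kan_simplicial[OF Y]
  have test: "test_bijective ?S Y' i K"
    if "kan_complex K" for K :: "((nat \<Rightarrow> 'a simplex_obj) \<times> (nat \<times> nat \<Rightarrow> nat \<Rightarrow> nat), 'b) test_simplex sset"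
    using c that by (simp add: kan_completion_def weak_homotopy_equivalence_def bij_betw_classes_iff[OF S i])
  \<comment> \<open>Only injectivity of these encodings matters. A value \<open>x\<close> is stored
    as the constant map of an object with dimension 0; the zeros are fillers, and the result need
    not be a simplex of the subdivision.\<close>
  define eX :: "'a \<Rightarrow> ((nat \<Rightarrow> 'a simplex_obj) \<times> (nat \<times> nat \<Rightarrow> nat \<Rightarrow> nat), 'b) test_simplex"
    where "eX x = {Inr (Inl (\<lambda>_. (0, \<lambda>_ _. x), \<lambda>_ _. 0))}" for x
  define eY :: "'b \<Rightarrow> ((nat \<Rightarrow> 'a simplex_obj) \<times> (nat \<times> nat \<Rightarrow> nat \<Rightarrow> nat), 'b) test_simplex"
    where "eY y = {Inr (Inr y)}" for y
  have inj: "inj eX" "inj eY" by (auto simp: inj_def eX_def eY_def fun_eq_iff)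
  have tX: "test_bijective ?S Y' i X"
    by (rule test_bijective_transport[OF S Y' i X inj(1) test[OF kan_transport[OF assms inj(1)]]])
  have tY: "test_bijective ?S Y' i Y'"
    by (rule test_bijective_transport[OF S Y' i Y' inj(2) test[OF kan_transport[OF Y inj(2)]]])
  \<comment> \<open>Testing \<open>i\<close> against \<open>X\<close> extends the last vertex map
    over \<open>Y'\<close>, and testing the last vertex map against \<open>Y'\<close> extends
    \<open>i\<close> over \<open>X\<close>, in both cases up to homotopy.\<close>
  obtain v where v: "v \<in> sset_hom Y' X" "sset_homotopic ?S X (sset_comp ?S v i) ?l"
    using tX l unfolding test_bijective_def by blast
  obtain w where w: "w \<in> sset_hom X Y'" "sset_homotopic ?S Y' (sset_comp ?S w ?l) i"
    using test_bijective_last_vertex[OF X Y] i unfolding test_bijective_def by blast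
  \<comment> \<open>Both composites agree with the identity after precomposition with the map from
    the subdivision, and injectivity on homotopy classes cancels that map.\<close>
  have "sset_homotopic ?S X (sset_comp ?S (sset_comp X v w) ?l) (sset_comp ?S (sset_id X) ?l)"
    using sset_homotopic_trans[OF sset_homotopic_postcomp[OF S v(1) w(2)] v(2)]
    by (simp add: sset_comp_assoc[OF l] sset_comp_id_left[OF l])
  then have "sset_homotopic X X (sset_comp X v w) (sset_id X)"
    using test_bijective_last_vertex[OF X assms] sset_comp_hom[OF X w(1) v(1)] sset_id_hom[OF X]
    unfolding test_bijective_def by blast
  moreover have "sset_homotopic ?S Y' (sset_comp ?S (sset_comp Y' w v) i) (sset_comp ?S (sset_id Y') i)"
    using sset_homotopic_trans[OF sset_homotopic_postcomp[OF S w(1) v(2)] w(2)]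
    by (simp add: sset_comp_assoc[OF i] sset_comp_id_left[OF i])
  then have "sset_homotopic Y' Y' (sset_comp Y' w v) (sset_id Y')"
    using tY sset_comp_hom[OF Y' v(1) w(1)] sset_id_hom[OF Y'] unfolding test_bijective_def by blast
  ultimately show "homotopy_equivalent Y' X"
    unfolding homotopy_equivalent_def homotopy_equivalence_def using v(1) w(1) by blast
qed

end
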